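(* Let $(\Gamma,\psi)$ be a totally reduced GBS graph with one qc-class $Q$ such that $\mathrm{supp}_{\mathrm{qc}}(Q)\neq\emptyset$. Suppose that $(\Gamma,\psi)$ is clean, has floating pieces, and has full-support gaps. Then for every family $F_0$ of $Q$ and every choice of minimal points $m_F\in F$, one for each family $F\neq F_0$ of $Q$, one can bring $(\Gamma,\psi)$ to normal form with respect to $F_0$ and $\{m_F\}_{F\ne F_0}$ by a (finite) sequence of slides, swaps and connections.
   Context: A graph (in the sense of Serre) has a vertex set $V$, an edge set $E$, a fixed-point-free involution $e\mapsto\bar e$ on $E$, an initial-vertex map $\iota:E\to V$, and $\tau(e)=\iota(\bar e)$. A GBS graph $(\Gamma,\psi)$ is a finite connected graph $\Gamma$ with a function $\psi:E(\Gamma)\to\mathbb Z\setminus\{0\}$; it encodes the graph of groups with all vertex and edge groups $\mathbb Z$ and edge maps $G_e\to G_{\tau(e)}$ given by multiplication by $\psi(e)$, and its GBS group is the fundamental group. It is totally reduced if it has the minimal number of vertices and edges among GBS graphs with isomorphic GBS group. Let $\mathcal P$ be the finite set of primes dividing some $\psi(e)$, and $\mathbf A=\mathbb Z/2\mathbb Z\oplus\bigoplus_{r\in\mathcal P}\mathbb Z$. For $\mathbf a=(a_0,(a_r)_r)\in\mathbf A$ write $\mathbf a\ge\mathbf 0$ if $a_r\ge0$ for all $r\in\mathcal P$ (no condition on $a_0$); $\mathbf A^+=\{\mathbf a\ge\mathbf 0\}$; $\mathrm{supp}(\mathbf a)=\{r\in\mathcal P:a_r\ne0\}$; $\boldsymbol\varepsilon\in\mathbf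 A$ is the element of order 2. The affine representation $\Lambda$ is the graph with $V(\Lambda)=V(\Gamma)\times\mathbf A^+$, $E(\Lambda)=E(\Gamma)$, same reverse map, and $\tau_\Lambda(e)=(\tau_\Gamma(e),(a_0,(a_r)_r))$ where $\psi(e)=(-1)^{a_0}\prod_r r^{a_r}$. Below $\iota(e),\tau(e)$ denote endpoints in $\Lambda$. Put $(v,\mathbf a)+\mathbf w=(v,\mathbf a+\mathbf w)$, and $p\le p'$ if $p'=p+\mathbf w$ with $\mathbf w\in\mathbf A^+$ (then $\mathbf w$ is the gap from $p$ to $p'$). An affine path from $p$ to $p'$ is a sequence of edges $(e_1,\dots,e_\ell)$, $\ell\ge0$, for which there are $\mathbf w_i\in\mathbf A^+$ with $\iota(e_1)+\mathbf w_1=p$, $\tau(e_\ell)+\mathbf w_\ell=p'$, $\tau(e_i)+\mathbf w_i=\iota(e_{i+1})+\mathbf w_{i+1}$. Write $p\sim_{\mathrm c}q$ if there is an affine path from $p$ to $q$; $p\preceq_{\mathrm c}q$ if $p\le q'$ for some $q'\sim_{\mathrm c}q$; $p\sim_{\mathrm{qc}}q$ (quasi-conjugate) if $p\preceq_{\mathrm c}q$ and $q\preceq_{\mathrm c}p$. For a quasi-conjugacy class $Q$ and $p\in Q$: $\mathrm{min}_{\mathrm{qc}}(Q)=\{q\in Q:\forall q'\in Q,\ q'\le q\Rightarrow q\le q'\}$ is the set of minimal points; $\mathrm{supp}_{\mathrm{qc}}(Q)=\bigcup\{\mathrm{supp}(\mathbf u):\mathbf u\in\mathbf A^+,\ p+\mathbf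 u\sim_{\mathrm{qc}}p\}$. $(\Gamma,\psi)$ has one qc-class $Q$ if all endpoints of edges lie in $Q$. Convention: minimal points $m$ and $m+\boldsymbol\varepsilon$ are identified and treated as one minimal point; an endpoint is "at $m$" if it equals $m$ or $m+\boldsymbol\varepsilon$. An edge and its reverse count as one edge. A point $p$ lies above $m$ with full-support gap if $p=m+\mathbf w$ with $\mathbf w\in\mathbf A^+$ and $\mathrm{supp}(\mathbf w)=\mathrm{supp}_{\mathrm{qc}}(Q)$. Two points of $Q$ are in the same family if they have the form $(v,\mathbf a),(v,\mathbf b)$ with $\mathrm{supp}(\mathbf b-\mathbf a)\subseteq\mathrm{supp}_{\mathrm{qc}}(Q)$; this partitions $Q$ into finitely many families, each containing a minimal point. $(\Gamma,\psi)$ is clean if every minimal point contains exactly one endpoint of exactly one edge and no edge has both endpoints at minimal points. It has floating pieces if it has strictly more edges than minimal points. An edge is floating if none of its endpoints is at a minimal point. It has full-support gaps if every endpoint of every edge either is at a minimal point or lies above some minimal point with full-support gap. Normal form (with respect to a family $F_0$ and minimal points $m_F\in F$ for families $F\ne F_0$), for a clean GBS graph with one qc-class, $\mathrm{supp}_{\mathrm{qc}}(Q)\ne\emptyset$ and floating pieces: (1) for every family $F\ne F_0$, the unique edge $e$ with $\iota(e)=m_F$ has $\tau(e)\in F_0$, lying above all minimal points of $F_0$ with full-support gap; (2) for every family $F$ and every minimal point $m\in F$ other than $m_F$ (for $F=F_0$, every minimal point), the unique edge $e$ with $\iota(e)=m$ has $\tau(e)\in F$, lying above all minimal points of $F$ with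 full-support gap; (3) for every floating edge $e$, both $\iota(e),\tau(e)$ are in $F_0$ and lie above all minimal points of $F_0$ with full-support gap. Moves ($p\,\text{---}\,q$ denotes an edge of $\Lambda$ with endpoints $p,q$; the two edges involved are distinct and the others are unchanged): Slide: $p\,\text{---}\,q$ and $r\,\text{---}\,p+\mathbf a$ ($\mathbf a\in\mathbf A^+$) become $p\,\text{---}\,q$ and $r\,\text{---}\,q+\mathbf a$. Swap: $p\,\text{---}\,p+\mathbf w_1$ and $q\,\text{---}\,q+\mathbf w_2$ with $\mathbf w_1,\mathbf w_2\in\mathbf A^+$, $p\le q\le p+k_1\mathbf w_1$, $p\le q\le p+k_2\mathbf w_2$ for some $k_1,k_2\in\mathbb N$, become $q\,\text{---}\,q+\mathbf w_1$ and $p\,\text{---}\,p+\mathbf w_2$. Connection: $q\,\text{---}\,p+\mathbf w_1$ and $p\,\text{---}\,p+\mathbf w$ with $\mathbf w,\mathbf w_1,\mathbf w_2\in\mathbf A^+$, $\mathbf w_1+\mathbf w_2=k\mathbf w$, $k\in\mathbb N$, become $p\,\text{---}\,q+\mathbf w_2$ and $q\,\text{---}\,q+\mathbf w$. *)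

theory Defs
  imports
    "HOL-Algebra.Group"
    "HOL-Computational_Algebra.Primes"
    "HOL-Library.Poly_Mapping"
    "HOL-Library.Product_Plus"
    "HOL-Library.Z2"
begin

section \<open>GBS graphs\<close>

record ('v, 'e) gbs =
  gverts :: "'v set"
  gedges :: "'e set"
  grev   :: "'e \<Rightarrow> 'e"
  gini   :: "'e \<Rightarrow> 'v"
  glab   :: "'e \<Rightarrow> int"

definition gter :: "('v, 'e) gbs \<Rightarrow> 'e \<Rightarrow> 'v" where
  "gter G e = gini G (grev G e)"

definition gbs_graph :: "('v, 'e) gbs \<Rightarrow> bool" where
  "gbs_graph G \<longleftrightarrow>
     finite (gverts G) \<and> finite (gedges G) \<and> gverts G \<noteq> {} \<and>
     (\<forall>e\<in>gedges G. grev G e \<in> gedges G \<and> grev G (grev G e) = e \<and> grev G e \<noteq> e \<and>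
        gini G e \<in> gverts G \<and> glab G e \<noteq> 0) \<and>
     (\<forall>u\<in>gverts G. \<forall>v\<in>gverts G. (u, v) \<in> {(gini G e, gter G e) | e. e \<in> gedges G}\<^sup>*)"


section \<open>The fundamental group of the graph of groups\<close>

text \<open>
  The universal group \<open>(*\<^sub>v G\<^sub>v) * F(E)\<close> modulo \<open>rev e = e\<inverse>\<close> and
  \<open>\<psi>\<^bsub>rev e\<^esub>(k) e = e \<psi>\<^sub>e(k)\<close> (for \<open>k\<close> in \<open>G\<^sub>e = \<int>\<close>) is realised on words whose letters
  are elements \<open>Vx v n\<close> (the integer \<open>n\<close> in the vertex group \<open>G\<^sub>v = \<int>\<close>) and edges.
  The fundamental group at \<open>v\<close> consists of the classes of the words that are loops at \<open>v\<close>.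
\<close>

datatype ('v, 'e) letter = Vx 'v int | Ed 'e

inductive word_eq :: "('v, 'e) gbs \<Rightarrow> ('v, 'e) letter list \<Rightarrow> ('v, 'e) letter list \<Rightarrow> bool"
  for G where
  refl: "word_eq G w w"
| sym: "word_eq G w w' \<Longrightarrow> word_eq G w' w"
| trans: "word_eq G w w' \<Longrightarrow> word_eq G w' w'' \<Longrightarrow> word_eq G w w''"
| cong: "word_eq G w w' \<Longrightarrow> word_eq G (x @ w @ y) (x @ w' @ y)"
| vertex_mult: "v \<in> gverts G \<Longrightarrow> word_eq G [Vx v m, Vx v n] [Vx v (m + n)]"
| vertex_one: "v \<in> gverts G \<Longrightarrow> word_eq G [Vx v 0] []"
| edge_inv: "e \<in> gedges G \<Longrightarrow> word_eq G [Ed e, Ed (grev G e)] []"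
| edge_rel: "e \<in> gedges G \<Longrightarrow>
    word_eq G [Vx (gini G e) (glab G (grev G e) * k), Ed e] [Ed e, Vx (gter G e) (glab G e * k)]"

inductive word_path :: "('v, 'e) gbs \<Rightarrow> 'v \<Rightarrow> ('v, 'e) letter list \<Rightarrow> 'v \<Rightarrow> bool"
  for G where
  "v \<in> gverts G \<Longrightarrow> word_path G v [] v"
| "v \<in> gverts G \<Longrightarrow> word_path G v w u \<Longrightarrow> word_path G v (Vx v n # w) u"
| "e \<in> gedges G \<Longrightarrow> word_path G (gter G e) w u \<Longrightarrow> word_path G (gini G e) (Ed e # w) u"

definition word_class :: "('v, 'e) gbs \<Rightarrow> ('v, 'e) letter list \<Rightarrow> ('v, 'e) letter list set" where
  "word_class G w = {w'. word_eq G w w'}"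

definition gbs_group :: "('v, 'e) gbs \<Rightarrow> 'v \<Rightarrow> ('v, 'e) letter list set monoid" where
  "gbs_group G v =
     \<lparr>carrier = {word_class G w | w. word_path G v w v},
      monoid.mult = (\<lambda>X Y. {z. \<exists>x\<in>X. \<exists>y\<in>Y. word_eq G (x @ y) z}),
      one = word_class G []\<rparr>"

text \<open>
  The base points are immaterial, the graphs being connected.  Every finite graph is isomorphic
  to one whose vertices and edges are natural numbers, so competitors of that type suffice.
  \<open>gedges\<close> contains both orientations of each edge, which does not affect the comparison.
\<close>

definition totally_reduced :: "('v, 'e) gbs \<Rightarrow> bool" where
  "totally_reduced G \<longleftrightarrow> gbs_graph G \<and>
     (\<forall>H :: (nat, nat) gbs. gbs_graph H \<longrightarrow>
        (\<exists>v\<in>gverts G. \<exists>u\<in>gverts H. gbs_group G v \<cong> gbs_group H u) \<longrightarrow>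
        card (gverts G) \<le> card (gverts H) \<and> card (gedges G) \<le> card (gedges H))"


section \<open>The affine representation\<close>

definition gprimes :: "('v, 'e) gbs \<Rightarrow> nat set" where
  "gprimes G = {r. prime r \<and> (\<exists>e\<in>gedges G. int r dvd glab G e)}"

text \<open>
  The group \<open>\<int>/2 \<oplus> \<Oplus>\<^sub>r \<int>\<close> is the subgroup of \<open>bit \<times> (nat \<Rightarrow>\<^sub>0 int)\<close> of the elements whose second component
  is supported on \<open>gprimes G\<close>; addition is that of \<open>Product_Plus\<close>.
\<close>

type_synonym avec = "bit \<times> (nat \<Rightarrow>\<^sub>0 int)"
type_synonym 'v apoint = "'v \<times> avec"

definition asupp :: "avec \<Rightarrow> nat set" where
  "asupp a = Poly_Mapping.keys (snd a)"

definition aplus :: "('v, 'e) gbs \<Rightarrow> avec set" where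
  "aplus G = {a. asupp a \<subseteq> gprimes G \<and> (\<forall>r. Poly_Mapping.lookup (snd a) r \<ge> 0)}"

definition aeps :: avec where
  "aeps = (1, 0)"

definition amult :: "nat \<Rightarrow> avec \<Rightarrow> avec" where
  "amult k w = (\<Sum>_<k. w)"

definition label_vec :: "('v, 'e) gbs \<Rightarrow> int \<Rightarrow> avec" where
  "label_vec G n = (THE a. a \<in> aplus G \<and>
     n = (if fst a = 0 then 1 else - 1) *
         (\<Prod>r\<in>gprimes G. int r ^ nat (Poly_Mapping.lookup (snd a) r)))"

text \<open>The vector described in \<open>label_vec\<close> exists and is unique for every edge label.\<close>

lemma gprimes_finite:
  assumes "gbs_graph G"
  shows "finite (gprimes G)"
proof -
  have "gprimes G \<subseteq> (\<Union>e\<in>gedges G. {r. r dvd nat \<bar>glab G e\<bar>})"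
    unfolding gprimes_def by (auto simp: nat_dvd_iff int_dvd_int_iff)
  moreover have "finite (\<Union>e\<in>gedges G. {r. r dvd nat \<bar>glab G e\<bar>})"
    using assms unfolding gbs_graph_def by (intro finite_UN_I finite_divisors_nat) auto
  ultimately show ?thesis by (rule finite_subset)
qed

lemma label_vec_ex1:
  assumes G: "gbs_graph G" and e: "e \<in> gedges G"
  shows "\<exists>!a. a \<in> aplus G \<and>
     glab G e = (if fst a = 0 then 1 else - 1) *
         (\<Prod>r\<in>gprimes G. int r ^ nat (Poly_Mapping.lookup (snd a) r))"
proof -
  let ?P = "gprimes G" and ?n = "glab G e"
  have fin: "finite ?P" by (rule gprimes_finite[OF G])
  have pr: "\<And>r. r \<in> ?P \<Longrightarrow> prime r" by (simp add: gprimes_def)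
  have n0: "?n \<noteq> 0" using G e by (auto simp: gbs_graph_def)
  define N where "N = nat \<bar>?n\<bar>"
  have N0: "N \<noteq> 0" using n0 by (simp add: N_def)
  have pf: "prime_factors N \<subseteq> ?P"
  proof
    fix r assume "r \<in> prime_factors N"
    hence "prime r" "r dvd N" by (auto simp: prime_factors_dvd)
    hence "int r dvd ?n" unfolding N_def by (metis abs_ge_zero dvd_abs_iff int_dvd_int_iff nat_0_le)
    thus "r \<in> ?P" using e \<open>prime r\<close> by (auto simp: gprimes_def)
  qed
  have prodN: "N = (\<Prod>r\<in>?P. r ^ multiplicity r N)"
  proof -
    have "N = (\<Prod>r\<in>prime_factors N. r ^ multiplicity r N)"
      using prime_factorization_nat[of N] N0 by simp
    also have "\<dots> = (\<Prod>r\<in>?P. r ^ multiplicity r N)"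
      using pf fin by (intro prod.mono_neutral_left)
        (auto simp: prime_factors_dvd pr not_dvd_imp_multiplicity_0 N0)
    finally show ?thesis .
  qed
  define f where "f r = (if r \<in> ?P then int (multiplicity r N) else 0)" for r
  have ff: "finite {r. f r \<noteq> 0}" using fin by (rule rev_finite_subset) (auto simp: f_def)
  define a where "a = ((if ?n > 0 then 0 else 1)::bit, Abs_poly_mapping f)"
  have la: "Poly_Mapping.lookup (snd a) = f" using ff by (simp add: a_def)
  show ?thesis
  proof (rule ex1I[of _ a], intro conjI)
    show "a \<in> aplus G"
      unfolding aplus_def asupp_def by (auto simp: in_keys_iff la) (auto simp: f_def split: if_splits)
    have "(\<Prod>r\<in>?P. int r ^ nat (Poly_Mapping.lookup (snd a) r)) = int N"
      unfolding arg_cong[OF prodN, of int] by (simp add: la f_def)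
    thus "?n = (if fst a = 0 then 1 else - 1) * (\<Prod>r\<in>?P. int r ^ nat (Poly_Mapping.lookup (snd a) r))"
      using n0 by (auto simp: a_def N_def)
  next
    fix b assume b: "b \<in> aplus G \<and> ?n = (if fst b = 0 then 1 else - 1) *
       (\<Prod>r\<in>?P. int r ^ nat (Poly_Mapping.lookup (snd b) r))"
    let ?g = "\<lambda>r. nat (Poly_Mapping.lookup (snd b) r)"
    have pos: "(\<Prod>r\<in>?P. int r ^ ?g r) > 0"
      by (intro prod_pos) (auto dest!: pr simp: prime_gt_0_nat)
    have N: "N = (\<Prod>r\<in>?P. r ^ ?g r)"
    proof -
      have "int N = (\<Prod>r\<in>?P. int r ^ ?g r)" using b pos by (auto simp: N_def)
      also have "\<dots> = int (\<Prod>r\<in>?P. r ^ ?g r)" by simp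
      finally show ?thesis by linarith
    qed
    have "multiplicity r N = ?g r" if "r \<in> ?P" for r
      unfolding N using multiplicity_prod_prime_powers[OF fin pr pr[OF that], of ?g] that by simp
    hence "Poly_Mapping.lookup (snd b) r = f r" for r
      using b by (cases "r \<in> ?P") (auto simp: f_def aplus_def asupp_def in_keys_iff)
    hence "snd b = snd a" using la by (auto intro!: poly_mapping_eqI)
    moreover have "fst b = fst a"
    proof (cases "fst b = 0")
      case True
      hence "?n > 0" using b pos by simp
      thus ?thesis using True by (simp add: a_def)
    next
      case False
      hence "?n < 0" using b pos by simp
      moreover have "fst b = 1" using False by (cases "fst b") auto
      ultimately show ?thesis by (simp add: a_def)
    qed
    ultimately show "b = a" by (simp add: prod_eq_iff)
  qed
qed

definition apoints :: "('v, 'e) gbs \<Rightarrow> 'v apoint set" where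
  "apoints G = gverts G \<times> aplus G"

definition ater :: "('v, 'e) gbs \<Rightarrow> 'e \<Rightarrow> 'v apoint" where
  "ater G e = (gter G e, label_vec G (glab G e))"

definition aini :: "('v, 'e) gbs \<Rightarrow> 'e \<Rightarrow> 'v apoint" where
  "aini G e = ater G (grev G e)"

definition shift :: "'v apoint \<Rightarrow> avec \<Rightarrow> 'v apoint" (infixl "\<oplus>\<^sub>a" 65) where
  "p \<oplus>\<^sub>a w = (fst p, snd p + w)"

definition ale :: "('v, 'e) gbs \<Rightarrow> 'v apoint \<Rightarrow> 'v apoint \<Rightarrow> bool" where
  "ale G p p' \<longleftrightarrow> (\<exists>w\<in>aplus G. p' = p \<oplus>\<^sub>a w)"

definition affine_path ::
  "('v, 'e) gbs \<Rightarrow> 'v apoint \<Rightarrow> 'e list \<Rightarrow> 'v apoint \<Rightarrow> bool" where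
  "affine_path G p es p' \<longleftrightarrow>
     p \<in> apoints G \<and> p' \<in> apoints G \<and> set es \<subseteq> gedges G \<and>
     (if es = [] then p = p'
      else \<exists>w :: nat \<Rightarrow> avec.
        (\<forall>i<length es. w i \<in> aplus G) \<and>
        aini G (hd es) \<oplus>\<^sub>a w 0 = p \<and>
        ater G (last es) \<oplus>\<^sub>a w (length es - 1) = p' \<and>
        (\<forall>i. Suc i < length es \<longrightarrow>
           ater G (es ! i) \<oplus>\<^sub>a w i = aini G (es ! Suc i) \<oplus>\<^sub>a w (Suc i)))"

definition aconj :: "('v, 'e) gbs \<Rightarrow> 'v apoint \<Rightarrow> 'v apoint \<Rightarrow> bool" where
  "aconj G p q \<longleftrightarrow> (\<exists>es. affine_path G p es q)"

definition conj_le :: "('v, 'e) gbs \<Rightarrow> 'v apoint \<Rightarrow> 'v apoint \<Rightarrow> bool" where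
  "conj_le G p q \<longleftrightarrow> (\<exists>q'. aconj G q' q \<and> ale G p q')"

definition qconj :: "('v, 'e) gbs \<Rightarrow> 'v apoint \<Rightarrow> 'v apoint \<Rightarrow> bool" where
  "qconj G p q \<longleftrightarrow> conj_le G p q \<and> conj_le G q p"

definition qc_class :: "('v, 'e) gbs \<Rightarrow> 'v apoint set \<Rightarrow> bool" where
  "qc_class G Q \<longleftrightarrow> (\<exists>p\<in>apoints G. Q = {q \<in> apoints G. qconj G p q})"

definition one_qc_class :: "('v, 'e) gbs \<Rightarrow> 'v apoint set \<Rightarrow> bool" where
  "one_qc_class G Q \<longleftrightarrow> qc_class G Q \<and> (\<forall>e\<in>gedges G. aini G e \<in> Q \<and> ater G e \<in> Q)"

definition min_qc :: "('v, 'e) gbs \<Rightarrow> 'v apoint set \<Rightarrow> 'v apoint set" where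
  "min_qc G Q = {q \<in> Q. \<forall>q'\<in>Q. ale G q' q \<longrightarrow> ale G q q'}"

text \<open>The union below does not depend on \<open>p\<close>, so it may also be taken over all \<open>p \<in> Q\<close>.\<close>

definition supp_qc :: "('v, 'e) gbs \<Rightarrow> 'v apoint set \<Rightarrow> nat set" where
  "supp_qc G Q = \<Union> {asupp u | u p. p \<in> Q \<and> u \<in> aplus G \<and> qconj G (p \<oplus>\<^sub>a u) p}"

definition same_family :: "('v, 'e) gbs \<Rightarrow> 'v apoint set \<Rightarrow> 'v apoint \<Rightarrow> 'v apoint \<Rightarrow> bool" where
  "same_family G Q p q \<longleftrightarrow>
     p \<in> Q \<and> q \<in> Q \<and> fst p = fst q \<and> asupp (snd q - snd p) \<subseteq> supp_qc G Q"

definition families :: "('v, 'e) gbs \<Rightarrow> 'v apoint set \<Rightarrow> 'v apoint set set" where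
  "families G Q = Q // {(p, q). same_family G Q p q}"

definition at_point :: "'v apoint \<Rightarrow> 'v apoint \<Rightarrow> bool" where
  "at_point p m \<longleftrightarrow> p = m \<or> p = m \<oplus>\<^sub>a aeps"

definition full_gap_above ::
  "('v, 'e) gbs \<Rightarrow> 'v apoint set \<Rightarrow> 'v apoint \<Rightarrow> 'v apoint \<Rightarrow> bool" where
  "full_gap_above G Q m p \<longleftrightarrow> (\<exists>w\<in>aplus G. p = m \<oplus>\<^sub>a w \<and> asupp w = supp_qc G Q)"

text \<open>
  Each geometric edge appears in \<open>gedges\<close> with both orientations, so its endpoints at \<open>m\<close>
  correspond to the oriented edges with \<open>aini\<close> at \<open>m\<close>; an edge with both endpoints at \<open>m\<close>
  counts twice.
\<close>

definition clean :: "('v, 'e) gbs \<Rightarrow> 'v apoint set \<Rightarrow> bool" where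
  "clean G Q \<longleftrightarrow>
     (\<forall>m\<in>min_qc G Q. \<exists>!e. e \<in> gedges G \<and> at_point (aini G e) m) \<and>
     \<not> (\<exists>e\<in>gedges G. aini G e \<in> min_qc G Q \<and> ater G e \<in> min_qc G Q)"

definition floating_pieces :: "('v, 'e) gbs \<Rightarrow> 'v apoint set \<Rightarrow> bool" where
  "floating_pieces G Q \<longleftrightarrow>
     card ((\<lambda>m. {m, m \<oplus>\<^sub>a aeps}) ` min_qc G Q) < card ((\<lambda>e. {e, grev G e}) ` gedges G)"

definition floating_edge :: "('v, 'e) gbs \<Rightarrow> 'v apoint set \<Rightarrow> 'e \<Rightarrow> bool" where
  "floating_edge G Q e \<longleftrightarrow> e \<in> gedges G \<and> aini G e \<notin> min_qc G Q \<and> ater G e \<notin> min_qc G Q"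

definition full_support_gaps :: "('v, 'e) gbs \<Rightarrow> 'v apoint set \<Rightarrow> bool" where
  "full_support_gaps G Q \<longleftrightarrow>
     (\<forall>e\<in>gedges G. \<forall>p\<in>{aini G e, ater G e}.
        \<exists>m\<in>min_qc G Q. at_point p m \<or> full_gap_above G Q m p)"

text \<open>Only the values of \<open>mF\<close> at families other than \<open>F0\<close> matter.\<close>

definition normal_form ::
  "('v, 'e) gbs \<Rightarrow> 'v apoint set \<Rightarrow> 'v apoint set \<Rightarrow> ('v apoint set \<Rightarrow> 'v apoint) \<Rightarrow> bool" where
  "normal_form G Q F0 mF \<longleftrightarrow>
     gbs_graph G \<and> one_qc_class G Q \<and> supp_qc G Q \<noteq> {} \<and> clean G Q \<and> floating_pieces G Q \<and>
     F0 \<in> families G Q \<and> (\<forall>F\<in>families G Q - {F0}. mF F \<in> F \<inter> min_qc G Q) \<and>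
     (\<forall>F\<in>families G Q - {F0}. \<forall>e\<in>gedges G. at_point (aini G e) (mF F) \<longrightarrow>
        ater G e \<in> F0 \<and> (\<forall>m\<in>F0 \<inter> min_qc G Q. full_gap_above G Q m (ater G e))) \<and>
     (\<forall>F\<in>families G Q. \<forall>m\<in>F \<inter> min_qc G Q. F = F0 \<or> \<not> at_point m (mF F) \<longrightarrow>
        (\<forall>e\<in>gedges G. at_point (aini G e) m \<longrightarrow>
           ater G e \<in> F \<and> (\<forall>m'\<in>F \<inter> min_qc G Q. full_gap_above G Q m' (ater G e)))) \<and>
     (\<forall>e. floating_edge G Q e \<longrightarrow> (\<forall>p\<in>{aini G e, ater G e}.
        p \<in> F0 \<and> (\<forall>m\<in>F0 \<inter> min_qc G Q. full_gap_above G Q m p)))"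


section \<open>Moves\<close>

text \<open>
  A move keeps the vertices, the edges and the reverse map, and changes the endpoints in the
  affine representation of at most the edges in \<open>S\<close>.  As the endpoints determine the
  initial-vertex map and the labels, \<open>G'\<close> is determined by \<open>G\<close> and the new endpoints.
  The set \<open>gprimes\<close> is the same for \<open>G\<close> and \<open>G'\<close> in each of the moves below.
\<close>

definition unchanged_off :: "'e set \<Rightarrow> ('v, 'e) gbs \<Rightarrow> ('v, 'e) gbs \<Rightarrow> bool" where
  "unchanged_off S G G' \<longleftrightarrow>
     gbs_graph G' \<and> gverts G' = gverts G \<and> gedges G' = gedges G \<and>
     (\<forall>e\<in>gedges G. grev G' e = grev G e) \<and>
     (\<forall>e\<in>gedges G - S. aini G' e = aini G e \<and> ater G' e = ater G e)"

definition edge_joins :: "('v, 'e) gbs \<Rightarrow> 'e \<Rightarrow> 'v apoint \<Rightarrow> 'v apoint \<Rightarrow> bool" where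
  "edge_joins G e p q \<longleftrightarrow> e \<in> gedges G \<and> aini G e = p \<and> ater G e = q"

definition slide :: "('v, 'e) gbs \<Rightarrow> ('v, 'e) gbs \<Rightarrow> bool" where
  "slide G G' \<longleftrightarrow> (\<exists>e f p q r a.
     f \<noteq> e \<and> f \<noteq> grev G e \<and> a \<in> aplus G \<and>
     edge_joins G e p q \<and> edge_joins G f r (p \<oplus>\<^sub>a a) \<and>
     edge_joins G' e p q \<and> edge_joins G' f r (q \<oplus>\<^sub>a a) \<and>
     unchanged_off {f, grev G f} G G')"

definition swap :: "('v, 'e) gbs \<Rightarrow> ('v, 'e) gbs \<Rightarrow> bool" where
  "swap G G' \<longleftrightarrow> (\<exists>e f p q w1 w2 k1 k2.
     f \<noteq> e \<and> f \<noteq> grev G e \<and> w1 \<in> aplus G \<and> w2 \<in> aplus G \<and>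
     ale G p q \<and> ale G q (p \<oplus>\<^sub>a amult k1 w1) \<and> ale G q (p \<oplus>\<^sub>a amult k2 w2) \<and>
     edge_joins G e p (p \<oplus>\<^sub>a w1) \<and> edge_joins G f q (q \<oplus>\<^sub>a w2) \<and>
     edge_joins G' e q (q \<oplus>\<^sub>a w1) \<and> edge_joins G' f p (p \<oplus>\<^sub>a w2) \<and>
     unchanged_off {e, grev G e, f, grev G f} G G')"

definition connection :: "('v, 'e) gbs \<Rightarrow> ('v, 'e) gbs \<Rightarrow> bool" where
  "connection G G' \<longleftrightarrow> (\<exists>e f p q w w1 w2 k.
     f \<noteq> e \<and> f \<noteq> grev G e \<and> w \<in> aplus G \<and> w1 \<in> aplus G \<and> w2 \<in> aplus G \<and>
     w1 + w2 = amult k w \<and>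
     edge_joins G e q (p \<oplus>\<^sub>a w1) \<and> edge_joins G f p (p \<oplus>\<^sub>a w) \<and>
     edge_joins G' e p (q \<oplus>\<^sub>a w2) \<and> edge_joins G' f q (q \<oplus>\<^sub>a w) \<and>
     unchanged_off {e, grev G e, f, grev G f} G G')"

definition move :: "('v, 'e) gbs \<Rightarrow> ('v, 'e) gbs \<Rightarrow> bool" where
  "move G G' \<longleftrightarrow> slide G G' \<or> swap G G' \<or> connection G G'"

end

theory Submission
  imports Defs
begin

text \<open>
  Write \<open>S\<close> for the support of the quasi-conjugacy class \<open>Q\<close>; adding vectors with support in
  \<open>S\<close> does not lead out of \<open>Q\<close>.  In a clean graph every minimal point \<open>x\<close> carries one
  oriented edge \<open>\<eta> x\<close>, and full-support gaps say that every other endpoint \<open>n\<close> has the form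
  \<open>\<sigma> n + \<alpha> n\<close> with \<open>\<sigma> n\<close> minimal and \<open>\<alpha> n\<close> of support \<open>S\<close>.  This data (\<open>layout\<close>) is all that
  matters: \<open>\<sigma>\<close> turns the edges at minimal points into a functional graph \<open>x \<mapsto> \<sigma> (rv (\<eta> x))\<close> on
  the minimal points, with floating edges joining vertices of it, and slides let every
  endpoint over \<open>z\<close> other than the far end of \<open>\<eta> z\<close> move along the edge of \<open>z\<close>.

  Sliding over one minimal point after the other (\<open>elim_point\<close>, \<open>make_rooted\<close>) shortens all paths of the
  functional graph until every endpoint lies directly over a root, that is, a minimal point
  \<open>r\<close> with a loop \<open>r --- r + w\<close>.  As \<open>w\<close> has support \<open>S\<close>, the other endpoints over \<open>r\<close> can then be
  pushed up along the loop as high as one likes, hence over every minimal point of the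
  family of \<open>r\<close>.

  Roots are merged with the help of a floating edge.  If it joins \<open>r + a\<close> to \<open>r' + b\<close> with
  \<open>r \<noteq> r'\<close>, then a connection with the loop at \<open>r\<close> attaches \<open>r\<close> to \<open>r'\<close> and leaves a floating
  loop at \<open>r' + b\<close>; one root is gone (\<open>conn_merge\<close>).  If both ends of each floating edge lie over the same root, then,
  since \<open>Q\<close> is a single class, minimal points over two different roots share a family
  (\<open>linking\<close>), and one end of the floating edge can be slid up, across that family and down
  to the other root (\<open>bridge\<close>), which gives the previous case.

  With a single root left, a further connection moves it to any prescribed minimal point of
  \<open>F0\<close> (\<open>reroot\<close>).  The loop there may be too short for its far end to be slid over any other
  edge, but a swap exchanges it with a floating edge that has been made as long as desired (\<open>raise_loop\<close>).  Lifting all endpoints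
  along the new loop, and sliding the edges of the remaining minimal points of a family
  \<open>F \<noteq> F0\<close> back over the edge of \<open>m\<^sub>F\<close>, produces the normal form (\<open>distribute\<close>).

  All of this takes place on the level of endpoint functions; a separate part shows
  that these are realised by GBS graphs and that moves preserve quasi-conjugacy.
\<close>

section \<open>Exponent vectors\<close>

definition co :: "avec \<Rightarrow> nat \<Rightarrow> int" where
  "co a = Poly_Mapping.lookup (snd a)"

lemma co_simps [simp]:
  "co (a + b) r = co a r + co b r" "co (a - b) r = co a r - co b r" "co 0 r = 0" "co aeps r = 0"
  by (simp_all add: co_def lookup_add lookup_minus aeps_def)

lemma co_amult [simp]: "co (amult k w) r = int k * co w r"
proof (induction k)
  case (Suc k)
  have "amult (Suc k) w = w + amult k w"
    by (simp add: amult_def add.commute)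
  with Suc show ?case by (simp add: algebra_simps)
qed (simp add: amult_def)

lemma amult_Suc: "amult (Suc k) w = amult k w + w" and amult_0 [simp]: "amult 0 w = 0"
  by (simp_all add: amult_def)

lemma mem_asupp: "r \<in> asupp a \<longleftrightarrow> co a r \<noteq> 0"
  by (simp add: asupp_def in_keys_iff co_def)

lemma aeps_twice [simp]: "aeps + aeps = 0"
  by (simp add: aeps_def prod_eq_iff)

lemma shift_shift [simp]: "p \<oplus>\<^sub>a u \<oplus>\<^sub>a w = p \<oplus>\<^sub>a (u + w)"
  and shift_0 [simp]: "p \<oplus>\<^sub>a 0 = p"
  and fst_shift [simp]: "fst (p \<oplus>\<^sub>a u) = fst p"
  and snd_shift [simp]: "snd (p \<oplus>\<^sub>a u) = snd p + u"
  by (simp_all add: shift_def add.assoc)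

section \<open>Endpoint functions and their moves\<close>

text \<open>
  A graph with a fixed set of primes.  Moves only change the endpoints of edges in the
  affine representation, so the state of the process is a function \<open>I\<close> that maps every
  oriented edge to its initial point; the terminal point of \<open>e\<close> is \<open>I (rv e)\<close>.
\<close>

locale gbs_frame =
  fixes V :: "'v set" and E :: "'e set" and rv :: "'e \<Rightarrow> 'e" and P :: "nat set"
  assumes V: "finite V" "V \<noteq> {}" and finE: "finite E"
    and rv: "\<And>e. e \<in> E \<Longrightarrow> rv e \<in> E \<and> rv (rv e) = e \<and> rv e \<noteq> e"
    and P: "finite P" "\<And>r. r \<in> P \<Longrightarrow> prime r"
begin

lemma rv_simps [simp]: "e \<in> E \<Longrightarrow> rv e \<in> E" "e \<in> E \<Longrightarrow> rv (rv e) = e"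
  "e \<in> E \<Longrightarrow> rv e \<noteq> e" "e \<in> E \<Longrightarrow> e \<noteq> rv e"
  using rv by metis+

definition Ap :: "avec set" where
  "Ap = {a. asupp a \<subseteq> P \<and> (\<forall>r. co a r \<ge> 0)}"

definition pts :: "'v apoint set" where
  "pts = V \<times> Ap"

text \<open>
  A preorder only: \<open>p\<close> and \<open>p \<oplus>\<^sub>a aeps\<close> lie below each other.
\<close>

definition le :: "'v apoint \<Rightarrow> 'v apoint \<Rightarrow> bool" where
  "le p q \<longleftrightarrow> (\<exists>w\<in>Ap. q = p \<oplus>\<^sub>a w)"

definition adj :: "('e \<Rightarrow> 'v apoint) \<Rightarrow> ('v \<times> 'v) set" where
  "adj I = {(fst (I e), fst (I (rv e))) |e. e \<in> E}"

text \<open>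
  The conditions under which \<open>I\<close> comes from a GBS graph whose labels involve exactly the
  primes in \<open>P\<close>.
\<close>

definition config :: "('e \<Rightarrow> 'v apoint) \<Rightarrow> bool" where
  "config I \<longleftrightarrow> (\<forall>e\<in>E. I e \<in> pts) \<and> (\<forall>u\<in>V. \<forall>v\<in>V. (u, v) \<in> (adj I)\<^sup>*) \<and>
     (\<Union>e\<in>E. asupp (snd (I e))) = P"

definition cstep :: "('e \<Rightarrow> 'v apoint) \<Rightarrow> 'v apoint \<Rightarrow> 'v apoint \<Rightarrow> bool" where
  "cstep I p q \<longleftrightarrow> (\<exists>e\<in>E. \<exists>u\<in>Ap. p = I e \<oplus>\<^sub>a u \<and> q = I (rv e) \<oplus>\<^sub>a u)"

text \<open>
  The relation \<open>\<preceq>\<^sub>c\<close>, written as a closure of elementary steps instead of a single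
  inequality followed by an affine path.  In this form it is visibly the least translation
  invariant preorder that contains \<open>le\<close> and the edges, which makes its invariance under
  moves a matter of checking single edges.
\<close>

definition qle :: "('e \<Rightarrow> 'v apoint) \<Rightarrow> 'v apoint \<Rightarrow> 'v apoint \<Rightarrow> bool" where
  "qle I = (\<lambda>p q. p \<in> pts \<and> q \<in> pts \<and> (le p q \<or> cstep I p q))\<^sup>*\<^sup>*"

definition cslide :: "('e \<Rightarrow> 'v apoint) \<Rightarrow> ('e \<Rightarrow> 'v apoint) \<Rightarrow> bool" where
  "cslide I I' \<longleftrightarrow> (\<exists>e f a. e \<in> E \<and> f \<in> E \<and> f \<noteq> e \<and> f \<noteq> rv e \<and> a \<in> Ap \<and>
     I f = I e \<oplus>\<^sub>a a \<and> I' = I(f := I (rv e) \<oplus>\<^sub>a a))"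

definition cswap :: "('e \<Rightarrow> 'v apoint) \<Rightarrow> ('e \<Rightarrow> 'v apoint) \<Rightarrow> bool" where
  "cswap I I' \<longleftrightarrow> (\<exists>e f p q w1 w2 k1 k2. e \<in> E \<and> f \<in> E \<and> f \<noteq> e \<and> f \<noteq> rv e \<and>
     w1 \<in> Ap \<and> w2 \<in> Ap \<and> le p q \<and> le q (p \<oplus>\<^sub>a amult k1 w1) \<and> le q (p \<oplus>\<^sub>a amult k2 w2) \<and>
     I e = p \<and> I (rv e) = p \<oplus>\<^sub>a w1 \<and> I f = q \<and> I (rv f) = q \<oplus>\<^sub>a w2 \<and>
     I' = I(e := q, rv e := q \<oplus>\<^sub>a w1, f := p, rv f := p \<oplus>\<^sub>a w2))"

definition cconn :: "('e \<Rightarrow> 'v apoint) \<Rightarrow> ('e \<Rightarrow> 'v apoint) \<Rightarrow> bool" where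
  "cconn I I' \<longleftrightarrow> (\<exists>e f p q w w1 w2 k. e \<in> E \<and> f \<in> E \<and> f \<noteq> e \<and> f \<noteq> rv e \<and>
     w \<in> Ap \<and> w1 \<in> Ap \<and> w2 \<in> Ap \<and> w1 + w2 = amult k w \<and>
     I e = q \<and> I (rv e) = p \<oplus>\<^sub>a w1 \<and> I f = p \<and> I (rv f) = p \<oplus>\<^sub>a w \<and>
     I' = I(e := p, rv e := q \<oplus>\<^sub>a w2, f := q, rv f := q \<oplus>\<^sub>a w))"

definition cmove :: "('e \<Rightarrow> 'v apoint) \<Rightarrow> ('e \<Rightarrow> 'v apoint) \<Rightarrow> bool" where
  "cmove I I' \<longleftrightarrow> cslide I I' \<or> cswap I I' \<or> cconn I I'"

lemma Ap_add [intro]: "a \<in> Ap \<Longrightarrow> b \<in> Ap \<Longrightarrow> a + b \<in> Ap"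
  unfolding Ap_def by (auto simp: mem_asupp subset_iff) (metis add.right_neutral)

lemma Ap_0 [simp]: "0 \<in> Ap" and Ap_aeps [simp]: "aeps \<in> Ap"
  by (auto simp: Ap_def mem_asupp subset_iff)

lemma Ap_amult [intro]: "w \<in> Ap \<Longrightarrow> amult k w \<in> Ap"
  by (auto simp: Ap_def mem_asupp subset_iff)

lemma asupp_add: "a \<in> Ap \<Longrightarrow> b \<in> Ap \<Longrightarrow> asupp (a + b) = asupp a \<union> asupp b"
  by (auto simp: Ap_def mem_asupp set_eq_iff add_nonneg_eq_0_iff)

lemma pts_shift [simp, intro]: "p \<in> pts \<Longrightarrow> u \<in> Ap \<Longrightarrow> p \<oplus>\<^sub>a u \<in> pts"
  by (auto simp: pts_def shift_def)

lemma snd_pts [intro]: "p \<in> pts \<Longrightarrow> snd p \<in> Ap"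
  by (auto simp: pts_def)

lemma le_shift [intro]: "u \<in> Ap \<Longrightarrow> le p (p \<oplus>\<^sub>a u)"
  by (auto simp: le_def)

lemma le_pts: "p \<in> pts \<Longrightarrow> le p q \<Longrightarrow> q \<in> pts"
  by (auto simp: le_def)

lemma qle_refl [simp]: "qle I p p"
  by (simp add: qle_def)

lemma qle_trans [trans]: "qle I p q \<Longrightarrow> qle I q r \<Longrightarrow> qle I p r"
  by (simp add: qle_def)

lemma qle_le: "p \<in> pts \<Longrightarrow> le p q \<Longrightarrow> qle I p q"
  unfolding qle_def using le_pts by blast

lemma qle_shift:
  assumes "qle I p q" "u \<in> Ap" shows "qle I (p \<oplus>\<^sub>a u) (q \<oplus>\<^sub>a u)"
  using assms(1) unfolding qle_def
proof (induction rule: rtranclp_induct)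
  case (step q r)
  have "le (q \<oplus>\<^sub>a u) (r \<oplus>\<^sub>a u)" if "le q r"
    using that by (auto simp: le_def add_ac)
  moreover have "cstep I (q \<oplus>\<^sub>a u) (r \<oplus>\<^sub>a u)" if "cstep I q r"
    using that assms(2) by (fastforce simp: cstep_def)
  ultimately show ?case
    using step(2) assms(2)
    by (intro rtranclp.rtrancl_into_rtrancl[OF step(3)]) auto
qed simp

lemma config_pts: "config I \<Longrightarrow> e \<in> E \<Longrightarrow> I e \<in> pts"
  by (simp add: config_def)

lemma qle_edge: "config I \<Longrightarrow> e \<in> E \<Longrightarrow> qle I (I e) (I (rv e))"
  unfolding qle_def config_def cstep_def using rv
  by (intro r_into_rtranclp) (metis Ap_0 shift_0)

text \<open>
  By translation invariance, comparing two such preorders only requires to look at the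
  edges of one of them.
\<close>

lemma qle_mono:
  assumes "\<And>e. e \<in> E \<Longrightarrow> qle J (I e) (I (rv e))" and "qle I p q"
  shows "qle J p q"
  using assms(2) unfolding qle_def[of I]
proof (induction rule: rtranclp_induct)
  case (step q r)
  have "qle J q r"
  proof (cases "le q r")
    case True
    with step(2) show ?thesis by (blast intro: qle_le)
  next
    case False
    with step(2) obtain e u where "e \<in> E" "u \<in> Ap" "q = I e \<oplus>\<^sub>a u" "r = I (rv e) \<oplus>\<^sub>a u"
      by (auto simp: cstep_def)
    with qle_shift[OF assms(1)] show ?thesis by simp
  qed
  with step show ?case by (blast intro: qle_trans)
qed simp

lemma cslide_sym: assumes "cslide I I'" shows "cslide I' I"
proof -
  obtain e f a where h: "e \<in> E" "f \<in> E" "f \<noteq> e" "f \<noteq> rv e" "a \<in> Ap"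
     "I f = I e \<oplus>\<^sub>a a" "I' = I(f := I (rv e) \<oplus>\<^sub>a a)"
    using assms by (auto simp: cslide_def)
  have "rv e \<in> E" "rv (rv e) = e" using rv h by auto
  then show ?thesis unfolding cslide_def using h
    by (intro exI[of _ "rv e"] exI[of _ f] exI[of _ a]) auto
qed

lemma rv_distinct:
  assumes "e \<in> E" "f \<in> E" "f \<noteq> e" "f \<noteq> rv e"
  shows "rv f \<noteq> e" "rv f \<noteq> rv e" "rv e \<noteq> f" "rv e \<noteq> e" "rv f \<noteq> f" "e \<noteq> f"
    "e \<noteq> rv f" "rv e \<noteq> rv f" "e \<noteq> rv e" "f \<noteq> rv f"
  using assms rv by metis+

lemma cswap_sym: assumes "cswap I I'" shows "cswap I' I"
proof -
  obtain e f p q w1 w2 k1 k2 where h: "e \<in> E" "f \<in> E" "f \<noteq> e" "f \<noteq> rv e"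
     "w1 \<in> Ap" "w2 \<in> Ap" "le p q" "le q (p \<oplus>\<^sub>a amult k1 w1)" "le q (p \<oplus>\<^sub>a amult k2 w2)"
     "I e = p" "I (rv e) = p \<oplus>\<^sub>a w1" "I f = q" "I (rv f) = q \<oplus>\<^sub>a w2"
     "I' = I(e := q, rv e := q \<oplus>\<^sub>a w1, f := p, rv f := p \<oplus>\<^sub>a w2)"
    using assms by (auto simp: cswap_def)
  note d = rv_distinct[OF h(1-4)]
  have "I' f = p" "I' (rv f) = p \<oplus>\<^sub>a w2" "I' e = q" "I' (rv e) = q \<oplus>\<^sub>a w1"
     "I = I'(f := q, rv f := q \<oplus>\<^sub>a w2, e := p, rv e := p \<oplus>\<^sub>a w1)"
    using h d by (auto simp: fun_eq_iff)
  with h d show ?thesis unfolding cswap_def by metis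
qed

lemma cconn_sym: assumes "cconn I I'" shows "cconn I' I"
proof -
  obtain e f p q w w1 w2 k where h: "e \<in> E" "f \<in> E" "f \<noteq> e" "f \<noteq> rv e"
     "w \<in> Ap" "w1 \<in> Ap" "w2 \<in> Ap" "w1 + w2 = amult k w"
     "I e = q" "I (rv e) = p \<oplus>\<^sub>a w1" "I f = p" "I (rv f) = p \<oplus>\<^sub>a w"
     "I' = I(e := p, rv e := q \<oplus>\<^sub>a w2, f := q, rv f := q \<oplus>\<^sub>a w)"
    using assms by (auto simp: cconn_def)
  note d = rv_distinct[OF h(1-4)]
  have "I' e = p" "I' (rv e) = q \<oplus>\<^sub>a w2" "I' f = q" "I' (rv f) = q \<oplus>\<^sub>a w" "w2 + w1 = amult k w"
     "I = I'(e := q, rv e := p \<oplus>\<^sub>a w1, f := p, rv f := p \<oplus>\<^sub>a w)"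
    using h d by (auto simp: fun_eq_iff add.commute)
  with h d show ?thesis unfolding cconn_def by metis
qed

text \<open>
  Every move can be undone by a move of the same kind.  Hence each invariance statement
  below needs a proof in one direction only.
\<close>

lemma cmove_sym: "cmove I I' \<Longrightarrow> cmove I' I"
  by (auto simp: cmove_def cslide_sym cswap_sym cconn_sym)

lemma adj_edge: "e \<in> E \<Longrightarrow> (fst (I e), fst (I (rv e))) \<in> adj I"
  "e \<in> E \<Longrightarrow> (fst (I (rv e)), fst (I e)) \<in> adj I"
  unfolding adj_def using rv by blast (metis (mono_tags, lifting) mem_Collect_eq rv)

section \<open>Moves preserve connectedness, primes and quasi-conjugacy\<close>

text \<open>
  The trace of an edge \<open>e\<close> of \<open>I\<close> in \<open>I'\<close>: its endpoints stay connected, its primes still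
  occur, and it remains compatible with the preorder.
\<close>

definition kept :: "('e \<Rightarrow> 'v apoint) \<Rightarrow> ('e \<Rightarrow> 'v apoint) \<Rightarrow> 'e \<Rightarrow> bool" where
  "kept I I' e \<longleftrightarrow> (fst (I e), fst (I (rv e))) \<in> (adj I')\<^sup>* \<and>
     asupp (snd (I e)) \<subseteq> (\<Union>e\<in>E. asupp (snd (I' e))) \<and>
     ((\<forall>e\<in>E. I' e \<in> pts) \<longrightarrow> qle I' (I e) (I (rv e)))"

lemma kept_edge:
  assumes "e \<in> E" "I' e = I e" "I' (rv e) = I (rv e)"
  shows "kept I I' e"
proof -
  have "qle I' (I' e) (I' (rv e))" if "\<forall>e\<in>E. I' e \<in> pts"
  proof -
    have "cstep I' (I' e) (I' (rv e))"
      unfolding cstep_def using assms(1) by (intro bexI[of _ e] bexI[of _ 0]) auto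
    then show ?thesis
      unfolding qle_def using that assms(1) by (intro r_into_rtranclp) auto
  qed
  then show ?thesis
    unfolding kept_def using adj_edge(1)[OF assms(1), of I'] assms by auto
qed

text \<open>
  The old position of the moved edge \<open>f\<close> is recovered from the new one by translating the
  unchanged edge \<open>e\<close>.
\<close>

lemma kept_slide:
  assumes c: "config I" and "cslide I I'" and g: "g \<in> E"
  shows "kept I I' g"
proof -
  obtain e f a where h: "e \<in> E" "f \<in> E" "f \<noteq> e" "f \<noteq> rv e" "a \<in> Ap"
     "I f = I e \<oplus>\<^sub>a a" "I' = I(f := I (rv e) \<oplus>\<^sub>a a)"
    using assms by (auto simp: cslide_def)
  note d = rv_distinct[OF h(1-4)]
  have v: "I' e = I e" "I' (rv e) = I (rv e)" "I' f = I (rv e) \<oplus>\<^sub>a a" "I' (rv f) = I (rv f)"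
    using h d by auto
  have R: "rv e \<in> E" "rv f \<in> E" "rv (rv f) = f" using h(1,2) by auto
  have a1: "(fst (I e), fst (I (rv e))) \<in> adj I'" "(fst (I (rv e)), fst (I e)) \<in> adj I'"
    "(fst (I' f), fst (I (rv f))) \<in> adj I'" "(fst (I (rv f)), fst (I' f)) \<in> adj I'"
    using adj_edge[OF h(1), of I'] adj_edge[OF h(2), of I'] v by auto
  have s: "snd (I e) \<in> Ap" "snd (I (rv e)) \<in> Ap" using config_pts[OF c] h(1) R by auto
  have sf: "asupp (snd (I f)) \<subseteq> (\<Union>e\<in>E. asupp (snd (I' e)))"
  proof -
    have "asupp (snd (I f)) \<subseteq> asupp (snd (I' e)) \<union> asupp (snd (I' f))"
      using s h v by (auto simp: asupp_add)
    then show ?thesis using h by blast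
  qed
  consider "g = f" | "g = rv f" | "g \<noteq> f" "g \<noteq> rv f" by blast
  then show ?thesis
  proof cases
    case 1
    have "qle I' (I f) (I (rv f))" if p: "\<forall>e\<in>E. I' e \<in> pts"
    proof -
      have "kept I I' e" "kept I' I' f" using h v by (auto intro: kept_edge)
      then have "qle I' (I e) (I (rv e))" "qle I' (I' f) (I' (rv f))"
        using p by (auto simp: kept_def)
      from qle_shift[OF this(1) h(5)] this(2) show ?thesis
        using h(6) v by (auto intro: qle_trans)
    qed
    moreover have "(fst (I f), fst (I (rv f))) \<in> (adj I')\<^sup>*"
      unfolding h(6) fst_shift using a1(1,3) v(3) by (simp add: converse_rtrancl_into_rtrancl)
    ultimately show ?thesis using 1 sf unfolding kept_def by simp
  next
    case 2
    have "qle I' (I (rv f)) (I f)" if p: "\<forall>e\<in>E. I' e \<in> pts"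
    proof -
      have "kept I I' (rv e)" "kept I' I' (rv f)" using h(1,2) v R by (auto intro!: kept_edge)
      then have "qle I' (I (rv e)) (I e)" "qle I' (I' (rv f)) (I' f)"
        using p h(1,2) by (simp_all add: kept_def)
      from qle_shift[OF this(1) h(5)] this(2) show ?thesis
        using h(6) v by (auto intro: qle_trans)
    qed
    moreover have "asupp (snd (I (rv f))) \<subseteq> (\<Union>e\<in>E. asupp (snd (I' e)))"
      using v R by force
    moreover have "(fst (I (rv f)), fst (I f)) \<in> (adj I')\<^sup>*"
      unfolding h(6) fst_shift using a1(2,4) v(3) by (simp add: converse_rtrancl_into_rtrancl)
    ultimately show ?thesis using 2 R unfolding kept_def by simp
  next
    case 3
    then show ?thesis using g h(1,2) by (intro kept_edge) (auto simp: h(7))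
  qed
qed

lemma Ap_subset_amult:
  assumes "w1 \<in> Ap" "w2 \<in> Ap" "w1 + w2 = amult k w"
  shows "asupp w1 \<subseteq> asupp w"
proof
  fix r assume "r \<in> asupp w1"
  then have "co w1 r > 0" "co w2 r \<ge> 0" using assms by (auto simp: Ap_def mem_asupp order_less_le)
  moreover have "co w1 r + co w2 r = int k * co w r" using arg_cong[OF assms(3), of "\<lambda>a. co a r"] by simp
  ultimately show "r \<in> asupp w" by (auto simp: mem_asupp)
qed

lemma kept_of_qle:
  assumes "g \<in> E" "fst (I g) = fst (I (rv g)) \<or> (fst (I g), fst (I (rv g))) \<in> adj I'"
    and "asupp (snd (I g)) \<subseteq> (\<Union>e\<in>E. asupp (snd (I' e)))"
    and "(\<forall>e\<in>E. I' e \<in> pts) \<Longrightarrow> qle I' (I g) (I (rv g))"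
  shows "kept I I' g"
  using assms unfolding kept_def by auto

text \<open>
  All endpoints involved sit over one vertex.  The new edges make \<open>p\<close> equivalent to
  \<open>p + k * w2\<close>, which lies above \<open>q\<close>; so \<open>p\<close> and \<open>q\<close> are equivalent, and
  translations by \<open>w1\<close> and \<open>w2\<close> are available at both of them.
\<close>

lemma kept_swap:
  assumes c: "config I" and "cswap I I'" and g: "g \<in> E"
  shows "kept I I' g"
proof -
  obtain e f p q w1 w2 k1 k2 where h: "e \<in> E" "f \<in> E" "f \<noteq> e" "f \<noteq> rv e"
     "w1 \<in> Ap" "w2 \<in> Ap" "le p q" "le q (p \<oplus>\<^sub>a amult k1 w1)" "le q (p \<oplus>\<^sub>a amult k2 w2)"
     "I e = p" "I (rv e) = p \<oplus>\<^sub>a w1" "I f = q" "I (rv f) = q \<oplus>\<^sub>a w2"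
     "I' = I(e := q, rv e := q \<oplus>\<^sub>a w1, f := p, rv f := p \<oplus>\<^sub>a w2)"
    using assms by (auto simp: cswap_def)
  note d = rv_distinct[OF h(1-4)]
  have v: "I' e = q" "I' (rv e) = q \<oplus>\<^sub>a w1" "I' f = p" "I' (rv f) = p \<oplus>\<^sub>a w2"
    using h d by auto
  have R: "rv e \<in> E" "rv f \<in> E" "rv (rv f) = f" "rv (rv e) = e" using h(1,2) by auto
  have pq: "p \<in> pts" "q \<in> pts" using config_pts[OF c h(1)] config_pts[OF c h(2)] h(10,12) by auto
  have fs: "fst q = fst p" using h(7) by (auto simp: le_def)
  have s: "snd p \<in> Ap" "snd q \<in> Ap" using pq by auto
  have U: "asupp (snd p) \<union> asupp (snd q) \<union> asupp w1 \<union> asupp w2 \<subseteq> (\<Union>e\<in>E. asupp (snd (I' e)))"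
  proof -
    have "asupp (snd p) \<union> asupp (snd q) \<union> asupp w1 \<union> asupp w2 =
      asupp (snd (I' e)) \<union> asupp (snd (I' (rv e))) \<union> asupp (snd (I' f)) \<union> asupp (snd (I' (rv f)))"
      using s h v by (auto simp: asupp_add)
    then show ?thesis using h R by blast
  qed
  have q: "qle I' p (p \<oplus>\<^sub>a w1)" "qle I' (p \<oplus>\<^sub>a w1) p" "qle I' q (q \<oplus>\<^sub>a w2)" "qle I' (q \<oplus>\<^sub>a w2) q"
    if "\<forall>e\<in>E. I' e \<in> pts"
  proof -
    have "kept I' I' (rv e)" "kept I' I' (rv f)" using R by (auto intro!: kept_edge)
    then have *: "qle I' (q \<oplus>\<^sub>a w1) q" "qle I' (p \<oplus>\<^sub>a w2) p"
      using that v R by (auto simp: kept_def)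
    show "qle I' p (p \<oplus>\<^sub>a w1)" "qle I' q (q \<oplus>\<^sub>a w2)"
      using pq h by (auto intro!: qle_le)
    \<comment> \<open>the loop at \<open>p\<close> is now the one with the vector \<open>w2\<close>\<close>
    have iter: "qle I' (p \<oplus>\<^sub>a amult k w2) p" for k
    proof (induction k)
      case (Suc k)
      from qle_shift[OF Suc h(6)] *(2) show ?case
        by (auto simp: amult_Suc intro: qle_trans)
    qed simp
    have qp: "qle I' q p" using qle_le[OF pq(2) h(9)] iter by (blast intro: qle_trans)
    have pq': "qle I' p q" using qle_le[OF pq(1) h(7)] .
    show "qle I' (p \<oplus>\<^sub>a w1) p"
      using qle_shift[OF pq' h(5)] *(1) qp by (blast intro: qle_trans)
    show "qle I' (q \<oplus>\<^sub>a w2) q"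
      using qle_shift[OF qp h(6)] *(2) pq' by (blast intro: qle_trans)
  qed
  consider "g \<in> {e, rv e, f, rv f}" | "g \<notin> {e, rv e, f, rv f}" by blast
  then show ?thesis
  proof cases
    case 1
    show ?thesis
    proof (rule kept_of_qle)
      show "asupp (snd (I g)) \<subseteq> (\<Union>e\<in>E. asupp (snd (I' e)))"
      proof (rule subset_trans[OF _ U])
        show "asupp (snd (I g)) \<subseteq> asupp (snd p) \<union> asupp (snd q) \<union> asupp w1 \<union> asupp w2"
          using 1 h(5,6,10-13) s by (elim insertE) (simp_all add: asupp_add, blast+)
      qed
      show "fst (I g) = fst (I (rv g)) \<or> (fst (I g), fst (I (rv g))) \<in> adj I'"
        using 1 h(10-13) fs R by auto
      show "qle I' (I g) (I (rv g))" if "\<forall>e\<in>E. I' e \<in> pts"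
        using 1 q[OF that] h(10-13) R by auto
    qed (use g in auto)
  next
    case 2
    then have "rv g \<notin> {e, rv e, f, rv f}" using g h(1,2) by (metis insert_iff empty_iff rv_simps(2))
    with 2 show ?thesis using g h(1,2) by (intro kept_edge) (auto simp: h(14))
  qed
qed

text \<open>
  Going around \<open>q --- q + w\<close> repeatedly shows that \<open>q\<close> is conjugate to \<open>q + k * w\<close>, which equals
  \<open>q + w2 + w1\<close> and is therefore conjugate to \<open>p + w1\<close>.
\<close>

lemma kept_conn:
  assumes c: "config I" and "cconn I I'" and g: "g \<in> E"
  shows "kept I I' g"
proof -
  obtain e f p q w w1 w2 k where h: "e \<in> E" "f \<in> E" "f \<noteq> e" "f \<noteq> rv e"
     "w \<in> Ap" "w1 \<in> Ap" "w2 \<in> Ap" "w1 + w2 = amult k w"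
     "I e = q" "I (rv e) = p \<oplus>\<^sub>a w1" "I f = p" "I (rv f) = p \<oplus>\<^sub>a w"
     "I' = I(e := p, rv e := q \<oplus>\<^sub>a w2, f := q, rv f := q \<oplus>\<^sub>a w)"
    using assms by (auto simp: cconn_def)
  note d = rv_distinct[OF h(1-4)]
  have v: "I' e = p" "I' (rv e) = q \<oplus>\<^sub>a w2" "I' f = q" "I' (rv f) = q \<oplus>\<^sub>a w"
    using h d by auto
  have R: "rv e \<in> E" "rv f \<in> E" "rv (rv f) = f" "rv (rv e) = e" using h(1,2) by auto
  have pq: "p \<in> pts" "q \<in> pts" using config_pts[OF c h(1)] config_pts[OF c h(2)] h(9,11) by auto
  have s: "snd p \<in> Ap" "snd q \<in> Ap" using pq by auto
  have a1: "(fst p, fst q) \<in> adj I'" "(fst q, fst p) \<in> adj I'"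
    using adj_edge[OF h(1), of I'] v by auto
  have U: "asupp (snd p) \<union> asupp (snd q) \<union> asupp w \<union> asupp w1 \<subseteq> (\<Union>e\<in>E. asupp (snd (I' e)))"
  proof -
    have "asupp (snd p) \<union> asupp (snd q) \<union> asupp w \<subseteq>
      asupp (snd (I' e)) \<union> asupp (snd (I' f)) \<union> asupp (snd (I' (rv f)))"
      using s h v by (auto simp: asupp_add)
    then show ?thesis using h R Ap_subset_amult[OF h(6,7,8)] by blast
  qed
  have q: "qle I' p (p \<oplus>\<^sub>a w)" "qle I' (p \<oplus>\<^sub>a w) p" "qle I' q (p \<oplus>\<^sub>a w1)" "qle I' (p \<oplus>\<^sub>a w1) q"
    if "\<forall>e\<in>E. I' e \<in> pts"
  proof -
    have "kept I' I' e" "kept I' I' f" "kept I' I' (rv e)" "kept I' I' (rv f)"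
      using h R by (auto intro!: kept_edge)
    then have *: "qle I' p (q \<oplus>\<^sub>a w2)" "qle I' (q \<oplus>\<^sub>a w2) p" "qle I' q (q \<oplus>\<^sub>a w)" "qle I' (q \<oplus>\<^sub>a w) q"
      using that v R by (auto simp: kept_def)
    have iter: "qle I' (q \<oplus>\<^sub>a amult k w) q" for k
    proof (induction k)
      case (Suc k)
      from qle_shift[OF Suc h(5)] *(4) show ?case
        by (auto simp: amult_Suc intro: qle_trans)
    qed simp
    have iter': "qle I' q (q \<oplus>\<^sub>a amult k w)" for k
      using pq h by (auto intro!: qle_le)
    have ww: "w2 + w1 = amult k w" using h by (simp add: add.commute)
    show "qle I' q (p \<oplus>\<^sub>a w1)" using iter'[of k] qle_shift[OF *(2) h(6)] ww by (auto intro: qle_trans)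
    show "qle I' (p \<oplus>\<^sub>a w1) q" using iter[of k] qle_shift[OF *(1) h(6)] ww by (auto intro: qle_trans)
    show "qle I' p (p \<oplus>\<^sub>a w)" using pq h by (auto intro!: qle_le)
    show "qle I' (p \<oplus>\<^sub>a w) p"
      using qle_shift[OF *(1) h(5)] qle_shift[OF *(4) h(7)] *(2)
      by (auto simp: add.commute intro: qle_trans)
  qed
  consider "g \<in> {e, rv e, f, rv f}" | "g \<notin> {e, rv e, f, rv f}" by blast
  then show ?thesis
  proof cases
    case 1
    show ?thesis
    proof (rule kept_of_qle)
      show "asupp (snd (I g)) \<subseteq> (\<Union>e\<in>E. asupp (snd (I' e)))"
      proof (rule subset_trans[OF _ U])
        show "asupp (snd (I g)) \<subseteq> asupp (snd p) \<union> asupp (snd q) \<union> asupp w \<union> asupp w1"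
          using 1 h(5,6,9-12) s by (elim insertE) (simp_all add: asupp_add, blast+)
      qed
      show "fst (I g) = fst (I (rv g)) \<or> (fst (I g), fst (I (rv g))) \<in> adj I'"
        using 1 h(9-12) R a1 by auto
      show "qle I' (I g) (I (rv g))" if "\<forall>e\<in>E. I' e \<in> pts"
        using 1 q[OF that] h(9-12) R by auto
    qed (use g in auto)
  next
    case 2
    then have "rv g \<notin> {e, rv e, f, rv f}" using g h(1,2) by (metis insert_iff empty_iff rv_simps(2))
    with 2 show ?thesis using g h(1,2) by (intro kept_edge) (auto simp: h(13))
  qed
qed

lemma kept_move: "config I \<Longrightarrow> cmove I I' \<Longrightarrow> g \<in> E \<Longrightarrow> kept I I' g"
  by (auto simp: cmove_def intro: kept_slide kept_swap kept_conn)

lemma cmove_pts: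
  assumes "\<forall>e\<in>E. I e \<in> pts" "cmove I I'"
  shows "\<forall>e\<in>E. I' e \<in> pts"
proof -
  consider "cslide I I'" | "cswap I I'" | "cconn I I'" using assms(2) by (auto simp: cmove_def)
  then show ?thesis
  proof cases
    case 1
    then show ?thesis using assms(1) unfolding cslide_def by (auto intro!: pts_shift)
  next
    case 2
    then obtain e f p q w1 w2 where h: "e \<in> E" "f \<in> E" "w1 \<in> Ap" "w2 \<in> Ap" "I e = p" "I f = q"
       "I' = I(e := q, rv e := q \<oplus>\<^sub>a w1, f := p, rv f := p \<oplus>\<^sub>a w2)"
      unfolding cswap_def by blast
    then have "p \<in> pts" "q \<in> pts" using assms(1) by auto
    then show ?thesis using assms(1) h(3,4) unfolding h(7) by simp
  next
    case 3
    then obtain e f p q w w2 where h: "e \<in> E" "f \<in> E" "w \<in> Ap" "w2 \<in> Ap" "I e = q" "I f = p"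
       "I' = I(e := p, rv e := q \<oplus>\<^sub>a w2, f := q, rv f := q \<oplus>\<^sub>a w)"
      unfolding cconn_def by blast
    then have "p \<in> pts" "q \<in> pts" using assms(1) by auto
    then show ?thesis using assms(1) h(3,4) unfolding h(7) by simp
  qed
qed

lemma cmove_monotone:
  assumes c: "config I" and m: "cmove I I'"
  shows "(adj I)\<^sup>* \<subseteq> (adj I')\<^sup>*" "P \<subseteq> (\<Union>e\<in>E. asupp (snd (I' e)))" "qle I p q \<Longrightarrow> qle I' p q"
proof -
  have k: "kept I I' g" if "g \<in> E" for g using kept_move[OF c m that] .
  have "adj I \<subseteq> (adj I')\<^sup>*" using k by (auto simp: adj_def kept_def)
  then show "(adj I)\<^sup>* \<subseteq> (adj I')\<^sup>*" by (metis rtrancl_subset_rtrancl)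
  show "P \<subseteq> (\<Union>e\<in>E. asupp (snd (I' e)))" using k c by (fastforce simp: config_def kept_def)
  have "\<forall>e\<in>E. I' e \<in> pts" using cmove_pts m c by (auto simp: config_def)
  then show "qle I p q \<Longrightarrow> qle I' p q" using qle_mono k by (meson kept_def)
qed

lemma config_move:
  assumes c: "config I" and m: "cmove I I'"
  shows "config I'"
proof -
  have p: "\<forall>e\<in>E. I' e \<in> pts" using cmove_pts m c by (auto simp: config_def)
  then have "(\<Union>e\<in>E. asupp (snd (I' e))) \<subseteq> P" by (fastforce simp: pts_def Ap_def)
  then show ?thesis using p c cmove_monotone[OF c m] by (auto simp: config_def)
qed

lemma qle_move: "config I \<Longrightarrow> cmove I I' \<Longrightarrow> qle I' = qle I"
  by (auto simp: fun_eq_iff intro: cmove_monotone config_move dest: cmove_sym)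

lemma config_reach: "cmove\<^sup>*\<^sup>* I I' \<Longrightarrow> config I \<Longrightarrow> config I' \<and> qle I' = qle I"
  by (induction rule: rtranclp_induct) (auto dest: config_move qle_move)

section \<open>Sliding endpoints along fixed edges\<close>

definition kstep :: "'e set \<Rightarrow> ('e \<Rightarrow> 'v apoint) \<Rightarrow> 'v apoint \<Rightarrow> 'v apoint \<Rightarrow> bool" where
  "kstep K I p q \<longleftrightarrow> (\<exists>e\<in>K. \<exists>u\<in>Ap. p = I e \<oplus>\<^sub>a u \<and> q = I (rv e) \<oplus>\<^sub>a u)"

text \<open>
  A step of conjugacy along an edge other than \<open>f\<close> is exactly a slide of an end of \<open>f\<close>.
\<close>

lemma slide_along:
  assumes K: "K \<subseteq> E" "rv ` K \<subseteq> K" and f: "f \<in> E" "f \<notin> K"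
    and "(kstep K I)\<^sup>*\<^sup>* (I f) s"
  shows "cmove\<^sup>*\<^sup>* I (I(f := s))"
  using assms(5)
proof (induction rule: rtranclp_induct)
  case (step s t)
  then obtain e u where e: "e \<in> K" "u \<in> Ap" "s = I e \<oplus>\<^sub>a u" "t = I (rv e) \<oplus>\<^sub>a u"
    by (auto simp: kstep_def)
  have "cslide (I(f := s)) (I(f := t))"
    unfolding cslide_def using e K f
    by (intro exI[of _ e] exI[of _ f] exI[of _ u]) auto
  then have "cmove (I(f := s)) (I(f := t))" by (simp add: cmove_def)
  with step.IH show ?case by (metis rtranclp.rtrancl_into_rtrancl)
qed simp

text \<open>
  Since the edges in \<open>K\<close> are not touched, the endpoints in \<open>B\<close> can be moved independently.
\<close>

lemma multi_slide:
  assumes K: "K \<subseteq> E" "rv ` K \<subseteq> K" and B: "B \<subseteq> E" "B \<inter> K = {}"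
    and s: "\<And>b. b \<in> B \<Longrightarrow> (kstep K I)\<^sup>*\<^sup>* (I b) (s b)"
  shows "cmove\<^sup>*\<^sup>* I (\<lambda>e. if e \<in> B then s e else I e)"
proof -
  have "finite B" using B finE finite_subset by blast
  then show ?thesis using B s
  proof (induction B)
    case (insert b B)
    let ?J = "\<lambda>e. if e \<in> B then s e else I e"
    have J: "cmove\<^sup>*\<^sup>* I ?J" using insert by auto
    have "?J e = I e" "?J (rv e) = I (rv e)" if "e \<in> K" for e
      using that K insert.prems by auto
    then have "kstep K ?J = kstep K I" by (auto simp: kstep_def fun_eq_iff)
    then have "(kstep K ?J)\<^sup>*\<^sup>* (?J b) (s b)" using insert by auto
    then have "cmove\<^sup>*\<^sup>* ?J (?J(b := s b))"
      using K insert.prems by (intro slide_along) auto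
    moreover have "?J(b := s b) = (\<lambda>e. if e \<in> insert b B then s e else I e)"
      by (auto simp: fun_eq_iff)
    ultimately show ?case using J by (metis (no_types, lifting) rtranclp_trans)
  qed simp
qed

end

section \<open>Layouts over the minimal points\<close>

text \<open>
  The features of a quasi-conjugacy class \<open>Q\<close> with support \<open>S\<close> on which the
  rearrangement of edges relies.  The finite set \<open>X\<close> represents the minimal points.
\<close>

locale gbs_class = gbs_frame V E rv P
  for V :: "'v set" and E :: "'e set" and rv and P +
  fixes X Q :: "'v apoint set" and S :: "nat set"
  assumes X: "finite X" "X \<subseteq> Q" "Q \<subseteq> pts" and S: "S \<subseteq> P"
    and Q_up: "\<And>p u. p \<in> Q \<Longrightarrow> u \<in> Ap \<Longrightarrow> asupp u \<subseteq> S \<Longrightarrow> p \<oplus>\<^sub>a u \<in> Q"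
    and Q_gap: "\<And>p u. p \<in> Q \<Longrightarrow> u \<in> Ap \<Longrightarrow> p \<oplus>\<^sub>a u \<in> Q \<Longrightarrow> asupp u \<subseteq> S"
    and Q_below: "\<And>p. p \<in> Q \<Longrightarrow> \<exists>x\<in>X. le x p"
begin

definition fam :: "'v apoint \<Rightarrow> 'v apoint \<Rightarrow> bool" where
  "fam p q \<longleftrightarrow> fst p = fst q \<and> asupp (snd q - snd p) \<subseteq> S"

definition Full :: "avec set" where
  "Full = {a \<in> Ap. asupp a = S}"

definition High :: "int \<Rightarrow> avec set" where
  "High h = {a \<in> Full. \<forall>r\<in>S. h \<le> co a r}"

text \<open>
  Here \<open>\<eta> x\<close> is the oriented edge that starts at the minimal point \<open>x\<close>, and every oriented
  edge \<open>n\<close> that starts elsewhere does so at \<open>\<sigma> n \<oplus>\<^sub>a \<alpha> n\<close>.  The functions \<open>\<eta>\<close>, \<open>\<sigma>\<close>, \<open>\<alpha>\<close> are part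
  of the state: connections and swaps exchange the roles of edges, and \<open>\<sigma>\<close> is a choice
  whenever an endpoint lies above several minimal points.
\<close>

definition layout where
  "layout I \<eta> \<sigma> \<alpha> \<longleftrightarrow> \<eta> ` X \<subseteq> E \<and> inj_on \<eta> X \<and> (\<forall>x\<in>X. rv (\<eta> x) \<notin> \<eta> ` X) \<and> (\<forall>x\<in>X. I (\<eta> x) = x) \<and>
     (\<forall>n\<in>E - \<eta> ` X. \<sigma> n \<in> X \<and> \<alpha> n \<in> Full \<and> I n = \<sigma> n \<oplus>\<^sub>a \<alpha> n)"

text \<open>
  Every endpoint lies over a root: the edge at the minimal point \<open>\<sigma> n\<close> returns to \<open>\<sigma> n\<close>.
\<close>

definition rooted where
  "rooted \<eta> \<sigma> \<longleftrightarrow> (\<forall>n\<in>E - \<eta> ` X. \<sigma> (rv (\<eta> (\<sigma> n))) = \<sigma> n)"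

definition linked where
  "linked I \<longleftrightarrow> (\<forall>p\<in>Q. \<forall>q\<in>Q. qle I p q) \<and> (\<forall>p\<in>Q. \<forall>q\<in>pts. qle I p q \<and> qle I q p \<longrightarrow> q \<in> Q)"

definition floats where
  "floats \<eta> f \<longleftrightarrow> f \<in> E - \<eta> ` X \<and> rv f \<notin> \<eta> ` X"

text \<open>
  A bound beyond which an endpoint over one minimal point lies over all those of the family.
\<close>

definition height :: int where
  "height = 1 + (\<Sum>x\<in>X. \<Sum>r\<in>P. co (snd x) r)"

lemma finS: "finite S"
  using S P finite_subset by blast

lemma Full_Ap: "a \<in> Full \<Longrightarrow> a \<in> Ap"
  by (simp add: Full_def)

lemma Full_supp: "a \<in> Full \<Longrightarrow> asupp a = S"
  by (simp add: Full_def)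

lemma Full_add: "a \<in> Full \<Longrightarrow> b \<in> Full \<Longrightarrow> a + b \<in> Full"
  by (auto simp: Full_def asupp_add)

lemma High_Full: "a \<in> High h \<Longrightarrow> a \<in> Full"
  by (simp add: High_def)

lemma Full_pos: "a \<in> Full \<Longrightarrow> r \<in> S \<Longrightarrow> co a r > 0"
  using Full_supp[of a] Full_Ap[of a] mem_asupp[of r a] by (simp add: Ap_def order_less_le)

lemma Full_zero: "a \<in> Full \<Longrightarrow> r \<notin> S \<Longrightarrow> co a r = 0"
  using Full_supp[of a] by (auto simp: mem_asupp)

lemma FullI: "(\<And>r. r \<in> S \<Longrightarrow> co a r > 0) \<Longrightarrow> (\<And>r. r \<notin> S \<Longrightarrow> co a r = 0) \<Longrightarrow> a \<in> Full"
  using S unfolding Full_def Ap_def set_eq_iff subset_iff mem_Collect_eq mem_asupp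
  by (metis less_le order_refl)

lemma HighI: "a \<in> Full \<Longrightarrow> (\<And>r. r \<in> S \<Longrightarrow> h \<le> co a r) \<Longrightarrow> a \<in> High h"
  by (simp add: High_def)

lemma High_add: "a \<in> Full \<Longrightarrow> b \<in> High h \<Longrightarrow> a + b \<in> High h"
  by (rule HighI) (use Full_pos[of a] in \<open>force simp: High_def intro: Full_add\<close>)+

declare Full_Ap [intro, simp] Full_add [intro, simp] High_Full [intro]

text \<open>
  The device for pushing endpoints up: enough multiples of a full-support vector outweigh
  any difference supported in \<open>S\<close>.
\<close>

lemma lift_high:
  assumes w: "w \<in> Full" and bd: "asupp b \<subseteq> S" "asupp d \<subseteq> S"
  shows "\<exists>k. b + amult k w - d \<in> High h"
proof -
  define m where "m r = \<bar>h\<bar> + 1 + \<bar>co b r\<bar> + \<bar>co d r\<bar>" for r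
  define k where "k = nat (\<Sum>r\<in>S. m r)"
  have *: "co (b + amult k w - d) r \<ge> \<bar>h\<bar> + 1" if r: "r \<in> S" for r
  proof -
    have "m r \<le> (\<Sum>r\<in>S. m r)"
      using finS r by (intro member_le_sum) (auto simp: m_def)
    then have "m r \<le> int k" by (simp add: k_def)
    also have "\<dots> \<le> int k * co w r" using Full_pos[OF w r] by (simp add: mult_le_cancel_left1)
    finally show ?thesis by (simp add: m_def)
  qed
  have "co (b + amult k w - d) r = 0" if "r \<notin> S" for r
    using that bd Full_zero[OF w that] mem_asupp[of r b] mem_asupp[of r d] by auto
  then have "b + amult k w - d \<in> Full" using * by (intro FullI) force+
  then have "b + amult k w - d \<in> High h" using * by (intro HighI) force+
  then show ?thesis ..
qed

lemma X_pts: "x \<in> X \<Longrightarrow> x \<in> pts"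
  using X by auto

lemma high_move:
  assumes "x \<in> X" "y \<in> X" "fam x y" "c \<in> High height"
  shows "\<exists>c'\<in>Full. x \<oplus>\<^sub>a c = y \<oplus>\<^sub>a c'"
proof -
  let ?c = "c + snd x - snd y"
  have nn: "co (snd z) r \<ge> 0" if "z \<in> X" for z r
    using X_pts[OF that] by (auto simp: pts_def Ap_def)
  have y: "co (snd y) r < height" if "r \<in> S" for r
  proof -
    have "co (snd y) r \<le> (\<Sum>r\<in>P. co (snd y) r)"
      using that S P assms by (intro member_le_sum) (auto simp: nn)
    also have "\<dots> \<le> (\<Sum>x\<in>X. \<Sum>r\<in>P. co (snd x) r)"
      using X assms nn by (intro member_le_sum[of y X "\<lambda>x. \<Sum>r\<in>P. co (snd x) r"]) (force intro!: sum_nonneg)+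
    finally show ?thesis by (simp add: height_def)
  qed
  have "?c \<in> Full"
  proof (rule FullI)
    fix r assume r: "r \<in> S"
    then have "co c r \<ge> height" using assms by (simp add: High_def)
    then show "co ?c r > 0" using y[OF r] nn[OF assms(1), of r] by simp
  next
    fix r assume r: "r \<notin> S"
    then have "co (snd y - snd x) r = 0" "co c r = 0"
      using assms Full_zero[of c r] by (auto simp: fam_def mem_asupp simp del: co_simps)
    then show "co ?c r = 0" by simp
  qed
  moreover have "x \<oplus>\<^sub>a c = y \<oplus>\<^sub>a ?c"
    using assms by (auto simp: shift_def fam_def add.commute)
  ultimately show ?thesis by blast
qed

context
  fixes I \<eta> \<sigma> \<alpha>
  assumes layout: "layout I \<eta> \<sigma> \<alpha>"
begin

lemma layout_eta: "x \<in> X \<Longrightarrow> \<eta> x \<in> E" "x \<in> X \<Longrightarrow> y \<in> X \<Longrightarrow> \<eta> x = \<eta> y \<longleftrightarrow> x = y" "x \<in> X \<Longrightarrow> I (\<eta> x) = x"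
  "x \<in> X \<Longrightarrow> rv (\<eta> x) \<notin> \<eta> ` X" "x \<in> X \<Longrightarrow> y \<in> X \<Longrightarrow> rv (\<eta> x) \<noteq> \<eta> y" "x \<in> X \<Longrightarrow> y \<in> X \<Longrightarrow> \<eta> y \<noteq> rv (\<eta> x)"
proof -
  show b: "x \<in> X \<Longrightarrow> rv (\<eta> x) \<notin> \<eta> ` X" using layout by (simp add: layout_def)
  then show "x \<in> X \<Longrightarrow> y \<in> X \<Longrightarrow> rv (\<eta> x) \<noteq> \<eta> y" "x \<in> X \<Longrightarrow> y \<in> X \<Longrightarrow> \<eta> y \<noteq> rv (\<eta> x)"
    by (metis imageI)+
qed (use layout in \<open>auto simp: layout_def inj_on_def\<close>)

lemma layout_non: "n \<in> E \<Longrightarrow> n \<notin> \<eta> ` X \<Longrightarrow> \<sigma> n \<in> X" "n \<in> E \<Longrightarrow> n \<notin> \<eta> ` X \<Longrightarrow> \<alpha> n \<in> Full"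
  "n \<in> E \<Longrightarrow> n \<notin> \<eta> ` X \<Longrightarrow> I n = \<sigma> n \<oplus>\<^sub>a \<alpha> n"
  using layout by (auto simp: layout_def)

lemma layout_rv: "x \<in> X \<Longrightarrow> rv (\<eta> x) \<in> E" "x \<in> X \<Longrightarrow> \<sigma> (rv (\<eta> x)) \<in> X" "x \<in> X \<Longrightarrow> \<alpha> (rv (\<eta> x)) \<in> Full"
  "x \<in> X \<Longrightarrow> I (rv (\<eta> x)) = \<sigma> (rv (\<eta> x)) \<oplus>\<^sub>a \<alpha> (rv (\<eta> x))"
  using layout_eta layout_non by auto

lemma layout_rv_eq: "x \<in> X \<Longrightarrow> y \<in> X \<Longrightarrow> rv (\<eta> x) = rv (\<eta> y) \<longleftrightarrow> x = y"
  using layout_eta rv by metis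

lemma layout_down:
  assumes "x \<in> X" "\<eta> x \<in> K" "u \<in> Ap"
  shows "kstep K I (x \<oplus>\<^sub>a u) (\<sigma> (rv (\<eta> x)) \<oplus>\<^sub>a (\<alpha> (rv (\<eta> x)) + u))"
  unfolding kstep_def using assms layout_eta(3)[OF assms(1)] layout_rv(4)[OF assms(1)]
  by (intro bexI[of _ "\<eta> x"] bexI[of _ u]) auto

lemma layout_up:
  assumes "x \<in> X" "rv (\<eta> x) \<in> K" "u \<in> Ap"
  shows "kstep K I (\<sigma> (rv (\<eta> x)) \<oplus>\<^sub>a (\<alpha> (rv (\<eta> x)) + u)) (x \<oplus>\<^sub>a u)"
  unfolding kstep_def using assms layout_eta(1,3)[OF assms(1)] layout_rv(4)[OF assms(1)]
  by (intro bexI[of _ "rv (\<eta> x)"] bexI[of _ u]) auto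

lemma layout_loop:
  assumes "r \<in> X" "\<eta> r \<in> K" "\<sigma> (rv (\<eta> r)) = r" "u \<in> Ap"
  shows "(kstep K I)\<^sup>*\<^sup>* (r \<oplus>\<^sub>a u) (r \<oplus>\<^sub>a (u + amult k (\<alpha> (rv (\<eta> r)))))"
proof (induction k)
  case (Suc k)
  have "u + amult k (\<alpha> (rv (\<eta> r))) \<in> Ap"
    using assms(4) layout_rv(3)[OF assms(1)] by auto
  from layout_down[OF assms(1,2) this] show ?case
    using Suc assms(3) by (auto simp: amult_Suc add_ac intro: rtranclp.rtrancl_into_rtrancl)
qed simp

end

section \<open>Rooted layouts\<close>

text \<open>
  Slide everything that lies over \<open>z\<close> along the edge at \<open>z\<close>.  The far end of that edge lies
  over \<open>y \<noteq> z\<close>, so the edge itself is not among those that move.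
\<close>

lemma elim_point:
  assumes layout: "layout I \<eta> \<sigma> \<alpha>" and z: "z \<in> X" and y: "\<sigma> (rv (\<eta> z)) = y" "y \<noteq> z"
  shows "\<exists>I' \<alpha>'. cmove\<^sup>*\<^sup>* I I' \<and> layout I' \<eta> (\<lambda>n. if \<sigma> n = z then y else \<sigma> n) \<alpha>'"
proof -
  note [simp] = layout_eta[OF layout] layout_non[OF layout] layout_rv[OF layout]
  let ?K = "{\<eta> z, rv (\<eta> z)}" and ?B = "{n \<in> E - \<eta> ` X. \<sigma> n = z}"
  let ?\<alpha> = "\<lambda>n. if n \<in> ?B then \<alpha> (rv (\<eta> z)) + \<alpha> n else \<alpha> n"
  let ?s = "\<lambda>n. y \<oplus>\<^sub>a (\<alpha> (rv (\<eta> z)) + \<alpha> n)"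
  let ?I = "\<lambda>n. if n \<in> ?B then ?s n else I n"
  have "cmove\<^sup>*\<^sup>* I ?I"
  proof (rule multi_slide[where K = ?K])
    fix b assume b: "b \<in> ?B"
    then have "kstep ?K I (I b) (?s b)"
      using layout_down[OF layout z, of ?K "\<alpha> b"] y by auto
    then show "(kstep ?K I)\<^sup>*\<^sup>* (I b) (?s b)" by (rule r_into_rtranclp)
  qed (use z y in auto)
  moreover have "layout ?I \<eta> (\<lambda>n. if \<sigma> n = z then y else \<sigma> n) ?\<alpha>"
    unfolding layout_def using z y layout by (auto simp: layout_def)
  ultimately show ?thesis by blast
qed

text \<open>
  Gaussian elimination on the functional graph: the minimal points are treated one by one,
  and after \<open>A\<close> has been treated, an endpoint lies over a point of \<open>A\<close> only if that point is a
  root.  When the last point of a cycle is reached, its edge has become a loop.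
\<close>

lemma make_rooted:
  assumes layout: "layout I \<eta> \<sigma> \<alpha>"
  shows "\<exists>I' \<sigma>' \<alpha>'. cmove\<^sup>*\<^sup>* I I' \<and> layout I' \<eta> \<sigma>' \<alpha>' \<and> rooted \<eta> \<sigma>'"
proof -
  have "\<exists>I' \<sigma>' \<alpha>'. cmove\<^sup>*\<^sup>* I I' \<and> layout I' \<eta> \<sigma>' \<alpha>' \<and>
     (\<forall>n\<in>E - \<eta> ` X. \<sigma>' n \<in> A \<longrightarrow> \<sigma>' (rv (\<eta> (\<sigma>' n))) = \<sigma>' n)" if "finite A" "A \<subseteq> X" for A
    using that
  proof (induction A)
    case empty
    then show ?case using layout by blast
  next
    case (insert z A)
    then obtain J \<sigma>' \<alpha>' where J: "cmove\<^sup>*\<^sup>* I J" "layout J \<eta> \<sigma>' \<alpha>'"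
      and inv: "\<And>n. n \<in> E \<Longrightarrow> n \<notin> \<eta> ` X \<Longrightarrow> \<sigma>' n \<in> A \<Longrightarrow> \<sigma>' (rv (\<eta> (\<sigma>' n))) = \<sigma>' n" by auto
    note [simp] = layout_eta[OF J(2)] layout_non[OF J(2)] layout_rv[OF J(2)]
    have z: "z \<in> X" using insert by auto
    show ?case
    proof (cases "\<sigma>' (rv (\<eta> z)) = z")
      case True
      then show ?thesis using J inv by blast
    next
      case False
      define y where "y = \<sigma>' (rv (\<eta> z))"
      obtain J' \<beta> where J': "cmove\<^sup>*\<^sup>* J J'" "layout J' \<eta> (\<lambda>n. if \<sigma>' n = z then y else \<sigma>' n) \<beta>"
        using elim_point[OF J(2) z y_def[symmetric] False[folded y_def]] by blast
      have yy: "y \<in> A \<Longrightarrow> \<sigma>' (rv (\<eta> y)) = y" using inv[of "rv (\<eta> z)"] z by (simp add: y_def)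
      have "(\<lambda>n. if \<sigma>' n = z then y else \<sigma>' n) (rv (\<eta> s)) = s"
        if "n \<in> E - \<eta> ` X" "s = (if \<sigma>' n = z then y else \<sigma>' n)" "s \<in> insert z A" for n s
        using that False yy inv[of n] by (auto simp: y_def split: if_splits)
      then have "\<forall>n\<in>E - \<eta> ` X. (\<lambda>n. if \<sigma>' n = z then y else \<sigma>' n) n \<in> insert z A \<longrightarrow>
        (\<lambda>n. if \<sigma>' n = z then y else \<sigma>' n) (rv (\<eta> ((\<lambda>n. if \<sigma>' n = z then y else \<sigma>' n) n))) =
        (\<lambda>n. if \<sigma>' n = z then y else \<sigma>' n) n" by blast
      then show ?thesis using rtranclp_trans[OF J(1) J'(1)] J'(2) by blast
    qed
  qed
  from this[of X] X layout_non show ?thesis unfolding rooted_def by (metis DiffD1 DiffD2 order_refl)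
qed

section \<open>Merging the roots\<close>

lemma image_redirect:
  assumes "\<eta> ` X \<subseteq> E" "inj_on \<eta> X" "r \<in> X" "g \<notin> \<eta> ` X"
  shows "(\<eta>(r := g)) ` X = insert g (\<eta> ` X - {\<eta> r})"
  using assms by (auto simp: inj_on_def image_iff)

lemma rv_flip: "e \<in> E \<Longrightarrow> f \<in> E \<Longrightarrow> rv e = f \<longleftrightarrow> e = rv f"
  by auto

lemma float_neq:
  assumes f: "floats \<eta> f" and x: "x \<in> X" "\<eta> x \<in> E"
  shows "f \<noteq> \<eta> x" "rv f \<noteq> \<eta> x" "f \<noteq> rv (\<eta> x)" "rv f \<noteq> rv (\<eta> x)"
proof -
  show 1: "f \<noteq> \<eta> x" and 2: "rv f \<noteq> \<eta> x" using f x by (auto simp: floats_def)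
  then show "f \<noteq> rv (\<eta> x)" "rv f \<noteq> rv (\<eta> x)" using f x unfolding floats_def by (metis DiffD1 rv_simps(2))+
qed

lemma cconn_I:
  assumes "e \<in> E" "f \<in> E" "f \<noteq> e" "f \<noteq> rv e" "w \<in> Ap" "w1 \<in> Ap" "w2 \<in> Ap" "w1 + w2 = amult k w"
    "I (rv e) = p \<oplus>\<^sub>a w1" "I f = p" "I (rv f) = p \<oplus>\<^sub>a w"
  shows "cmove I (I(e := p, rv e := I e \<oplus>\<^sub>a w2, f := I e, rv f := I e \<oplus>\<^sub>a w))"
  unfolding cmove_def cconn_def using assms by blast

text \<open>
  The connection is applied to the floating edge as \<open>q --- p + w1\<close> and to the loop as \<open>p --- p + w\<close>,
  with \<open>p = r\<close> and \<open>q = r' + b\<close>; in particular \<open>q\<close> need not be minimal.  Afterwards the former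
  floating edge attaches \<open>r\<close> to \<open>r'\<close>, and the former loop floats over \<open>r'\<close>.
\<close>

lemma conn_merge:
  assumes layout: "layout I \<eta> \<sigma> \<alpha>" and rt: "rooted \<eta> \<sigma>" and f: "floats \<eta> f" and ne: "\<sigma> f \<noteq> \<sigma> (rv f)"
  shows "\<exists>I' \<eta>' \<sigma>' \<alpha>' f'. cmove\<^sup>*\<^sup>* I I' \<and> layout I' \<eta>' \<sigma>' \<alpha>' \<and> rooted \<eta>' \<sigma>' \<and> floats \<eta>' f' \<and>
     \<sigma>' ` (E - \<eta>' ` X) \<subset> \<sigma> ` (E - \<eta> ` X)"
proof -
  note [simp] = layout_eta[OF layout] layout_non[OF layout] layout_rv[OF layout]
  define r where "r = \<sigma> f"
  define r' where "r' = \<sigma> (rv f)"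
  define a where "a = \<alpha> f"
  define b where "b = \<alpha> (rv f)"
  define w where "w = \<alpha> (rv (\<eta> r))"
  have fE: "f \<in> E" "f \<notin> \<eta> ` X" "rv f \<in> E" "rv f \<notin> \<eta> ` X" using f by (auto simp: floats_def)
  have rX: "r \<in> X" "r' \<in> X" "r \<noteq> r'" using fE ne by (auto simp: r_def r'_def)
  have root: "\<sigma> (rv (\<eta> r)) = r" "\<sigma> (rv (\<eta> r')) = r'"
    using rt fE unfolding rooted_def r_def r'_def by auto
  have If: "I f = r \<oplus>\<^sub>a a" "I (rv f) = r' \<oplus>\<^sub>a b" "I (\<eta> r) = r" "I (rv (\<eta> r)) = r \<oplus>\<^sub>a w"
    using fE rX layout_rv(4)[OF layout rX(1)] by (auto simp: r_def r'_def a_def b_def w_def root[unfolded r_def])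
  have F: "a \<in> Full" "b \<in> Full" "w \<in> Full" using fE rX by (auto simp: a_def b_def w_def)
  have "asupp (0::avec) \<subseteq> S" by (auto simp: mem_asupp)
  then obtain k where "0 + amult k w - a \<in> High 0"
    using lift_high[OF F(3), of 0 a 0] Full_supp[OF F(1)] by blast
  then have w2: "amult k w - a \<in> Full" by auto
  \<comment> \<open>the complement of the gap \<open>a\<close> in a multiple of the loop vector\<close>
  define w2 where "w2 = amult k w - a"
  have fX: "f \<noteq> \<eta> x" "rv f \<noteq> \<eta> x" "f \<noteq> rv (\<eta> x)" "rv f \<noteq> rv (\<eta> x)" if "x \<in> X" for x
    using float_neq[OF f that] that by auto
  note [simp] = fX fX[symmetric] layout_rv_eq[OF layout]
  let ?J = "I(rv f := r, f := r' \<oplus>\<^sub>a (b + w2), \<eta> r := r' \<oplus>\<^sub>a b, rv (\<eta> r) := r' \<oplus>\<^sub>a (b + w))"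
  let ?\<eta> = "\<eta>(r := rv f)" and ?\<sigma> = "\<sigma>(f := r', \<eta> r := r', rv (\<eta> r) := r')"
    and ?\<alpha> = "\<alpha>(f := b + w2, \<eta> r := b, rv (\<eta> r) := b + w)"
  have "cmove I (I(rv f := r, rv (rv f) := I (rv f) \<oplus>\<^sub>a w2, \<eta> r := I (rv f), rv (\<eta> r) := I (rv f) \<oplus>\<^sub>a w))"
    using fE rX F If w2 by (intro cconn_I[where k = k and ?w1.0 = a]) (auto simp: w2_def)
  then have m: "cmove I ?J" using fE If by simp
  have im: "?\<eta> ` X = insert (rv f) (\<eta> ` X - {\<eta> r})"
    using image_redirect[of \<eta> r "rv f"] layout fE rX by (auto simp: layout_def)
  have stJ: "layout ?J ?\<eta> ?\<sigma> ?\<alpha>"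
    unfolding layout_def im
  proof (intro conjI ballI)
    show "insert (rv f) (\<eta> ` X - {\<eta> r}) \<subseteq> E" using fE by auto
    show "inj_on ?\<eta> X" using rX by (auto simp: inj_on_def)
  next
    fix x assume x: "x \<in> X"
    show "rv (?\<eta> x) \<notin> insert (rv f) (\<eta> ` X - {\<eta> r})"
      using x rX fE by (auto simp: image_iff)
    show "?J (?\<eta> x) = x"
      using x rX fE by auto
  next
    fix n assume n: "n \<in> E - insert (rv f) (\<eta> ` X - {\<eta> r})"
    consider "n = \<eta> r" | "n = rv (\<eta> r)" | "n = f"
      | "n \<in> E" "n \<notin> \<eta> ` X" "n \<noteq> \<eta> r" "n \<noteq> rv (\<eta> r)" "n \<noteq> f" "n \<noteq> rv f" using n by blast
    then have "?\<sigma> n \<in> X \<and> ?\<alpha> n \<in> Full \<and> ?J n = ?\<sigma> n \<oplus>\<^sub>a ?\<alpha> n"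
      by cases (use rX F fE w2 in \<open>simp_all add: w2_def\<close>)
    then show "?\<sigma> n \<in> X" "?\<alpha> n \<in> Full" "?J n = ?\<sigma> n \<oplus>\<^sub>a ?\<alpha> n" by blast+
  qed
  have y: "?\<sigma> (rv (?\<eta> r)) = r'" "r' \<noteq> r" using fE rX by auto
  let ?\<tau> = "\<lambda>n. if ?\<sigma> n = r then r' else ?\<sigma> n"
  obtain I' \<alpha>' where I': "cmove\<^sup>*\<^sup>* ?J I'" "layout I' ?\<eta> ?\<tau> \<alpha>'"
    using elim_point[OF stJ rX(1) y] by blast
  have old: "n \<in> E - \<eta> ` X" "?\<tau> n = \<sigma> n" "\<sigma> n \<noteq> r" if "n \<in> E - ?\<eta> ` X" "?\<tau> n \<noteq> r'" for n
  proof -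
    have n: "n \<noteq> \<eta> r" "n \<noteq> rv (\<eta> r)" "n \<noteq> f" using that(2) rX by force+
    then have \<sigma>: "?\<sigma> n = \<sigma> n" by simp
    show "n \<in> E - \<eta> ` X" using that(1) n unfolding im by blast
    show ne: "\<sigma> n \<noteq> r" using that(2) unfolding \<sigma> by force
    show "?\<tau> n = \<sigma> n" using ne unfolding \<sigma> by simp
  qed
  have "rooted ?\<eta> ?\<tau>"
    unfolding rooted_def
  proof
    fix n assume n: "n \<in> E - ?\<eta> ` X"
    show "?\<tau> (rv (?\<eta> (?\<tau> n))) = ?\<tau> n"
    proof (cases "?\<tau> n = r'")
      case True
      show ?thesis unfolding True using rX root by simp
    next
      case False
      note o = old[OF n False]
      have "\<sigma> (rv (\<eta> (\<sigma> n))) = \<sigma> n" using rt o(1) by (simp add: rooted_def)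
      then show ?thesis unfolding o(2) using o rX by simp
    qed
  qed
  note rt' = this
  have fl': "floats ?\<eta> (\<eta> r)"
    unfolding floats_def im using rX fE by simp
  have less: "?\<tau> ` (E - ?\<eta> ` X) \<subset> \<sigma> ` (E - \<eta> ` X)"
  proof
    have "r' \<in> \<sigma> ` (E - \<eta> ` X)" using fE r'_def by blast
    then show "?\<tau> ` (E - ?\<eta> ` X) \<subseteq> \<sigma> ` (E - \<eta> ` X)" using old by (smt (verit, best) image_iff subsetI)
    have "r \<in> \<sigma> ` (E - \<eta> ` X)" using fE r_def by blast
    moreover have "r \<notin> ?\<tau> ` (E - ?\<eta> ` X)" using rX by auto
    ultimately show "?\<tau> ` (E - ?\<eta> ` X) \<noteq> \<sigma> ` (E - \<eta> ` X)" by blast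
  qed
  show ?thesis
    by (intro exI conjI) (rule converse_rtranclp_into_rtranclp[of cmove, OF m I'(1)] I'(2) rt' fl' less)+
qed

text \<open>
  The endpoint is lifted along the loop at the root until it can be slid back over the edge
  at \<open>x\<close> and arrives so high over \<open>x\<close> that it lies over \<open>y\<close> as well; from there it follows
  the edge at \<open>y\<close>.
\<close>

lemma bridge:
  assumes layout: "layout I \<eta> \<sigma> \<alpha>" and rt: "rooted \<eta> \<sigma>" and f: "floats \<eta> f"
    and xy: "x \<in> X" "y \<in> X" "fam x y" "\<sigma> (rv (\<eta> x)) = \<sigma> f"
  shows "\<exists>I' \<alpha>'. cmove\<^sup>*\<^sup>* I I' \<and> layout I' \<eta> (\<sigma>(f := \<sigma> (rv (\<eta> y)))) \<alpha>'"
proof -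
  note [simp] = layout_eta[OF layout] layout_non[OF layout] layout_rv[OF layout]
  define r where "r = \<sigma> f"
  define a where "a = \<alpha> f"
  define w where "w = \<alpha> (rv (\<eta> r))"
  define b where "b = \<alpha> (rv (\<eta> x))"
  let ?K = "\<eta> ` X \<union> rv ` \<eta> ` X"
  have fE: "f \<in> E" "f \<notin> \<eta> ` X" "rv f \<in> E" "rv f \<notin> \<eta> ` X" using f by (auto simp: floats_def)
  have rX: "r \<in> X" using fE by (auto simp: r_def)
  have root: "\<sigma> (rv (\<eta> r)) = r"
    using rt fE unfolding rooted_def r_def by auto
  have F: "a \<in> Full" "b \<in> Full" "w \<in> Full" using fE rX xy by (auto simp: a_def b_def w_def)
  \<comment> \<open>\<open>k\<close> turns around the loop bring \<open>r + a\<close> to \<open>r + b\<close> plus something high\<close>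
  obtain k where k: "a + amult k w - b \<in> High height"
    using lift_high[OF F(3), of a b height] Full_supp[OF F(1)] Full_supp[OF F(2)] by blast
  define c where "c = a + amult k w - b"
  obtain c' where c': "c' \<in> Full" "x \<oplus>\<^sub>a c = y \<oplus>\<^sub>a c'"
    using high_move[OF xy(1-3) k] unfolding c_def by blast
  define s where "s = \<sigma> (rv (\<eta> y)) \<oplus>\<^sub>a (\<alpha> (rv (\<eta> y)) + c')"
  have cF: "c \<in> Ap" using k by (auto simp: c_def)
  have "(kstep ?K I)\<^sup>*\<^sup>* (I f) s"
  proof -
    have "(kstep ?K I)\<^sup>*\<^sup>* (I f) (r \<oplus>\<^sub>a (b + c))"
      using layout_loop[OF layout rX _ root, of ?K a k] rX fE F by (simp add: r_def a_def c_def w_def)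
    also have "(kstep ?K I) (r \<oplus>\<^sub>a (b + c)) (x \<oplus>\<^sub>a c)"
      using layout_up[OF layout xy(1) _ cF, of ?K] xy by (simp add: r_def b_def)
    also have "(kstep ?K I) (x \<oplus>\<^sub>a c) s"
      unfolding c'(2) s_def using layout_down[OF layout xy(2), of ?K c'] xy c' by simp
    finally show ?thesis .
  qed
  then have "cmove\<^sup>*\<^sup>* I (I(f := s))"
    using fE by (intro slide_along[of ?K]) (auto simp: rv_flip)
  moreover have "layout (I(f := s)) \<eta> (\<sigma>(f := \<sigma> (rv (\<eta> y)))) (\<alpha>(f := \<alpha> (rv (\<eta> y)) + c'))"
    using layout fE xy c' unfolding layout_def by (auto simp: s_def)
  ultimately show ?thesis by blast
qed

lemma bridge_rooted:
  assumes "rooted \<eta> \<sigma>" "layout I \<eta> \<sigma> \<alpha>" "floats \<eta> f" "y \<in> X"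
  shows "rooted \<eta> (\<sigma>(f := \<sigma> (rv (\<eta> y))))"
    "(\<sigma>(f := \<sigma> (rv (\<eta> y)))) ` (E - \<eta> ` X) \<subseteq> \<sigma> ` (E - \<eta> ` X)"
proof -
  note [simp] = layout_eta[OF assms(2)] layout_non[OF assms(2)] layout_rv[OF assms(2)]
  have "rv (\<eta> z) \<noteq> f" if "z \<in> X" for z
    using that assms(3) by (auto simp: floats_def)
  then show "rooted \<eta> (\<sigma>(f := \<sigma> (rv (\<eta> y))))"
    using assms(1,4) unfolding rooted_def by simp
  show "(\<sigma>(f := \<sigma> (rv (\<eta> y)))) ` (E - \<eta> ` X) \<subseteq> \<sigma> ` (E - \<eta> ` X)"
    using assms(4) by auto
qed

lemma fam_le:
  assumes "x \<in> Q" "p \<in> Q" "le x p" shows "fam x p"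
  using assms(3) Q_gap[OF assms(1)] assms(2) unfolding fam_def le_def by (elim bexE) simp

lemma fam_refl [simp]: "fam p p"
  by (simp add: fam_def mem_asupp subset_iff)

lemma X_Q: "x \<in> X \<Longrightarrow> x \<in> Q"
  using X by blast

lemma fam_sym: "fam p q \<Longrightarrow> fam q p"
  by (auto simp: fam_def mem_asupp subset_iff)

lemma fam_trans: "fam p q \<Longrightarrow> fam q r \<Longrightarrow> fam p r"
  by (auto simp: fam_def mem_asupp subset_iff) metis

text \<open>
  The points in families of minimal points that lead to \<open>r\<close> form a set that no edge and no
  inequality inside \<open>Q\<close> leaves.  As all points of \<open>Q\<close> are equivalent for the
  preorder, this set is all of \<open>Q\<close>.
\<close>

lemma linking:
  assumes layout: "layout I \<eta> \<sigma> \<alpha>" and rt: "rooted \<eta> \<sigma>" and c: "config I" and l: "linked I" and r: "r \<in> X"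
    "\<sigma> (rv (\<eta> r)) = r"
    and fl: "\<And>f. floats \<eta> f \<Longrightarrow> \<sigma> f = \<sigma> (rv f)"
    and closed: "\<And>x y. x \<in> X \<Longrightarrow> y \<in> X \<Longrightarrow> fam x y \<Longrightarrow> \<sigma> (rv (\<eta> x)) = r \<Longrightarrow> \<sigma> (rv (\<eta> y)) = r"
    and y: "y \<in> X"
  shows "\<sigma> (rv (\<eta> y)) = r"
proof -
  note [simp] = layout_eta[OF layout] layout_non[OF layout] layout_rv[OF layout]
  \<comment> \<open>all minimal points of the family of \<open>p\<close> lead to the root \<open>r\<close>\<close>
  define D where "D p \<longleftrightarrow> p \<in> Q \<and> (\<forall>x\<in>X. fam x p \<longrightarrow> \<sigma> (rv (\<eta> x)) = r)" for p
  have D_I: "D p" if "p \<in> Q" "x \<in> X" "\<sigma> (rv (\<eta> x)) = r" "fam x p" for p x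
    unfolding D_def using that closed fam_trans fam_sym by blast
  have D_fam: "D q" if "D p" "q \<in> Q" "fam p q" for p q
    using that unfolding D_def using fam_trans fam_sym by blast
  have IQ: "I e \<in> Q" if "e \<in> E" for e
  proof (cases "e \<in> \<eta> ` X")
    case True
    then show ?thesis using X by auto
  next
    case False
    then have "\<sigma> e \<in> Q" using that X by auto
    then show ?thesis using that False Q_up[of "\<sigma> e" "\<alpha> e"] Full_supp[of "\<alpha> e"] by simp
  qed
  have fI: "fam (\<sigma> n) (I n)" if n: "n \<in> E" "n \<notin> \<eta> ` X" for n
  proof (rule fam_le)
    show "\<sigma> n \<in> Q" "I n \<in> Q" using IQ[OF n(1)] X layout_non(1)[OF layout n] by blast+
    show "le (\<sigma> n) (I n)" using n by auto
  qed
  have edge: "D (I (rv e))" if e: "e \<in> E" and De: "D (I e)" for e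
  proof (cases "e \<in> \<eta> ` X")
    case True
    then obtain x where x: "x \<in> X" "e = \<eta> x" by auto
    have "fam x (I e)" using x by (simp add: fam_def mem_asupp subset_iff)
    then have "\<sigma> (rv e) = r" using De x by (simp add: D_def)
    moreover have "fam (\<sigma> (rv e)) (I (rv e))" using x by (intro fI) auto
    ultimately show ?thesis using D_I[of "I (rv e)" r] r IQ e by auto
  next
    case False
    have f1: "fam (\<sigma> e) (I e)" using e False by (rule fI)
    have se: "\<sigma> e \<in> X" using e False by simp
    have "\<sigma> (rv (\<eta> (\<sigma> e))) = r" using De se f1 by (simp add: D_def)
    moreover have "\<sigma> (rv (\<eta> (\<sigma> e))) = \<sigma> e" using rt e False by (simp add: rooted_def)
    ultimately have sr: "\<sigma> e = r" by simp
    show ?thesis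
    proof (cases "rv e \<in> \<eta> ` X")
      case True
      then obtain x where x: "x \<in> X" "rv e = \<eta> x" by auto
      then have "e = rv (\<eta> x)" using e by (metis rv_simps(2))
      then show ?thesis using D_I[of x x] x sr X_Q[of x] by simp
    next
      case F2: False
      then have "\<sigma> (rv e) = r" using fl[of e] sr False e by (simp add: floats_def)
      moreover have "fam (\<sigma> (rv e)) (I (rv e))" using e F2 by (intro fI) auto
      ultimately show ?thesis using D_I[of "I (rv e)" r] r IQ e by auto
    qed
  qed
  have shift: "fam (I e) (I e \<oplus>\<^sub>a u)" if "e \<in> E" "u \<in> Ap" "I e \<oplus>\<^sub>a u \<in> Q" for e u
    using that IQ by (intro fam_le) auto
  have "qle I q p \<Longrightarrow> q \<in> Q \<Longrightarrow> D p \<Longrightarrow> D q" for p q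
    unfolding qle_def
  proof (induction rule: converse_rtranclp_induct)
    case (step q q1)
    have q1: "qle I q1 p" using step(2) by (simp add: qle_def)
    have "qle I q q1" using step(1) unfolding qle_def by (rule r_into_rtranclp)
    moreover have "qle I q1 q"
      using q1 l step.prems by (auto simp: linked_def D_def intro: qle_trans)
    ultimately have q1Q: "q1 \<in> Q" using l step.prems(1) step(1) by (auto simp: linked_def)
    then have D1: "D q1" using step by blast
    show ?case
    proof (cases "le q q1")
      case True
      then show ?thesis using D_fam[OF D1 step.prems(1)] fam_le[OF step.prems(1) q1Q] fam_sym by blast
    next
      case False
      then obtain e u where e: "e \<in> E" "u \<in> Ap" "q = I e \<oplus>\<^sub>a u" "q1 = I (rv e) \<oplus>\<^sub>a u"
        using step(1) by (auto simp: cstep_def)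
      have "D (I (rv e))" using D_fam[OF D1 IQ] shift[of "rv e" u] q1Q e fam_sym by simp
      then have "D (I e)" using edge[of "rv e"] e by simp
      then show ?thesis using D_fam step.prems(1) shift e by blast
    qed
  qed
  moreover have "qle I y r" "r \<in> Q" "y \<in> Q" using l X_Q[OF r(1)] X_Q[OF y] by (auto simp: linked_def)
  moreover have "D r" using D_I[of r r] r \<open>r \<in> Q\<close> by (simp add: fam_def mem_asupp subset_iff)
  ultimately have "D y" by blast
  then show ?thesis using y by (simp add: D_def fam_def mem_asupp subset_iff)
qed

lemma linked_reach:
  assumes "cmove\<^sup>*\<^sup>* I I'" "config I" "linked I"
  shows "linked I'"
proof -
  have "qle I' = qle I" using config_reach[OF assms(1,2)] ..
  then show ?thesis using assms(3) unfolding linked_def by metis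
qed

lemma merge_step:
  assumes layout: "layout I \<eta> \<sigma> \<alpha>" and rt: "rooted \<eta> \<sigma>" and c: "config I" and l: "linked I"
    and f: "floats \<eta> f" and n: "n \<in> E - \<eta> ` X" "\<sigma> n \<noteq> \<sigma> f"
  shows "\<exists>I' \<eta>' \<sigma>' \<alpha>' f'. cmove\<^sup>*\<^sup>* I I' \<and> layout I' \<eta>' \<sigma>' \<alpha>' \<and> rooted \<eta>' \<sigma>' \<and> floats \<eta>' f' \<and>
     \<sigma>' ` (E - \<eta>' ` X) \<subset> \<sigma> ` (E - \<eta> ` X)"
proof (cases "\<exists>f. floats \<eta> f \<and> \<sigma> f \<noteq> \<sigma> (rv f)")
  case True
  then show ?thesis using conn_merge[OF layout rt] by blast
next
  case False
  note [simp] = layout_eta[OF layout] layout_non[OF layout] layout_rv[OF layout]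
  have fE: "f \<in> E" "f \<notin> \<eta> ` X" "rv f \<in> E" "rv f \<notin> \<eta> ` X" using f by (auto simp: floats_def)
  have r: "\<sigma> f \<in> X" "\<sigma> (rv (\<eta> (\<sigma> f))) = \<sigma> f" using rt fE by (auto simp: rooted_def)
  have "\<exists>x y. x \<in> X \<and> y \<in> X \<and> fam x y \<and> \<sigma> (rv (\<eta> x)) = \<sigma> f \<and> \<sigma> (rv (\<eta> y)) \<noteq> \<sigma> f"
  proof (rule ccontr)
    assume "\<not> ?thesis"
    then have "\<sigma> (rv (\<eta> (\<sigma> n))) = \<sigma> f"
      using linking[OF layout rt c l r, of "\<sigma> n"] False n by auto
    then show False using rt n by (simp add: rooted_def)
  qed
  then obtain x y where xy: "x \<in> X" "y \<in> X" "fam x y" "\<sigma> (rv (\<eta> x)) = \<sigma> f" and ne: "\<sigma> (rv (\<eta> y)) \<noteq> \<sigma> f" by blast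
  obtain J \<alpha>' where J: "cmove\<^sup>*\<^sup>* I J" "layout J \<eta> (\<sigma>(f := \<sigma> (rv (\<eta> y)))) \<alpha>'"
    using bridge[OF layout rt f xy] by blast
  have "(\<sigma>(f := \<sigma> (rv (\<eta> y)))) f \<noteq> (\<sigma>(f := \<sigma> (rv (\<eta> y)))) (rv f)"
    using False f ne fE by auto
  from conn_merge[OF J(2) bridge_rooted(1)[OF rt layout f xy(2)] f this]
  obtain I' \<eta>' \<sigma>' \<alpha>' f' where *: "cmove\<^sup>*\<^sup>* J I'" "layout I' \<eta>' \<sigma>' \<alpha>'" "rooted \<eta>' \<sigma>'" "floats \<eta>' f'"
     "\<sigma>' ` (E - \<eta>' ` X) \<subset> (\<sigma>(f := \<sigma> (rv (\<eta> y)))) ` (E - \<eta> ` X)"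
    by (elim exE conjE) (rule that; assumption)
  show ?thesis
    by (intro exI conjI)
      (rule rtranclp_trans[OF J(1) *(1)] *(2-4) psubset_subset_trans[OF *(5) bridge_rooted(2)[OF rt layout f xy(2)]])+
qed

text \<open>
  Induction on the number of roots, with a floating edge carried along.
\<close>

lemma single_root:
  assumes "layout I \<eta> \<sigma> \<alpha>" "rooted \<eta> \<sigma>" "config I" "linked I" "floats \<eta> f"
  shows "\<exists>I' \<eta>' \<sigma>' \<alpha>' f' r. cmove\<^sup>*\<^sup>* I I' \<and> layout I' \<eta>' \<sigma>' \<alpha>' \<and> floats \<eta>' f' \<and> r \<in> X \<and> (\<forall>n\<in>E - \<eta>' ` X. \<sigma>' n = r)"
  using assms
proof (induction "card (\<sigma> ` (E - \<eta> ` X))" arbitrary: I \<eta> \<sigma> \<alpha> f rule: less_induct)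
  case less
  show ?case
  proof (cases "\<forall>n\<in>E - \<eta> ` X. \<sigma> n = \<sigma> f")
    case True
    moreover have "\<sigma> f \<in> X" using layout_non[OF less.prems(1)] less.prems(5) by (simp add: floats_def)
    ultimately show ?thesis using less.prems by blast
  next
    case False
    then obtain n where "n \<in> E - \<eta> ` X" "\<sigma> n \<noteq> \<sigma> f" by blast
    from merge_step[OF less.prems this]
    obtain J \<eta>' \<sigma>' \<alpha>' f' where *: "cmove\<^sup>*\<^sup>* I J" "layout J \<eta>' \<sigma>' \<alpha>'" "rooted \<eta>' \<sigma>'" "floats \<eta>' f'"
     "\<sigma>' ` (E - \<eta>' ` X) \<subset> \<sigma> ` (E - \<eta> ` X)"
      by (elim exE conjE) (rule that; assumption)
    have "card (\<sigma>' ` (E - \<eta>' ` X)) < card (\<sigma> ` (E - \<eta> ` X))"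
      using *(5) finE by (intro psubset_card_mono) auto
    from less.hyps[OF this *(2,3) _ _ *(4)]
    obtain I' \<eta>'' \<sigma>'' \<alpha>'' f'' r where **: "cmove\<^sup>*\<^sup>* J I'" "layout I' \<eta>'' \<sigma>'' \<alpha>''" "floats \<eta>'' f''" "r \<in> X"
       "\<forall>n\<in>E - \<eta>'' ` X. \<sigma>'' n = r"
      using config_reach[OF *(1) less.prems(3)] linked_reach[OF *(1) less.prems(3,4)] by blast
    show ?thesis using rtranclp_trans[OF *(1) **(1)] **(2-5) by blast
  qed
qed


section \<open>Placing the endpoints around a single root\<close>

text \<open>
  The connection of \<open>x --- r + b\<close> with the loop at \<open>r\<close> turns \<open>x\<close> into the root and \<open>r\<close> into a
  point attached to it.
\<close>

lemma reroot:
  assumes layout: "layout I \<eta> \<sigma> \<alpha>" and f: "floats \<eta> f" and r: "r \<in> X" "\<And>n. n \<in> E \<Longrightarrow> n \<notin> \<eta> ` X \<Longrightarrow> \<sigma> n = r"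
    and x: "x \<in> X"
  shows "\<exists>I' \<eta>' \<sigma>' \<alpha>'. cmove\<^sup>*\<^sup>* I I' \<and> layout I' \<eta>' \<sigma>' \<alpha>' \<and> floats \<eta>' f \<and> (\<forall>n\<in>E - \<eta>' ` X. \<sigma>' n = x)"
proof (cases "x = r")
  case True
  then show ?thesis using assms by blast
next
  case False
  note [simp] = layout_eta[OF layout] layout_non[OF layout] layout_rv[OF layout] layout_rv_eq[OF layout] r(2)
  define b where "b = \<alpha> (rv (\<eta> x))"
  define w where "w = \<alpha> (rv (\<eta> r))"
  have rX: "r \<in> X" "x \<in> X" "r \<noteq> x" "x \<noteq> r" using r x False by auto
  have F: "b \<in> Full" "w \<in> Full" using rX by (auto simp: b_def w_def)
  have Ie: "I (rv (\<eta> x)) = r \<oplus>\<^sub>a b" "I (rv (\<eta> r)) = r \<oplus>\<^sub>a w"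
    using rX layout_rv(4)[OF layout] by (auto simp: b_def w_def simp del: layout_rv[OF layout])
  have "asupp (0::avec) \<subseteq> S" by (auto simp: mem_asupp)
  then obtain k where "0 + amult k w - b \<in> High 0"
    using lift_high[OF F(2), of 0 b 0] Full_supp[OF F(1)] by blast
  then have w2: "amult k w - b \<in> Full" by auto
  define w2 where "w2 = amult k w - b"
  let ?J = "I(\<eta> x := r, rv (\<eta> x) := x \<oplus>\<^sub>a w2, \<eta> r := x, rv (\<eta> r) := x \<oplus>\<^sub>a w)"
  let ?\<eta> = "\<eta>(r := \<eta> x, x := \<eta> r)" and ?\<sigma> = "\<sigma>(rv (\<eta> x) := x, rv (\<eta> r) := x)"
    and ?\<alpha> = "\<alpha>(rv (\<eta> x) := w2, rv (\<eta> r) := w)"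
  have "cmove I (I(\<eta> x := r, rv (\<eta> x) := I (\<eta> x) \<oplus>\<^sub>a w2, \<eta> r := I (\<eta> x), rv (\<eta> r) := I (\<eta> x) \<oplus>\<^sub>a w))"
    using rX F w2 Ie by (intro cconn_I[where k = k and ?w1.0 = b]) (auto simp: w2_def)
  then have m: "cmove I ?J" using rX by simp
  have im: "?\<eta> ` X = \<eta> ` X"
    using rX by (auto simp: image_iff)
  have stJ: "layout ?J ?\<eta> ?\<sigma> ?\<alpha>"
    unfolding layout_def im
  proof (intro conjI ballI)
    show "\<eta> ` X \<subseteq> E" by auto
    show "inj_on ?\<eta> X" using rX by (auto simp: inj_on_def)
  next
    fix y assume y: "y \<in> X"
    show "rv (?\<eta> y) \<notin> \<eta> ` X" using y rX by simp
    show "?J (?\<eta> y) = y" using y rX by auto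
  next
    fix n assume n: "n \<in> E - \<eta> ` X"
    show "?\<sigma> n \<in> X" "?\<alpha> n \<in> Full" "?J n = ?\<sigma> n \<oplus>\<^sub>a ?\<alpha> n"
      using n rX F w2 layout_non(3)[OF layout, of n] by (auto simp: w2_def)
  qed
  have y: "?\<sigma> (rv (?\<eta> r)) = x" "x \<noteq> r" using rX by auto
  let ?\<tau> = "\<lambda>n. if ?\<sigma> n = r then x else ?\<sigma> n"
  obtain I' \<alpha>' where I': "cmove\<^sup>*\<^sup>* ?J I'" "layout I' ?\<eta> ?\<tau> \<alpha>'"
    using elim_point[OF stJ rX(1) y] by blast
  have "\<forall>n\<in>E - ?\<eta> ` X. ?\<tau> n = x" unfolding im by auto
  moreover have "floats ?\<eta> f" using f unfolding floats_def im .
  ultimately show ?thesis using converse_rtranclp_into_rtranclp[OF m I'(1)] I'(2) by blast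
qed

lemma cswap_I:
  assumes "e \<in> E" "f \<in> E" "f \<noteq> e" "f \<noteq> rv e" "w1 \<in> Ap" "w2 \<in> Ap" "a \<in> Ap"
    "amult k1 w1 - a \<in> Ap" "amult k2 w2 - a \<in> Ap"
    "I (rv e) = I e \<oplus>\<^sub>a w1" "I f = I e \<oplus>\<^sub>a a" "I (rv f) = I e \<oplus>\<^sub>a a \<oplus>\<^sub>a w2"
  shows "cmove I (I(e := I e \<oplus>\<^sub>a a, rv e := I e \<oplus>\<^sub>a a \<oplus>\<^sub>a w1, f := I e, rv f := I e \<oplus>\<^sub>a w2))"
proof -
  have "le (I e) (I e \<oplus>\<^sub>a a)" using assms(7) by auto
  moreover have "le (I e \<oplus>\<^sub>a a) (I e \<oplus>\<^sub>a amult k1 w1)"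
    unfolding le_def using assms(8) by (intro bexI[of _ "amult k1 w1 - a"]) auto
  moreover have "le (I e \<oplus>\<^sub>a a) (I e \<oplus>\<^sub>a amult k2 w2)"
    unfolding le_def using assms(9) by (intro bexI[of _ "amult k2 w2 - a"]) auto
  ultimately show ?thesis unfolding cmove_def cswap_def using assms(1-6,10-12) by blast
qed

text \<open>
  The far end of the loop may lie too low to be slid over any other edge.  A floating
  edge between \<open>r + a\<close> and \<open>r + b\<close>, however, can be stretched to \<open>q --- q + v\<close> with \<open>q = r + a\<close> and
  \<open>v\<close> arbitrarily high, and a swap then puts the vector \<open>v\<close> at the root.
\<close>

lemma raise_loop:
  assumes layout: "layout I \<eta> \<sigma> \<alpha>" and f: "floats \<eta> f" and r: "r \<in> X" "\<And>n. n \<in> E \<Longrightarrow> n \<notin> \<eta> ` X \<Longrightarrow> \<sigma> n = r"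
  shows "\<exists>I' \<eta>' \<sigma>' \<alpha>'. cmove\<^sup>*\<^sup>* I I' \<and> layout I' \<eta>' \<sigma>' \<alpha>' \<and> (\<forall>n\<in>E - \<eta>' ` X. \<sigma>' n = r) \<and> \<alpha>' (rv (\<eta>' r)) \<in> High h"
proof -
  note [simp] = layout_eta[OF layout] layout_non[OF layout] layout_rv[OF layout] layout_rv_eq[OF layout] r
  have fE: "f \<in> E" "f \<notin> \<eta> ` X" "rv f \<in> E" "rv f \<notin> \<eta> ` X" using f by (auto simp: floats_def)
  have fX: "f \<noteq> \<eta> x" "rv f \<noteq> \<eta> x" "f \<noteq> rv (\<eta> x)" "rv f \<noteq> rv (\<eta> x)" if "x \<in> X" for x
    using float_neq[OF f that] that by auto
  note [simp] = fX fX[symmetric] fE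
  define a where "a = \<alpha> f"
  define b where "b = \<alpha> (rv f)"
  define w where "w = \<alpha> (rv (\<eta> r))"
  have F: "a \<in> Full" "b \<in> Full" "w \<in> Full" by (simp_all add: a_def b_def w_def)
  have If: "I f = r \<oplus>\<^sub>a a" "I (rv f) = r \<oplus>\<^sub>a b" "I (rv (\<eta> r)) = r \<oplus>\<^sub>a w"
    by (simp_all add: a_def b_def w_def)
  obtain k where k: "b + amult k w - a \<in> High h"
    using lift_high[OF F(3), of b a h] Full_supp[OF F(1)] Full_supp[OF F(2)] by blast
  define v where "v = b + amult k w - a"
  have vF: "v \<in> Full" "v \<in> High h" using k by (auto simp: v_def)
  have z: "asupp (0::avec) \<subseteq> S" by (auto simp: mem_asupp)
  obtain k1 where "0 + amult k1 w - a \<in> High 0"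
    using lift_high[OF F(3) z, of a 0] Full_supp[OF F(1)] by blast
  then have k1: "amult k1 w - a \<in> Ap" by auto
  obtain k2 where "0 + amult k2 v - a \<in> High 0"
    using lift_high[OF vF(1) z, of a 0] Full_supp[OF F(1)] by blast
  then have k2: "amult k2 v - a \<in> Ap" by auto
  let ?K = "{\<eta> r, rv (\<eta> r)}"
  let ?J = "I(rv f := r \<oplus>\<^sub>a (b + amult k w))"
  have m1: "cmove\<^sup>*\<^sup>* I ?J"
  proof (rule slide_along[of ?K])
    show "(kstep ?K I)\<^sup>*\<^sup>* (I (rv f)) (r \<oplus>\<^sub>a (b + amult k w))"
      using layout_loop[OF layout r(1), of ?K b k] F unfolding If w_def by simp
  qed auto
  let ?J2 = "?J(\<eta> r := r \<oplus>\<^sub>a a, rv (\<eta> r) := r \<oplus>\<^sub>a a \<oplus>\<^sub>a w, f := r, rv f := r \<oplus>\<^sub>a v)"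
  have "cmove ?J (?J(\<eta> r := ?J (\<eta> r) \<oplus>\<^sub>a a, rv (\<eta> r) := ?J (\<eta> r) \<oplus>\<^sub>a a \<oplus>\<^sub>a w, f := ?J (\<eta> r), rv f := ?J (\<eta> r) \<oplus>\<^sub>a v))"
    using k1 k2 F vF by (intro cswap_I) (simp_all add: Full_Ap If, simp_all add: v_def)
  then have m2: "cmove ?J ?J2" by simp
  let ?\<eta> = "\<eta>(r := f)" and ?\<sigma> = "\<sigma>(\<eta> r := r)"
    and ?\<alpha> = "\<alpha>(\<eta> r := a, rv (\<eta> r) := a + w, rv f := v)"
  have im: "?\<eta> ` X = insert f (\<eta> ` X - {\<eta> r})"
    using image_redirect[of \<eta> r f] layout by (auto simp: layout_def)
  have "layout ?J2 ?\<eta> ?\<sigma> ?\<alpha>"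
    unfolding layout_def im
  proof (intro conjI ballI)
    show "insert f (\<eta> ` X - {\<eta> r}) \<subseteq> E" by auto
    show "inj_on ?\<eta> X" by (auto simp: inj_on_def)
  next
    fix x assume x: "x \<in> X"
    show "rv (?\<eta> x) \<notin> insert f (\<eta> ` X - {\<eta> r})" using x by auto
    show "?J2 (?\<eta> x) = x" using x by auto
  next
    fix n assume n: "n \<in> E - insert f (\<eta> ` X - {\<eta> r})"
    consider "n = \<eta> r" | "n = rv (\<eta> r)" | "n = rv f"
      | "n \<in> E" "n \<notin> \<eta> ` X" "n \<noteq> \<eta> r" "n \<noteq> rv (\<eta> r)" "n \<noteq> f" "n \<noteq> rv f" using n by blast
    then have "?\<sigma> n \<in> X \<and> ?\<alpha> n \<in> Full \<and> ?J2 n = ?\<sigma> n \<oplus>\<^sub>a ?\<alpha> n"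
      by cases (use F vF in simp_all)
    then show "?\<sigma> n \<in> X" "?\<alpha> n \<in> Full" "?J2 n = ?\<sigma> n \<oplus>\<^sub>a ?\<alpha> n" by blast+
  qed
  moreover have "\<forall>n\<in>E - ?\<eta> ` X. ?\<sigma> n = r" unfolding im using r(2) by (auto simp del: r)
  moreover have "?\<alpha> (rv (?\<eta> r)) \<in> High h" using vF by simp
  ultimately show ?thesis using rtranclp.rtrancl_into_rtrancl[of cmove, OF m1 m2] by blast
qed

text \<open>
  Once the loop at \<open>r\<close> is high, one turn around it makes every other endpoint high.  The
  edge of \<open>x \<in> T\<close> is lifted further until it can be slid back over the edge of \<open>t x\<close>; as
  \<open>t x\<close> is not in \<open>T\<close>, these edges do not interfere with each other.
\<close>

lemma distribute:
  assumes layout: "layout I \<eta> \<sigma> \<alpha>" and r: "r \<in> X" "\<And>n. n \<in> E \<Longrightarrow> n \<notin> \<eta> ` X \<Longrightarrow> \<sigma> n = r"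
    and w: "\<alpha> (rv (\<eta> r)) \<in> High h" and T: "T \<subseteq> X" "r \<notin> T" "\<And>x. x \<in> T \<Longrightarrow> t x \<in> X - T"
  shows "\<exists>I' \<sigma>' \<alpha>'. cmove\<^sup>*\<^sup>* I I' \<and> layout I' \<eta> \<sigma>' \<alpha>' \<and> (\<forall>n\<in>E - \<eta> ` X. \<alpha>' n \<in> High h) \<and>
    (\<forall>x\<in>T. \<sigma>' (rv (\<eta> x)) = t x) \<and> (\<forall>n\<in>E - \<eta> ` X - rv ` \<eta> ` T. \<sigma>' n = r)"
proof -
  note [simp] = layout_eta[OF layout] layout_non[OF layout] layout_rv[OF layout] layout_rv_eq[OF layout] r
  define w where "w = \<alpha> (rv (\<eta> r))"
  have F: "w \<in> High h" "w \<in> Full" using assms(4) by (simp_all add: w_def)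
  let ?K = "{\<eta> r, rv (\<eta> r)}" and ?B = "E - \<eta> ` X - {rv (\<eta> r)}"
  let ?J = "\<lambda>n. if n \<in> ?B then r \<oplus>\<^sub>a (\<alpha> n + w) else I n"
  let ?\<alpha> = "\<lambda>n. if n \<in> ?B then \<alpha> n + w else \<alpha> n"
  have m1: "cmove\<^sup>*\<^sup>* I ?J"
  proof (rule multi_slide[of ?K])
    fix n assume n: "n \<in> ?B"
    then show "(kstep ?K I)\<^sup>*\<^sup>* (I n) (r \<oplus>\<^sub>a (\<alpha> n + w))"
      using layout_loop[OF layout r(1), of ?K "\<alpha> n" 1] by (simp add: w_def amult_def)
  qed auto
  have stJ: "layout ?J \<eta> \<sigma> ?\<alpha>"
    using layout F by (auto simp: layout_def)
  have hi: "?\<alpha> n \<in> High h" if "n \<in> E" "n \<notin> \<eta> ` X" for n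
    using that F High_add[of "\<alpha> n" w h] assms(4) by auto
  have "\<forall>x\<in>T. \<exists>k. ?\<alpha> (rv (\<eta> x)) + amult k w - ?\<alpha> (rv (\<eta> (t x))) \<in> High h"
  proof
    fix x assume x: "x \<in> T"
    have "?\<alpha> (rv (\<eta> x)) \<in> Full" "?\<alpha> (rv (\<eta> (t x))) \<in> Full"
      using layout_rv(3)[OF stJ, of x] layout_rv(3)[OF stJ, of "t x"] T(1) T(3)[OF x] x by blast+
    from Full_supp[OF this(1)] Full_supp[OF this(2)]
    show "\<exists>k. ?\<alpha> (rv (\<eta> x)) + amult k w - ?\<alpha> (rv (\<eta> (t x))) \<in> High h"
      using lift_high[OF F(2)] by blast
  qed
  then obtain k where "\<forall>x\<in>T. ?\<alpha> (rv (\<eta> x)) + amult (k x) w - ?\<alpha> (rv (\<eta> (t x))) \<in> High h"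
    by metis
  moreover define d where "d x = ?\<alpha> (rv (\<eta> x)) + amult (k x) w - ?\<alpha> (rv (\<eta> (t x)))" for x
  ultimately have d: "d x \<in> High h" if "x \<in> T" for x using that by simp
  have dF: "d x \<in> Full" if "x \<in> T" for x using d[OF that] by auto
  let ?L = "\<eta> ` (X - T) \<union> rv ` \<eta> ` (X - T)" and ?C = "rv ` \<eta> ` T"
  define \<xi> where "\<xi> n = (THE x. x \<in> X \<and> n = rv (\<eta> x))" for n
  have \<xi>: "\<xi> (rv (\<eta> x)) = x" if "x \<in> X" for x
    unfolding \<xi>_def using that by (intro the_equality) auto
  let ?s = "\<lambda>n. t (\<xi> n) \<oplus>\<^sub>a d (\<xi> n)"
  let ?I = "\<lambda>n. if n \<in> ?C then ?s n else ?J n"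
  have m2: "cmove\<^sup>*\<^sup>* ?J ?I"
  proof (rule multi_slide[of ?L])
    fix n assume "n \<in> ?C"
    then obtain x where x: "x \<in> T" "n = rv (\<eta> x)" by auto
    have xX: "x \<in> X" "t x \<in> X" "t x \<notin> T" "x \<noteq> r" using x T by auto
    have [simp]: "\<xi> n = x" using \<xi> x xX by simp
    have "(kstep ?L ?J)\<^sup>*\<^sup>* (?J n) (r \<oplus>\<^sub>a (?\<alpha> n + amult (k x) w))"
    proof -
      have "?J n = r \<oplus>\<^sub>a ?\<alpha> n" "?\<alpha> n \<in> Ap" "?\<alpha> (rv (\<eta> r)) = w"
        using x xX F by (auto simp: w_def)
      then show ?thesis
        using layout_loop[OF stJ r(1), of ?L "?\<alpha> n" "k x"] T by simp
    qed
    also have "?\<alpha> n + amult (k x) w = ?\<alpha> (rv (\<eta> (t x))) + d x"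
      using x by (simp add: d_def)
    also have "kstep ?L ?J (r \<oplus>\<^sub>a (?\<alpha> (rv (\<eta> (t x))) + d x)) (t x \<oplus>\<^sub>a d x)"
      using layout_up[OF stJ xX(2), of ?L "d x"] xX dF[OF x(1)] by auto
    finally show "(kstep ?L ?J)\<^sup>*\<^sup>* (?J n) (?s n)" by simp
  next
    show "?C \<inter> ?L = {}" using T by fastforce
    show "?C \<subseteq> E" using T by auto
  qed auto
  let ?\<sigma>' = "\<lambda>n. if n \<in> ?C then t (\<xi> n) else \<sigma> n" and ?\<alpha>' = "\<lambda>n. if n \<in> ?C then d (\<xi> n) else ?\<alpha> n"
  have C: "?\<sigma>' n \<in> X \<and> ?\<alpha>' n \<in> High h \<and> ?I n = ?\<sigma>' n \<oplus>\<^sub>a ?\<alpha>' n" if n: "n \<in> E - \<eta> ` X" for n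
  proof (cases "n \<in> ?C")
    case True
    then obtain x where x: "x \<in> T" "n = rv (\<eta> x)" by auto
    then have "\<xi> n = x" using \<xi>[of x] T(1) by blast
    then show ?thesis using True d[OF x(1)] T(3)[OF x(1)] by simp
  next
    case False
    then show ?thesis using hi[of n] n layout_non(3)[OF stJ, of n] by auto
  qed
  have "layout ?I \<eta> ?\<sigma>' ?\<alpha>'"
    unfolding layout_def
  proof (intro conjI ballI)
    fix x assume x: "x \<in> X"
    then have "\<eta> x \<notin> ?C" using T by auto
    then show "?I (\<eta> x) = x" using x by simp
  next
    fix n assume "n \<in> E - \<eta> ` X"
    then show "?\<sigma>' n \<in> X" "?\<alpha>' n \<in> Full" "?I n = ?\<sigma>' n \<oplus>\<^sub>a ?\<alpha>' n" using C by blast+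
  qed (use layout in \<open>auto simp: layout_def\<close>)
  moreover have "\<forall>x\<in>T. ?\<sigma>' (rv (\<eta> x)) = t x" using \<xi> T by auto
  moreover have "\<forall>n\<in>E - \<eta> ` X - rv ` \<eta> ` T. ?\<sigma>' n = r" by auto
  ultimately show ?thesis using rtranclp_trans[OF m1 m2] C by blast
qed

lemma rearrange:
  assumes layout: "layout I \<eta> \<sigma> \<alpha>" and c: "config I" and l: "linked I" and f: "floats \<eta> f"
    and x0: "x0 \<in> X" and T: "T \<subseteq> X" "x0 \<notin> T" "t ` T \<subseteq> X - T"
  shows "\<exists>I' \<eta>' \<sigma>' \<alpha>'. cmove\<^sup>*\<^sup>* I I' \<and> layout I' \<eta>' \<sigma>' \<alpha>' \<and> (\<forall>n\<in>E - \<eta>' ` X. \<alpha>' n \<in> High h) \<and>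
    (\<forall>x\<in>T. \<sigma>' (rv (\<eta>' x)) = t x) \<and> (\<forall>n\<in>E - \<eta>' ` X - rv ` \<eta>' ` T. \<sigma>' n = x0)"
proof -
  obtain I1 \<sigma>1 \<alpha>1 where 1: "cmove\<^sup>*\<^sup>* I I1" "layout I1 \<eta> \<sigma>1 \<alpha>1" "rooted \<eta> \<sigma>1"
    using make_rooted[OF layout] by (elim exE conjE) (rule that; assumption)
  obtain I2 \<eta>2 \<sigma>2 \<alpha>2 f2 r where 2: "cmove\<^sup>*\<^sup>* I1 I2" "layout I2 \<eta>2 \<sigma>2 \<alpha>2" "floats \<eta>2 f2" "r \<in> X"
    "\<forall>n\<in>E - \<eta>2 ` X. \<sigma>2 n = r"
    using single_root[OF 1(2,3) conjunct1[OF config_reach[OF 1(1) c]] linked_reach[OF 1(1) c l] f]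
    by (elim exE conjE) (rule that; assumption)
  obtain I3 \<eta>3 \<sigma>3 \<alpha>3 where 3: "cmove\<^sup>*\<^sup>* I2 I3" "layout I3 \<eta>3 \<sigma>3 \<alpha>3" "floats \<eta>3 f2"
    "\<forall>n\<in>E - \<eta>3 ` X. \<sigma>3 n = x0"
    using reroot[OF 2(2-4) _ x0] 2(5) by blast
  obtain I4 \<eta>4 \<sigma>4 \<alpha>4 where 4: "cmove\<^sup>*\<^sup>* I3 I4" "layout I4 \<eta>4 \<sigma>4 \<alpha>4" "\<forall>n\<in>E - \<eta>4 ` X. \<sigma>4 n = x0"
    "\<alpha>4 (rv (\<eta>4 x0)) \<in> High h"
    using raise_loop[OF 3(2,3) x0] 3(4) by blast
  obtain I5 \<sigma>5 \<alpha>5 where 5: "cmove\<^sup>*\<^sup>* I4 I5" "layout I5 \<eta>4 \<sigma>5 \<alpha>5" "\<forall>n\<in>E - \<eta>4 ` X. \<alpha>5 n \<in> High h"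
    "\<forall>x\<in>T. \<sigma>5 (rv (\<eta>4 x)) = t x" "\<forall>n\<in>E - \<eta>4 ` X - rv ` \<eta>4 ` T. \<sigma>5 n = x0"
    using distribute[OF 4(2) x0 _ 4(4) T(1,2), of t] image_subset_iff[THEN iffD1, OF T(3)] 4(3) by blast
  show ?thesis
    by (intro exI conjI)
      (rule rtranclp_trans[OF 1(1) rtranclp_trans[OF 2(1) rtranclp_trans[OF 3(1) rtranclp_trans[OF 4(1) 5(1)]]]] 5(2-5))+
qed

end

section \<open>Realising endpoint functions by GBS graphs\<close>

context gbs_frame
begin

text \<open>
  The integer label with exponent vector \<open>a\<close>, the inverse of \<open>label_vec\<close>.
\<close>

definition avalue :: "avec \<Rightarrow> int" where
  "avalue a = (if fst a = 0 then 1 else - 1) * (\<Prod>r\<in>P. int r ^ nat (co a r))"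

definition realizes :: "('v, 'e) gbs \<Rightarrow> ('e \<Rightarrow> 'v apoint) \<Rightarrow> bool" where
  "realizes G I \<longleftrightarrow> gbs_graph G \<and> gverts G = V \<and> gedges G = E \<and> (\<forall>e\<in>E. grev G e = rv e) \<and>
     gprimes G = P \<and> (\<forall>e\<in>E. aini G e = I e)"

definition mk_gbs :: "('e \<Rightarrow> 'v apoint) \<Rightarrow> ('v, 'e) gbs" where
  "mk_gbs I = \<lparr>gverts = V, gedges = E, grev = rv, gini = \<lambda>e. fst (I e),
     glab = \<lambda>e. avalue (snd (I (rv e)))\<rparr>"

lemma avalue_nonzero: "avalue a \<noteq> 0"
proof -
  have "0 \<notin> P" using P(2)[of 0] by auto
  then show ?thesis using P(1) by (auto simp: avalue_def)
qed

lemma prime_dvd_avalue: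
  assumes r: "prime r" and a: "a \<in> Ap"
  shows "int r dvd avalue a \<longleftrightarrow> r \<in> asupp a"
proof -
  have pr: "prime (int r)" using r by simp
  have "int r dvd avalue a \<longleftrightarrow> int r dvd (\<Prod>r\<in>P. int r ^ nat (co a r))"
    by (simp add: avalue_def)
  also have "\<dots> \<longleftrightarrow> (\<exists>s\<in>P. int r dvd int s ^ nat (co a s))"
    using P(1) pr by (simp add: prime_dvd_prod_iff)
  also have "\<dots> \<longleftrightarrow> (\<exists>s\<in>P. r = s \<and> co a s > 0)"
  proof (intro bex_cong HOL.refl)
    fix s assume s: "s \<in> P"
    show "int r dvd int s ^ nat (co a s) \<longleftrightarrow> r = s \<and> co a s > 0"
    proof (cases "co a s > 0")
      case True
      then have "int r dvd int s ^ nat (co a s) \<longleftrightarrow> int r dvd int s"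
        using pr by (intro prime_dvd_power_iff) auto
      also have "\<dots> \<longleftrightarrow> r = s" using primes_dvd_imp_eq[OF r P(2)[OF s]] by auto
      finally show ?thesis using True by simp
    next
      case False
      then show ?thesis using prime_gt_1_nat[OF r] by simp
    qed
  qed
  also have "\<dots> \<longleftrightarrow> r \<in> asupp a"
    using a by (auto simp: Ap_def mem_asupp subset_iff order_less_le)
  finally show ?thesis .
qed

lemma aplus_Ap: "gprimes G = P \<Longrightarrow> aplus G = Ap"
  by (auto simp: aplus_def Ap_def co_def)

lemma label_avalue:
  assumes G: "gbs_graph G" "gprimes G = P" and e: "e \<in> gedges G" "glab G e = avalue a" and a: "a \<in> Ap"
  shows "label_vec G (glab G e) = a"
  unfolding label_vec_def
  by (rule the1_equality[OF label_vec_ex1[OF G(1) e(1)]])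
    (use a e(2) in \<open>simp add: aplus_Ap[OF G(2)] G(2) avalue_def co_def\<close>)

lemma gbs_label:
  assumes G: "gbs_graph G" "gprimes G = P" and e: "e \<in> gedges G"
  shows "label_vec G (glab G e) \<in> Ap" "avalue (label_vec G (glab G e)) = glab G e"
  using theI'[OF label_vec_ex1[OF G(1) e], folded label_vec_def]
  by (simp_all add: aplus_Ap[OF G(2)] G(2) avalue_def co_def)

lemma mk_gbs_realizes:
  assumes c: "config I"
  shows "realizes (mk_gbs I) I"
proof -
  let ?G = "mk_gbs I"
  have sel: "gverts ?G = V" "gedges ?G = E" "grev ?G = rv" "gini ?G = (\<lambda>e. fst (I e))"
    "glab ?G = (\<lambda>e. avalue (snd (I (rv e))))" "gter ?G = (\<lambda>e. fst (I (rv e)))"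
    by (simp_all add: mk_gbs_def gter_def fun_eq_iff)
  have pts: "fst (I e) \<in> V" "snd (I e) \<in> Ap" if "e \<in> E" for e
    using config_pts[OF c that] by (auto simp: pts_def)
  have g: "gbs_graph ?G"
    unfolding gbs_graph_def sel using V finE pts c avalue_nonzero
    by (simp add: config_def adj_def)
  have gp: "gprimes ?G = P"
  proof -
    have "gprimes ?G = {r. prime r \<and> (\<exists>e\<in>E. r \<in> asupp (snd (I (rv e))))}"
      unfolding gprimes_def sel using pts prime_dvd_avalue by (meson rv_simps(1))
    also have "\<dots> = {r. prime r \<and> (\<exists>e\<in>E. r \<in> asupp (snd (I e)))}"
      by (metis rv_simps(1,2))
    also have "\<dots> = P"
      using c P(2) unfolding config_def by blast
    finally show ?thesis .
  qed
  have "aini ?G e = I e" if e: "e \<in> E" for e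
  proof -
    have "label_vec ?G (glab ?G (rv e)) = snd (I e)"
      using e pts by (intro label_avalue[OF g gp]) (simp_all add: sel)
    then show ?thesis using e by (simp add: aini_def ater_def sel prod_eq_iff)
  qed
  then show ?thesis using g gp by (simp add: realizes_def sel)
qed

lemma rv_eq_iff: "e \<in> E \<Longrightarrow> f \<in> E \<Longrightarrow> rv e = rv f \<longleftrightarrow> e = f"
  by (metis rv_simps(2))

context
  fixes G I assumes re: "realizes G I"
begin

lemma re_simps: "gverts G = V" "gedges G = E" "e \<in> E \<Longrightarrow> grev G e = rv e" "gprimes G = P"
  "e \<in> E \<Longrightarrow> aini G e = I e" "aplus G = Ap" "apoints G = pts" "gbs_graph G"
  using re aplus_Ap[of G] by (auto simp: realizes_def apoints_def pts_def)

lemma re_ale: "ale G p q \<longleftrightarrow> le p q"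
  by (simp add: ale_def le_def re_simps)

lemma re_ater:
  assumes e: "e \<in> E" shows "ater G e = I (rv e)"
proof -
  have "aini G (rv e) = ater G (grev G (rv e))" by (simp add: aini_def)
  then show ?thesis using e by (simp add: re_simps)
qed

end

text \<open>
  In a slide, the end of \<open>f\<close> that moves is the initial one here and the terminal one in
  \<open>slide\<close>; so \<open>rv f\<close> takes the role of the moving edge.
\<close>

lemma realize_move:
  assumes G: "realizes G I" and G': "realizes G' I'" and m: "cmove I I'"
  shows "move G G'"
proof -
  note r = re_simps[OF G] re_ater[OF G] re_simps[OF G'] re_ater[OF G']
  have off: "unchanged_off B G G'" if "\<And>e. e \<in> E - B \<Longrightarrow> I' e = I e \<and> I' (rv e) = I (rv e)" for B
    using that unfolding unchanged_off_def by (simp add: r)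
  consider "cslide I I'" | "cswap I I'" | "cconn I I'" using m by (auto simp: cmove_def)
  then show ?thesis
  proof cases
    case 1
    then obtain e f a where h: "e \<in> E" "f \<in> E" "f \<noteq> e" "f \<noteq> rv e" "a \<in> Ap"
       "I f = I e \<oplus>\<^sub>a a" "I' = I(f := I (rv e) \<oplus>\<^sub>a a)"
      unfolding cslide_def by blast
    note d = rv_distinct[OF h(1-4)]
    have "unchanged_off {rv f, grev G (rv f)} G G'"
      by (rule off) (use h d in \<open>auto simp: r rv_eq_iff\<close>)
    then have "slide G G'"
      unfolding slide_def edge_joins_def using h(1-6) d
      by (intro exI[of _ e] exI[of _ "rv f"] exI[of _ "I e"] exI[of _ "I (rv e)"] exI[of _ "I (rv f)"] exI[of _ a])
        (simp add: r h(7))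
    then show ?thesis by (simp add: move_def)
  next
    case 2
    then obtain e f p q w1 w2 k1 k2 where h: "e \<in> E" "f \<in> E" "f \<noteq> e" "f \<noteq> rv e"
       "w1 \<in> Ap" "w2 \<in> Ap" "le p q" "le q (p \<oplus>\<^sub>a amult k1 w1)" "le q (p \<oplus>\<^sub>a amult k2 w2)"
       "I e = p" "I (rv e) = p \<oplus>\<^sub>a w1" "I f = q" "I (rv f) = q \<oplus>\<^sub>a w2"
       "I' = I(e := q, rv e := q \<oplus>\<^sub>a w1, f := p, rv f := p \<oplus>\<^sub>a w2)"
      unfolding cswap_def by blast
    note d = rv_distinct[OF h(1-4)]
    have "unchanged_off {e, grev G e, f, grev G f} G G'"
      by (rule off) (use h(1,2) d in \<open>auto simp: r rv_eq_iff h(14)\<close>)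
    then have "swap G G'"
      unfolding swap_def edge_joins_def using h(1-13) d
      by (intro exI[of _ e] exI[of _ f] exI[of _ p] exI[of _ q] exI[of _ w1] exI[of _ w2] exI[of _ k1] exI[of _ k2])
        (simp add: r h(14) re_ale[OF G])
    then show ?thesis by (simp add: move_def)
  next
    case 3
    then obtain e f p q w w1 w2 k where h: "e \<in> E" "f \<in> E" "f \<noteq> e" "f \<noteq> rv e"
       "w \<in> Ap" "w1 \<in> Ap" "w2 \<in> Ap" "w1 + w2 = amult k w"
       "I e = q" "I (rv e) = p \<oplus>\<^sub>a w1" "I f = p" "I (rv f) = p \<oplus>\<^sub>a w"
       "I' = I(e := p, rv e := q \<oplus>\<^sub>a w2, f := q, rv f := q \<oplus>\<^sub>a w)"
      unfolding cconn_def by blast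
    note d = rv_distinct[OF h(1-4)]
    have "unchanged_off {e, grev G e, f, grev G f} G G'"
      by (rule off) (use h(1,2) d in \<open>auto simp: r rv_eq_iff h(13)\<close>)
    then have "connection G G'"
      unfolding connection_def edge_joins_def using h(1-12) d
      by (intro exI[of _ e] exI[of _ f] exI[of _ p] exI[of _ q] exI[of _ w] exI[of _ w1] exI[of _ w2] exI[of _ k])
        (simp add: r h(13))
    then show ?thesis by (simp add: move_def)
  qed
qed

lemma realize_reach:
  assumes G: "realizes G I" and c: "config I" and m: "cmove\<^sup>*\<^sup>* I I'"
  shows "\<exists>G'. move\<^sup>*\<^sup>* G G' \<and> realizes G' I'"
  using m
proof (induction rule: rtranclp_induct)
  case base
  then show ?case using G by blast
next
  case (step J K)
  then obtain H where H: "move\<^sup>*\<^sup>* G H" "realizes H J" by blast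
  have "config J" using config_reach[OF step(1) c] ..
  then have K: "realizes (mk_gbs K) K" using mk_gbs_realizes[OF config_move[OF _ step(2)]] by blast
  then have "move H (mk_gbs K)" using realize_move[OF H(2) K step(2)] by blast
  then show ?case using H(1) K rtranclp.rtrancl_into_rtrancl by metis
qed

lemma aconj_step:
  assumes G: "realizes G I" and c: "config I" and p: "aconj G p q" "cstep I q r"
  shows "aconj G p r"
proof -
  note R = re_simps[OF G] re_ater[OF G]
  obtain es where es: "affine_path G p es q" using p(1) by (auto simp: aconj_def)
  obtain e u where e: "e \<in> E" "u \<in> Ap" "q = I e \<oplus>\<^sub>a u" "r = I (rv e) \<oplus>\<^sub>a u"
    using p(2) by (auto simp: cstep_def)
  have r: "r \<in> pts" using e config_pts[OF c, of "rv e"] by auto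
  show ?thesis
  proof (cases "es = []")
    case True
    have "affine_path G p [e] r"
      unfolding affine_path_def using es True e r
      by (auto simp: affine_path_def R intro!: exI[of _ "\<lambda>_. u"])
    then show ?thesis by (auto simp: aconj_def)
  next
    case False
    then obtain w where w: "\<forall>i<length es. w i \<in> Ap" "aini G (hd es) \<oplus>\<^sub>a w 0 = p"
        "ater G (last es) \<oplus>\<^sub>a w (length es - 1) = q"
        "\<forall>i. Suc i < length es \<longrightarrow>
           ater G (es ! i) \<oplus>\<^sub>a w i = aini G (es ! Suc i) \<oplus>\<^sub>a w (Suc i)"
      and pe: "p \<in> pts" "set es \<subseteq> E"
      using es by (auto simp: affine_path_def R)
    let ?w = "w(length es := u)"
    have "affine_path G p (es @ [e]) r"
      unfolding affine_path_def
    proof (intro conjI)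
      show "if es @ [e] = [] then p = r else \<exists>w. (\<forall>i<length (es @ [e]). w i \<in> aplus G) \<and>
        aini G (hd (es @ [e])) \<oplus>\<^sub>a w 0 = p \<and>
        ater G (last (es @ [e])) \<oplus>\<^sub>a w (length (es @ [e]) - 1) = r \<and>
        (\<forall>i. Suc i < length (es @ [e]) \<longrightarrow>
           ater G ((es @ [e]) ! i) \<oplus>\<^sub>a w i = aini G ((es @ [e]) ! Suc i) \<oplus>\<^sub>a w (Suc i))"
      proof -
        have "ater G ((es @ [e]) ! i) \<oplus>\<^sub>a ?w i = aini G ((es @ [e]) ! Suc i) \<oplus>\<^sub>a ?w (Suc i)"
          if i: "Suc i < length (es @ [e])" for i
        proof (cases "Suc i < length es")
          case True
          then show ?thesis using w(4) by (simp add: nth_append)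
        next
          case F2: False
          then have i: "length es - 1 = i" "Suc i = length es" "i \<noteq> length es" "i < length es"
            using i False by auto
          then have "(es @ [e]) ! i = last es" "?w i = w i" "(es @ [e]) ! Suc i = e" "?w (Suc i) = u"
            using False by (simp_all add: nth_append last_conv_nth del: One_nat_def)
          then show ?thesis using w(3) e R(5)[OF e(1)] i(1) by simp
        qed
        then have "(\<forall>i<length (es @ [e]). ?w i \<in> aplus G) \<and>
          aini G (hd (es @ [e])) \<oplus>\<^sub>a ?w 0 = p \<and>
          ater G (last (es @ [e])) \<oplus>\<^sub>a ?w (length (es @ [e]) - 1) = r \<and>
          (\<forall>i. Suc i < length (es @ [e]) \<longrightarrow>
           ater G ((es @ [e]) ! i) \<oplus>\<^sub>a ?w i = aini G ((es @ [e]) ! Suc i) \<oplus>\<^sub>a ?w (Suc i))"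
          using False w(1,2) e by (auto simp: R less_Suc_eq)
        then show ?thesis by auto
      qed
    qed (use pe e r in \<open>auto simp: R\<close>)
    then show ?thesis by (auto simp: aconj_def)
  qed
qed

lemma cstep_shift: "u \<in> Ap \<Longrightarrow> cstep I p q \<Longrightarrow> cstep I (p \<oplus>\<^sub>a u) (q \<oplus>\<^sub>a u)"
  unfolding cstep_def by fastforce

lemma csteps_shift:
  assumes "u \<in> Ap" "(cstep I)\<^sup>*\<^sup>* p q" shows "(cstep I)\<^sup>*\<^sup>* (p \<oplus>\<^sub>a u) (q \<oplus>\<^sub>a u)"
  using assms(2)
proof (induction rule: rtranclp_induct)
  case (step q r)
  then show ?case using cstep_shift[OF assms(1) step(2)] by (metis rtranclp.rtrancl_into_rtrancl)
qed simp

lemma csteps_aconj: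
  assumes G: "realizes G I" and c: "config I" and p: "p \<in> pts" "(cstep I)\<^sup>*\<^sup>* p q"
  shows "aconj G p q"
  using p(2)
proof (induction rule: rtranclp_induct)
  case base
  have "affine_path G p [] p" using p(1) by (simp add: affine_path_def re_simps[OF G])
  then show ?case by (auto simp: aconj_def)
next
  case (step q r)
  then show ?case using aconj_step[OF G c] by blast
qed

lemma aconj_qle:
  assumes G: "realizes G I" and c: "config I" and p: "aconj G p q"
  shows "qle I p q"
proof -
  note R = re_simps[OF G] re_ater[OF G]
  obtain es where es: "affine_path G p es q" using p(1) by (auto simp: aconj_def)
  show ?thesis
  proof (cases "es = []")
    case True
    then show ?thesis using es by (simp add: affine_path_def)
  next
    case False
    then obtain w where w: "\<forall>i<length es. w i \<in> Ap" "aini G (hd es) \<oplus>\<^sub>a w 0 = p"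
        "ater G (last es) \<oplus>\<^sub>a w (length es - 1) = q"
        "\<forall>i. Suc i < length es \<longrightarrow>
           ater G (es ! i) \<oplus>\<^sub>a w i = aini G (es ! Suc i) \<oplus>\<^sub>a w (Suc i)"
      and pe: "p \<in> pts" "set es \<subseteq> E"
      using es by (auto simp: affine_path_def R)
    have edge: "qle I (aini G (es ! i) \<oplus>\<^sub>a w i) (ater G (es ! i) \<oplus>\<^sub>a w i)" if "i < length es" for i
      using that pe w(1) qle_shift[OF qle_edge[OF c]] by (simp add: R subset_iff)
    have "qle I p (ater G (es ! i) \<oplus>\<^sub>a w i)" if "i < length es" for i
      using that
    proof (induction i)
      case 0
      then show ?case using edge[of 0] w(2) False by (simp add: hd_conv_nth)
    next
      case (Suc i)
      then have "qle I p (aini G (es ! Suc i) \<oplus>\<^sub>a w (Suc i))" using w(4) by (metis Suc_lessD)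
      then show ?case using edge[OF Suc.prems] by (blast intro: qle_trans)
    qed
    from this[of "length es - 1"] show ?thesis using w(3) False by (simp add: last_conv_nth)
  qed
qed

text \<open>
  Inequalities can be moved to the front of a chain of steps, because conjugacy is invariant
  under translation.
\<close>

lemma conj_le_qle:
  assumes G: "realizes G I" and c: "config I" and p: "p \<in> pts"
  shows "conj_le G p q \<longleftrightarrow> qle I p q"
proof
  assume "conj_le G p q"
  then obtain q' where "aconj G q' q" "le p q'" by (auto simp: conj_le_def re_ale[OF G])
  then show "qle I p q" using qle_le[OF p] aconj_qle[OF G c] by (blast intro: qle_trans)
next
  assume "qle I p q"
  then have "\<exists>q'. le p q' \<and> (cstep I)\<^sup>*\<^sup>* q' q"
    unfolding qle_def
  proof (induction rule: rtranclp_induct)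
    case base
    have "le p p" using le_shift[of 0 p] by simp
    then show ?case by blast
  next
    case (step q r)
    then obtain q' where q': "le p q'" "(cstep I)\<^sup>*\<^sup>* q' q" by blast
    show ?case
    proof (cases "le q r")
      case True
      then obtain w where w: "w \<in> Ap" "r = q \<oplus>\<^sub>a w" by (auto simp: le_def)
      obtain v where v: "v \<in> Ap" "q' = p \<oplus>\<^sub>a v" using q'(1) by (auto simp: le_def)
      have "le p (q' \<oplus>\<^sub>a w)" using v w by auto
      then show ?thesis using csteps_shift[OF w(1) q'(2)] w(2) by blast
    next
      case False
      then show ?thesis using step(2) q' by (metis rtranclp.rtrancl_into_rtrancl)
    qed
  qed
  then show "conj_le G p q"
    unfolding conj_le_def re_ale[OF G] using csteps_aconj[OF G c] le_pts[OF p] by blast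
qed

lemma re_qconj:
  assumes "realizes G I" "config I" "p \<in> pts" "q \<in> pts"
  shows "qconj G p q \<longleftrightarrow> qle I p q \<and> qle I q p"
  using assms conj_le_qle by (simp add: qconj_def)

end

lemma gbs_frame_gbs:
  assumes "gbs_graph G"
  shows "gbs_frame (gverts G) (gedges G) (grev G) (gprimes G)"
  using assms gprimes_finite[OF assms] by unfold_locales (auto simp: gbs_graph_def gprimes_def)

lemma gbs_realizes:
  assumes G: "gbs_graph G"
  shows "gbs_frame.config (gverts G) (gedges G) (grev G) (gprimes G) (aini G)"
    "gbs_frame.realizes (gverts G) (gedges G) (grev G) (gprimes G) G (aini G)"
proof -
  interpret gbs_frame "gverts G" "gedges G" "grev G" "gprimes G" by (rule gbs_frame_gbs[OF G])
  have fin: "fst (aini G e) = gini G e" if "e \<in> gedges G" for e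
    using that by (simp add: aini_def ater_def gter_def)
  have si: "snd (aini G e) = label_vec G (glab G (grev G e))" for e
    by (simp add: aini_def ater_def)
  have p: "snd (aini G e) \<in> Ap" "avalue (snd (aini G e)) = glab G (grev G e)" if "e \<in> gedges G" for e
    using gbs_label[OF G HOL.refl] that by (auto simp: si)
  have pr: "(\<Union>e\<in>gedges G. asupp (snd (aini G e))) = gprimes G"
  proof (intro equalityI subsetI)
    fix r assume "r \<in> gprimes G"
    then obtain e where e: "prime r" "e \<in> gedges G" "int r dvd glab G e" by (auto simp: gprimes_def)
    then have "r \<in> asupp (snd (aini G (grev G e)))"
      using prime_dvd_avalue[OF e(1) p(1)[of "grev G e"]] p(2)[of "grev G e"] by simp
    then show "r \<in> (\<Union>e\<in>gedges G. asupp (snd (aini G e)))" using e rv_simps(1) by blast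
  qed (use p(1) in \<open>auto simp: Ap_def\<close>)
  have a: "adj (aini G) = {(gini G e, gter G e) |e. e \<in> gedges G}"
    unfolding adj_def gter_def by (intro Collect_cong ex_cong1) (auto simp: fin)
  show "config (aini G)"
    unfolding config_def using pr p(1) G fin unfolding a pts_def
    by (auto simp: gbs_graph_def mem_Times_iff)
  show "realizes G (aini G)"
    using G by (simp add: realizes_def)
qed

section \<open>The structure of a quasi-conjugacy class\<close>

context gbs_frame
begin

text \<open>
  The reason why the support of a class does not depend on a base point.
\<close>

lemma qle_gap_transport:
  assumes "qle I p p'" "qle I p' p" "qle I (p \<oplus>\<^sub>a u) p" "u \<in> Ap"
  shows "qle I (p' \<oplus>\<^sub>a u) p'"
  using qle_shift[OF assms(2,4)] assms(1,3) by (blast intro: qle_trans)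

lemma qle_amult:
  assumes "qle I (p \<oplus>\<^sub>a u) p" "u \<in> Ap"
  shows "qle I (p \<oplus>\<^sub>a amult k u) p"
proof (induction k)
  case (Suc k)
  from qle_shift[OF this assms(2)] assms(1) show ?case by (simp add: amult_Suc) (blast intro: qle_trans)
qed simp

lemma amult_dominates:
  assumes "w \<in> Ap" "u \<in> Ap" "asupp w \<subseteq> asupp u"
  shows "\<exists>k. amult k u - w \<in> Ap"
proof -
  define k where "k = nat (\<Sum>r\<in>P. co w r)"
  have nn: "co w r \<ge> 0" "co u r \<ge> 0" for r using assms by (auto simp: Ap_def)
  have "co w r \<le> int k * co u r" for r
  proof (cases "r \<in> asupp u")
    case True
    then have "r \<in> P" "co u r \<noteq> 0" using assms(2) by (auto simp: Ap_def mem_asupp)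
    then have r: "r \<in> P" "co u r \<ge> 1" using nn(2)[of r] by linarith+
    have "co w r \<le> int k"
      unfolding k_def using member_le_sum[of r P "co w"] r P nn by (simp add: sum_nonneg)
    also have "\<dots> \<le> int k * co u r" using r by (simp add: mult_le_cancel_left1)
    finally show ?thesis .
  next
    case False
    then have "co w r = 0" using assms(3) by (auto simp: mem_asupp)
    then show ?thesis using nn by simp
  qed
  moreover have "asupp (amult k u - w) \<subseteq> P"
  proof
    fix r assume "r \<in> asupp (amult k u - w)"
    then have "r \<in> asupp u \<or> r \<in> asupp w" by (auto simp: mem_asupp)
    then show "r \<in> P" using assms by (auto simp: Ap_def)
  qed
  ultimately show ?thesis by (auto simp: Ap_def)
qed

lemma affine_le_trans:
  assumes "le p q" "le q r" shows "le p r"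
proof -
  obtain u v where "u \<in> Ap" "v \<in> Ap" "q = p \<oplus>\<^sub>a u" "r = q \<oplus>\<^sub>a v" using assms unfolding le_def by blast
  then have "u + v \<in> Ap" "r = p \<oplus>\<^sub>a (u + v)" by auto
  then show ?thesis unfolding le_def by blast
qed

end

lemma asupp_aeps [simp]: "asupp aeps = {}" "asupp (a + aeps) = asupp a"
  by (auto simp: mem_asupp set_eq_iff)

lemma at_point_sym: "at_point p m \<Longrightarrow> at_point m p"
  by (auto simp: at_point_def)

lemma at_point_trans: "at_point p m \<Longrightarrow> at_point m n \<Longrightarrow> at_point p n"
  by (auto simp: at_point_def)

text \<open>
  Here \<open>I0\<close> is the given endpoint function.  Each minimal point and its translate by \<open>aeps\<close>
  are represented in \<open>X\<close> by the one of the two that actually is an endpoint.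
\<close>

locale clean_gbs =
  fixes G :: "('v, 'e) gbs" and Q :: "'v apoint set"
  assumes G: "gbs_graph G" and one: "one_qc_class G Q" and S0: "supp_qc G Q \<noteq> {}"
    and cl: "clean G Q" and fp: "floating_pieces G Q" and gaps: "full_support_gaps G Q"
begin

abbreviation "EE \<equiv> gedges G"
abbreviation "S \<equiv> supp_qc G Q"
abbreviation "M \<equiv> min_qc G Q"
abbreviation "I0 \<equiv> aini G"

definition "X = {I0 e |e. e \<in> EE \<and> I0 e \<in> M}"

sublocale gbs_frame "gverts G" "gedges G" "grev G" "gprimes G"
  by (rule gbs_frame_gbs[OF G])

lemma config_init: "config I0" and realizes_init: "realizes G I0"
  using gbs_realizes[OF G] .

lemmas init_simps = re_simps(6,7)[OF realizes_init] re_ater[OF realizes_init] re_ale[OF realizes_init]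

lemma qc_pts: "p \<in> Q \<Longrightarrow> p \<in> pts"
  using one by (auto simp: one_qc_class_def qc_class_def init_simps)

lemma qc_qle: "p \<in> Q \<Longrightarrow> q \<in> Q \<Longrightarrow> qle I0 p q"
  using one by (auto simp: one_qc_class_def qc_class_def init_simps re_qconj[OF realizes_init config_init] intro: qle_trans)

lemma qc_closed: "p \<in> Q \<Longrightarrow> q \<in> pts \<Longrightarrow> qle I0 p q \<Longrightarrow> qle I0 q p \<Longrightarrow> q \<in> Q"
  using one by (auto simp: one_qc_class_def qc_class_def init_simps re_qconj[OF realizes_init config_init] intro: qle_trans)

lemma mem_supp_qc: "r \<in> S \<longleftrightarrow> (\<exists>p u. p \<in> Q \<and> u \<in> Ap \<and> qle I0 (p \<oplus>\<^sub>a u) p \<and> r \<in> asupp u)"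
proof -
  have "qconj G (p \<oplus>\<^sub>a u) p \<longleftrightarrow> qle I0 (p \<oplus>\<^sub>a u) p" if "p \<in> Q" "u \<in> Ap" for p u
    using that qc_pts[of p] by (auto simp: re_qconj[OF realizes_init config_init] intro: qle_le)
  then show ?thesis unfolding supp_qc_def init_simps by blast
qed

lemma supp_qc_primes: "S \<subseteq> gprimes G"
  by (auto simp: mem_supp_qc Ap_def)

lemma qc_gap: "p \<in> Q \<Longrightarrow> u \<in> Ap \<Longrightarrow> p \<oplus>\<^sub>a u \<in> Q \<Longrightarrow> asupp u \<subseteq> S"
  using qc_qle unfolding subset_iff mem_supp_qc by blast

text \<open>
  For each \<open>r \<in> S\<close> there is a gap at \<open>p\<close> that involves \<open>r\<close>.  Adding these up gives one gap \<open>u\<close>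
  of support \<open>S\<close>, and \<open>p + w\<close> is squeezed between \<open>p\<close> and a point \<open>p + k * u\<close>, which belongs to \<open>Q\<close>.
\<close>

lemma qc_up:
  assumes p: "p \<in> Q" and w: "w \<in> Ap" "asupp w \<subseteq> S"
  shows "p \<oplus>\<^sub>a w \<in> Q"
proof -
  have "\<exists>u\<in>Ap. T \<subseteq> asupp u \<and> qle I0 (p \<oplus>\<^sub>a u) p" if "finite T" "T \<subseteq> S" for T
    using that
  proof (induction T)
    case empty
    show ?case by (intro bexI[of _ 0]) auto
  next
    case (insert r T)
    then obtain u where u: "u \<in> Ap" "T \<subseteq> asupp u" "qle I0 (p \<oplus>\<^sub>a u) p" by auto
    obtain p' v where v: "p' \<in> Q" "v \<in> Ap" "qle I0 (p' \<oplus>\<^sub>a v) p'" "r \<in> asupp v"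
      using insert.prems mem_supp_qc by blast
    have "qle I0 (p \<oplus>\<^sub>a v) p"
      using qle_gap_transport[OF qc_qle[OF v(1) p] qc_qle[OF p v(1)] v(3,2)] .
    from qle_shift[OF this u(1)] u(3) have "qle I0 (p \<oplus>\<^sub>a (v + u)) p" by (simp) (blast intro: qle_trans)
    then show ?case using u v by (intro bexI[of _ "v + u"]) (auto simp: asupp_add)
  qed
  moreover have "finite S" using supp_qc_primes P(1) finite_subset by blast
  ultimately obtain u where u: "u \<in> Ap" "S \<subseteq> asupp u" "qle I0 (p \<oplus>\<^sub>a u) p" by blast
  obtain k where k: "amult k u - w \<in> Ap" using amult_dominates[OF w(1) u(1)] w u by blast
  have pt: "p \<in> pts" using qc_pts[OF p] .
  have "le (p \<oplus>\<^sub>a w) (p \<oplus>\<^sub>a amult k u)"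
    unfolding le_def using k by (intro bexI[of _ "amult k u - w"]) auto
  then have "qle I0 (p \<oplus>\<^sub>a w) p"
    using qle_le[of "p \<oplus>\<^sub>a w"] pt w qle_amult[OF u(3,1), of k] by (blast intro: qle_trans)
  moreover have "qle I0 p (p \<oplus>\<^sub>a w)" using pt w by (intro qle_le) auto
  ultimately show ?thesis using qc_closed[OF p] pt w by blast
qed

lemma min_iff: "m \<in> M \<longleftrightarrow> m \<in> Q \<and> (\<forall>q\<in>Q. le q m \<longrightarrow> le m q)"
  by (auto simp: min_qc_def init_simps)

lemma min_eps:
  assumes m: "m \<in> M" shows "m \<oplus>\<^sub>a aeps \<in> M"
proof -
  have e: "le m (m \<oplus>\<^sub>a aeps)" "le (m \<oplus>\<^sub>a aeps) m"
    by auto (auto simp: le_def intro!: bexI[of _ aeps])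
  have "m \<oplus>\<^sub>a aeps \<in> Q" using qc_up[of m aeps] m by (auto simp: min_iff)
  then show ?thesis using m e affine_le_trans unfolding min_iff by blast
qed

lemma min_at: "m \<in> M \<Longrightarrow> at_point p m \<Longrightarrow> p \<in> M"
  using min_eps[of m] unfolding at_point_def by metis

lemma X_min: "x \<in> X \<Longrightarrow> x \<in> M"
  by (auto simp: X_def)

lemma X_unique: "x \<in> X \<Longrightarrow> y \<in> X \<Longrightarrow> at_point x y \<Longrightarrow> x = y"
proof -
  assume a: "x \<in> X" "y \<in> X" "at_point x y"
  obtain e f where e: "e \<in> EE" "x = I0 e" "f \<in> EE" "y = I0 f" using a by (auto simp: X_def)
  have "\<exists>!e. e \<in> EE \<and> at_point (I0 e) y" using cl X_min[OF a(2)] by (simp add: clean_def)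
  moreover have "at_point (I0 e) y" "at_point (I0 f) y" using a e by (auto simp: at_point_def)
  ultimately show "x = y" using e by metis
qed

lemma X_rep: "m \<in> M \<Longrightarrow> \<exists>x\<in>X. at_point x m"
proof -
  assume m: "m \<in> M"
  then obtain e where e: "e \<in> EE" "at_point (I0 e) m" using cl by (auto simp: clean_def)
  then show ?thesis using min_at[OF m e(2)] by (intro bexI[of _ "I0 e"]) (auto simp: X_def)
qed

lemma at_point_le: "at_point p m \<Longrightarrow> le p m" "at_point p m \<Longrightarrow> le m p"
  unfolding at_point_def le_def using Ap_0 Ap_aeps
  by (metis shift_0 shift_shift aeps_twice)+

text \<open>
  Descent on the sum of the coordinates.
\<close>

lemma min_below: "p \<in> Q \<Longrightarrow> \<exists>m\<in>M. le m p"
proof (induction "nat (\<Sum>r\<in>gprimes G. co (snd p) r)" arbitrary: p rule: less_induct)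
  case less
  show ?case
  proof (cases "p \<in> M")
    case True
    then show ?thesis using le_shift[of 0 p] by auto
  next
    case False
    then obtain q where q: "q \<in> Q" "le q p" "\<not> le p q" using less.prems by (auto simp: min_iff)
    then obtain w where w: "w \<in> Ap" "p = q \<oplus>\<^sub>a w" by (auto simp: le_def)
    have "asupp w \<noteq> {}"
    proof
      assume "asupp w = {}"
      then have "snd w = 0" by (simp add: asupp_def)
      then have "w + w = 0" by (cases "fst w") (simp_all add: prod_eq_iff)
      then have "p \<oplus>\<^sub>a w = q" using w by simp
      then show False using q(3) w(1) by (metis le_shift)
    qed
    then obtain r where r: "r \<in> gprimes G" "co w r > 0"
      using w by (auto simp: Ap_def mem_asupp order_less_le set_eq_iff subset_iff)
    have nn: "co w r \<ge> 0" "co (snd q) r \<ge> 0" for r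
      using w qc_pts[OF q(1)] by (auto simp: Ap_def pts_def)
    have "(\<Sum>r\<in>gprimes G. co (snd q) r) < (\<Sum>r\<in>gprimes G. co (snd p) r)"
      using P(1) r nn w by (intro sum_strict_mono_ex1) auto
    moreover have "0 \<le> (\<Sum>r\<in>gprimes G. co (snd q) r)" using nn by (intro sum_nonneg) auto
    ultimately have "\<exists>m\<in>M. le m q" using less.hyps[OF _ q(1)] by simp
    then show ?thesis using q(2) affine_le_trans by blast
  qed
qed

lemma X_below: "p \<in> Q \<Longrightarrow> \<exists>x\<in>X. le x p"
  using min_below X_rep at_point_le affine_le_trans by metis

lemma finite_X: "finite X"
proof -
  have "X \<subseteq> I0 ` EE" by (auto simp: X_def)
  then show ?thesis using finE finite_subset by blast
qed

sublocale gbs_class "gverts G" "gedges G" "grev G" "gprimes G" X Q S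
  using finite_X X_min qc_pts supp_qc_primes qc_up qc_gap X_below by unfold_locales (auto simp: min_iff)

lemma linked_init: "linked I0"
  unfolding linked_def using qc_qle qc_closed by blast

definition eta :: "'v apoint \<Rightarrow> 'e" where
  "eta x = (THE e. e \<in> EE \<and> at_point (I0 e) x)"

lemma eta: "x \<in> X \<Longrightarrow> eta x \<in> EE \<and> I0 (eta x) = x"
proof -
  assume x: "x \<in> X"
  then obtain e where e: "e \<in> EE" "I0 e = x" by (auto simp: X_def)
  have "\<exists>!e. e \<in> EE \<and> at_point (I0 e) x" using cl X_min[OF x] by (simp add: clean_def)
  then have "eta x = e" unfolding eta_def using e by (intro the1_equality) (auto simp: at_point_def)
  then show ?thesis using e by simp
qed

lemma eta_I0: "e \<in> EE \<Longrightarrow> I0 e \<in> M \<Longrightarrow> e = eta (I0 e) \<and> I0 e \<in> X"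
proof -
  assume e: "e \<in> EE" "I0 e \<in> M"
  then have "\<exists>!f. f \<in> EE \<and> at_point (I0 f) (I0 e)" using cl by (simp add: clean_def)
  then show ?thesis using e eta[of "I0 e"] by (auto simp: X_def at_point_def)
qed

lemma eta_range: "e \<in> EE \<Longrightarrow> e \<in> eta ` X \<longleftrightarrow> I0 e \<in> M"
  using eta eta_I0[of e] X_min by force

lemma above_X:
  assumes e: "e \<in> EE" "e \<notin> eta ` X"
  shows "\<exists>x\<in>X. \<exists>a\<in>Full. I0 e = x \<oplus>\<^sub>a a"
proof -
  have "I0 e \<notin> M" using e eta_range by blast
  moreover obtain m where m: "m \<in> M" "at_point (I0 e) m \<or> full_gap_above G Q m (I0 e)"
    using gaps e(1) by (auto simp: full_support_gaps_def)
  ultimately obtain w where w: "w \<in> Ap" "I0 e = m \<oplus>\<^sub>a w" "asupp w = S"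
    using min_at[OF m(1), of "I0 e"] unfolding full_gap_above_def init_simps by blast
  obtain x where x: "x \<in> X" "at_point x m" using X_rep[OF m(1)] by blast
  have "m = x \<or> m = x \<oplus>\<^sub>a aeps" using x(2) by (auto simp: at_point_def)
  then have "I0 e = x \<oplus>\<^sub>a w \<or> I0 e = x \<oplus>\<^sub>a (w + aeps)" using w by (auto simp: add.commute)
  moreover have "w \<in> Full" "w + aeps \<in> Full"
    using w(3) w(1) Ap_add[OF w(1) Ap_aeps] unfolding Full_def by simp_all
  ultimately show ?thesis using x by blast
qed

lemma layout_init: "\<exists>\<sigma> \<alpha>. layout I0 eta \<sigma> \<alpha>"
proof -
  have "\<forall>e. \<exists>x a. e \<in> EE \<and> e \<notin> eta ` X \<longrightarrow> x \<in> X \<and> a \<in> Full \<and> I0 e = x \<oplus>\<^sub>a a"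
    using above_X by blast
  then obtain \<sigma> \<alpha> where "\<forall>e. e \<in> EE \<and> e \<notin> eta ` X \<longrightarrow> \<sigma> e \<in> X \<and> \<alpha> e \<in> Full \<and> I0 e = \<sigma> e \<oplus>\<^sub>a \<alpha> e"
    by metis
  moreover have "inj_on eta X" using eta by (metis inj_onI)
  moreover have "grev G (eta x) \<notin> eta ` X" if x: "x \<in> X" for x
  proof
    assume "grev G (eta x) \<in> eta ` X"
    then have "ater G (eta x) \<in> M" "aini G (eta x) \<in> M"
      using eta[OF x] X_min[OF x] eta_range[of "grev G (eta x)"] init_simps by auto
    then show False using cl eta[OF x] by (auto simp: clean_def)
  qed
  ultimately have "layout I0 eta \<sigma> \<alpha>" unfolding layout_def using eta by auto
  then show ?thesis by blast
qed

text \<open>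
  Without a floating edge, every edge would have an end at a minimal point, and there would be
  at most as many edges as minimal points.
\<close>

lemma float_init: "\<exists>f. floats eta f"
proof (rule ccontr)
  assume "\<not> ?thesis"
  then have *: "e \<in> eta ` X \<or> grev G e \<in> eta ` X" if "e \<in> EE" for e using that by (auto simp: floats_def)
  let ?p = "\<lambda>m. {m, m \<oplus>\<^sub>a aeps}" and ?g = "\<lambda>e. {e, grev G e}"
  have "?g ` EE \<subseteq> (\<lambda>x. ?g (eta x)) ` X"
  proof
    fix z assume "z \<in> ?g ` EE"
    then obtain e where e: "e \<in> EE" "z = ?g e" by auto
    from *[OF e(1)] show "z \<in> (\<lambda>x. ?g (eta x)) ` X"
    proof
      assume "grev G e \<in> eta ` X"
      then obtain x where "x \<in> X" "eta x = grev G e" by auto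
      then show ?thesis using e by (intro image_eqI[of _ _ x]) auto
    qed (use e in auto)
  qed
  then have "card (?g ` EE) \<le> card X"
    using finite_X card_mono[of "(\<lambda>x. ?g (eta x)) ` X" "?g ` EE"] card_image_le[OF finite_X, of "\<lambda>x. ?g (eta x)"]
    by simp
  also have "\<dots> = card (?p ` X)"
  proof (rule card_image[symmetric], rule inj_onI)
    fix x y assume "x \<in> X" "y \<in> X" "?p x = ?p y"
    then show "x = y" using X_unique[of x y] by (auto simp: at_point_def)
  qed
  also have "\<dots> \<le> card (?p ` M)"
  proof (rule card_mono)
    have "?p ` M \<subseteq> ?p ` X"
    proof
      fix z assume "z \<in> ?p ` M"
      then obtain m where m: "m \<in> M" "z = ?p m" by auto
      obtain x where "x \<in> X" "at_point x m" using X_rep[OF m(1)] by blast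
      then have "x \<in> X" "z = ?p x" using m by (auto simp: at_point_def)
      then show "z \<in> ?p ` X" by blast
    qed
    then show "finite (?p ` M)" using finite_X finite_subset by blast
  qed (use X_min in auto)
  finally show False using fp by (simp add: floating_pieces_def)
qed

section \<open>Families and the normal form\<close>

definition family_of :: "'v apoint \<Rightarrow> 'v apoint set" where
  "family_of p = {q \<in> Q. fam p q}"

lemma families_family_of: "families G Q = family_of ` Q"
  by (auto simp: families_def quotient_def family_of_def same_family_def fam_def)

lemma family_of_eq: "q \<in> family_of p \<Longrightarrow> family_of q = family_of p"
  unfolding family_of_def using fam_trans fam_sym by blast

lemma family_eq:
  assumes "F \<in> families G Q" "p \<in> F" shows "p \<in> Q \<and> F = family_of p"
proof -
  obtain z where z: "F = family_of z" using assms(1) unfolding families_family_of by blast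
  then have "p \<in> Q" using assms(2) by (simp add: family_of_def)
  then show ?thesis using z family_of_eq assms(2) by blast
qed

lemma fam_at: "at_point p q \<Longrightarrow> fam p q"
  by (auto simp: at_point_def fam_def mem_asupp subset_iff)

lemma at_mem: "F \<in> families G Q \<Longrightarrow> p \<in> F \<Longrightarrow> at_point q p \<Longrightarrow> q \<in> Q \<Longrightarrow> q \<in> F"
  using family_eq[of F p] fam_at[OF at_point_sym, of q p] by (auto simp: family_of_def)

text \<open>
  The minimal point \<open>m\<close> may differ by \<open>aeps\<close> from its representative in \<open>X\<close>; this does
  not affect the support of the gap.
\<close>

lemma full_gap_high:
  assumes x: "x \<in> X" and y: "m \<in> M" "fam x m" and a: "a \<in> High height"
  shows "full_gap_above G Q m (x \<oplus>\<^sub>a a)"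
proof -
  obtain y where yX: "y \<in> X" "at_point y m" using X_rep[OF y(1)] by blast
  have "fam x y" using fam_trans[OF y(2)] fam_at[OF at_point_sym[OF yX(2)]] .
  then obtain c where c: "c \<in> Full" "x \<oplus>\<^sub>a a = y \<oplus>\<^sub>a c" using high_move[OF x yX(1) _ a] by blast
  have "y = m \<or> y = m \<oplus>\<^sub>a aeps" using yX by (auto simp: at_point_def)
  then have "x \<oplus>\<^sub>a a = m \<oplus>\<^sub>a c \<or> x \<oplus>\<^sub>a a = m \<oplus>\<^sub>a (c + aeps)" using c by (auto simp: add.commute)
  moreover have "c \<in> Ap" "c + aeps \<in> Ap" "asupp c = S" "asupp (c + aeps) = S"
    using c Full_supp by auto
  ultimately show ?thesis unfolding full_gap_above_def init_simps by blast
qed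

lemma min_not_above:
  assumes x: "x \<in> Q" and a: "a \<in> Full" shows "x \<oplus>\<^sub>a a \<notin> M"
proof
  assume m: "x \<oplus>\<^sub>a a \<in> M"
  have "le x (x \<oplus>\<^sub>a a)" using a by auto
  then have "le (x \<oplus>\<^sub>a a) x" using m x unfolding min_iff by blast
  then obtain w where w: "w \<in> Ap" "x = x \<oplus>\<^sub>a (a + w)" by (auto simp: le_def)
  then have "a + w = 0" by (metis add_cancel_right_right snd_shift)
  obtain r where r: "r \<in> S" using S0 by auto
  have "co (a + w) r > 0" using Full_pos[OF a r] w by (simp add: Ap_def add_pos_nonneg)
  then show False unfolding \<open>a + w = 0\<close> by simp
qed

text \<open>
  The root is placed at a minimal point of \<open>F0\<close>.  The set \<open>T\<close> consists of the minimal points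
  outside \<open>F0\<close> other than the chosen ones, and \<open>t\<close> sends each of them to the chosen minimal point
  of its family.  The class, its minimal points and its families are expressed through \<open>qle\<close>
  and \<open>le\<close>, so they are the same for the resulting graph.
\<close>

lemma reaches_normal_form:
  assumes F0: "F0 \<in> families G Q" and mF: "\<forall>F\<in>families G Q - {F0}. mF F \<in> F \<inter> M"
  shows "\<exists>G'. move\<^sup>*\<^sup>* G G' \<and> normal_form G' Q F0 mF"
proof -
  obtain p0 where p0: "p0 \<in> Q" "F0 = family_of p0" using F0 by (auto simp: families_family_of)
  obtain x0 where x0: "x0 \<in> X" "le x0 p0" using X_below[OF p0(1)] by blast
  have F0': "F0 = family_of x0"
    using fam_le[OF X_Q[OF x0(1)] p0(1) x0(2)] p0 family_of_eq[of p0 x0] by (simp add: family_of_def)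
  define T where "T = {x \<in> X. family_of x \<noteq> F0 \<and> \<not> at_point x (mF (family_of x))}"
  define t where "t x = (SOME y. y \<in> X \<and> at_point y (mF (family_of x)))" for x
  have t: "t x \<in> X \<and> at_point (t x) (mF (family_of x)) \<and> family_of (t x) = family_of x" if x: "x \<in> X" "family_of x \<noteq> F0" for x
  proof -
    have m: "mF (family_of x) \<in> family_of x" "mF (family_of x) \<in> M" using mF x X_Q by (auto simp: families_family_of)
    have "\<exists>y. y \<in> X \<and> at_point y (mF (family_of x))" using X_rep[OF m(2)] by blast
    from someI_ex[OF this] have a: "t x \<in> X \<and> at_point (t x) (mF (family_of x))" unfolding t_def .
    then have "t x \<in> family_of x" using at_mem[of "family_of x" "mF (family_of x)" "t x"] m(1) x X_Q by (auto simp: families_family_of)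
    then show ?thesis using a family_of_eq by blast
  qed
  obtain \<sigma>0 \<alpha>0 where s0: "layout I0 eta \<sigma>0 \<alpha>0" using layout_init by blast
  obtain f where f: "floats eta f" using float_init by blast
  have T1: "T \<subseteq> X" "x0 \<notin> T" by (auto simp: T_def F0')
  have T2: "t ` T \<subseteq> X - T"
  proof
    fix y assume "y \<in> t ` T"
    then obtain x where x: "x \<in> T" "y = t x" by blast
    then have "y \<in> X" "at_point y (mF (family_of y))" using t[of x] unfolding T_def by auto
    then show "y \<in> X - T" by (simp add: T_def)
  qed
  obtain I \<eta> \<sigma> \<alpha> where I: "cmove\<^sup>*\<^sup>* I0 I" and s: "layout I \<eta> \<sigma> \<alpha>"
    and hi: "\<forall>n\<in>EE - \<eta> ` X. \<alpha> n \<in> High height" and sT: "\<forall>x\<in>T. \<sigma> (grev G (\<eta> x)) = t x"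
    and sn: "\<forall>n\<in>EE - \<eta> ` X - grev G ` \<eta> ` T. \<sigma> n = x0"
    using rearrange[where T = T and t = t and h = height, OF s0 config_init linked_init f x0(1) T1 T2]
    by (elim exE conjE) (rule that; assumption)
  obtain G' where G': "move\<^sup>*\<^sup>* G G'" "realizes G' I" using realize_reach[OF realizes_init config_init I] by blast
  have c: "config I" "qle I = qle I0" using config_reach[OF I config_init] by auto
  note R = re_simps[OF G'(2)] re_ater[OF G'(2)] re_ale[OF G'(2)]
  note S' = layout_eta[OF s] layout_non[OF s]
  have qc: "qconj G' p q \<longleftrightarrow> qconj G p q" if "p \<in> pts" "q \<in> pts" for p q
    using that by (simp add: re_qconj[OF G'(2) c(1)] re_qconj[OF realizes_init config_init] c(2))
  have rv': "grev G' e = grev G e" if "e \<in> EE" for e using R(3)[OF that] .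
  have supp: "supp_qc G' Q = S"
  proof -
    have "qconj G' (p \<oplus>\<^sub>a u) p \<longleftrightarrow> qconj G (p \<oplus>\<^sub>a u) p" if "p \<in> Q" "u \<in> Ap" for p u
      using that qc_pts[of p] by (intro qc) auto
    then show ?thesis unfolding supp_qc_def R init_simps by blast
  qed
  have M': "min_qc G' Q = M" by (simp add: min_qc_def R init_simps)
  have fam': "families G' Q = families G Q"
    by (simp add: families_def same_family_def supp)
  have full': "full_gap_above G' Q m p \<longleftrightarrow> full_gap_above G Q m p" for m p
    by (simp add: full_gap_above_def supp R init_simps)
  have IQ: "I e \<in> Q" if "e \<in> EE" for e
  proof (cases "e \<in> \<eta> ` X")
    case True
    then show ?thesis using S'(3) X_Q by auto
  next
    case False
    then show ?thesis
      using qc_up[OF X_Q[OF S'(7)[OF that False]], of "\<alpha> e"] S'(8,9)[OF that False] Full_supp[of "\<alpha> e"] by simp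
  qed
  have one': "one_qc_class G' Q"
  proof -
    obtain p where p: "p \<in> pts" "Q = {q \<in> pts. qconj G p q}"
      using one by (auto simp: one_qc_class_def qc_class_def init_simps)
    have "Q = {q \<in> pts. qconj G' p q}" unfolding p(2) using qc[OF p(1)] by blast
    then have "qc_class G' Q" using p(1) unfolding qc_class_def R by blast
    then show ?thesis using IQ by (simp add: one_qc_class_def R)
  qed
  have I_M: "e \<in> \<eta> ` X \<longleftrightarrow> I e \<in> M" if e: "e \<in> EE" for e
  proof
    assume "e \<in> \<eta> ` X"
    then show "I e \<in> M" using S'(3) X_min by auto
  next
    assume m: "I e \<in> M"
    show "e \<in> \<eta> ` X"
    proof (rule ccontr)
      assume n: "e \<notin> \<eta> ` X"
      then show False using min_not_above[OF X_Q[OF S'(7)[OF e n]] S'(8)[OF e n]] m S'(9)[OF e n] by simp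
    qed
  qed
  have at_eta: "\<exists>x\<in>X. e = \<eta> x \<and> at_point x m"
    if e: "e \<in> EE" "at_point (aini G' e) m" and m: "m \<in> M" for e m
  proof -
    have a: "at_point (I e) m" using e R(5) by simp
    then obtain x where "x \<in> X" "e = \<eta> x" using I_M[OF e(1)] min_at[OF m a] by blast
    then show ?thesis using a S'(3) by auto
  qed
  have clean': "clean G' Q"
    unfolding clean_def M' R
  proof (intro conjI ballI)
    fix m assume m: "m \<in> M"
    obtain x where x: "x \<in> X" "at_point x m" using X_rep[OF m] by blast
    show "\<exists>!e. e \<in> EE \<and> at_point (aini G' e) m"
    proof (rule ex1I[of _ "\<eta> x"])
      show "\<eta> x \<in> EE \<and> at_point (aini G' (\<eta> x)) m" using x S'(1,3) R by simp
      fix e assume e: "e \<in> EE \<and> at_point (aini G' e) m"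
      then obtain y where y: "y \<in> X" "e = \<eta> y" "at_point y m" using at_eta[of e m] m by blast
      have "y = x" using X_unique[OF y(1) x(1)] at_point_trans[OF y(3) at_point_sym[OF x(2)]] .
      then show "e = \<eta> x" using y by simp
    qed
  next
    show "\<not> (\<exists>e\<in>EE. aini G' e \<in> M \<and> ater G' e \<in> M)"
      using I_M S'(4) R rv_simps(1) by (metis (no_types, lifting) imageE)
  qed
  have float': "floating_pieces G' Q"
  proof -
    have "(\<lambda>e. {e, grev G' e}) ` EE = (\<lambda>e. {e, grev G e}) ` EE" using rv' by auto
    then show ?thesis using fp unfolding floating_pieces_def M' R by metis
  qed
  have above: "I e \<in> family_of (\<sigma> e) \<and> (\<forall>m\<in>family_of (\<sigma> e) \<inter> M. full_gap_above G Q m (I e))"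
    if e: "e \<in> EE" "e \<notin> \<eta> ` X" for e
  proof
    have sX: "\<sigma> e \<in> X" "\<sigma> e \<in> Q" using S'(7)[OF e] X_Q by auto
    have "fam (\<sigma> e) (I e)" using fam_le[OF sX(2) IQ[OF e(1)]] S'(8,9)[OF e] by (auto simp: le_def)
    then show "I e \<in> family_of (\<sigma> e)" using IQ[OF e(1)] by (simp add: family_of_def)
    show "\<forall>m\<in>family_of (\<sigma> e) \<inter> M. full_gap_above G Q m (I e)"
      using full_gap_high[OF sX(1)] hi e S'(9)[OF e] by (auto simp: family_of_def)
  qed
  have high: "ater G' e \<in> family_of z \<and> (\<forall>m\<in>family_of z \<inter> M. full_gap_above G Q m (ater G' e))"
    if "x \<in> X" "e = \<eta> x" "\<sigma> (grev G (\<eta> x)) = z" for e x z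
    using above[of "grev G e"] that S'(1,4)[of x] R(8,9) by simp
  have not_T: "\<sigma> (grev G (\<eta> x)) = x0" if "x \<in> X" "x \<notin> T" for x
  proof -
    have "grev G (\<eta> x) \<notin> grev G ` \<eta> ` T" using layout_rv_eq[OF s that(1)] that(2) T1(1) by blast
    then show ?thesis using sn S'(1,4)[OF that(1)] rv_simps(1) by blast
  qed
  have "normal_form G' Q F0 mF"
    unfolding normal_form_def M' supp fam' full' R(2)
  proof (intro conjI ballI impI allI)
    show "gbs_graph G'" by (rule R)
    show "one_qc_class G' Q" "S \<noteq> {}" "clean G' Q" "floating_pieces G' Q" "F0 \<in> families G Q"
      using one' S0 clean' float' F0 by auto
  next
    fix F assume "F \<in> families G Q - {F0}"
    then show "mF F \<in> F \<inter> M" using mF by blast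
  next
    fix F e assume F: "F \<in> families G Q - {F0}" and e: "e \<in> EE" "at_point (aini G' e) (mF F)"
    have m: "mF F \<in> F" "mF F \<in> M" using mF F by auto
    obtain x where x: "x \<in> X" "e = \<eta> x" "at_point x (mF F)" using at_eta[OF e m(2)] by blast
    have "x \<in> F" using at_mem[OF _ m(1) x(3)] F X_Q[OF x(1)] by blast
    then have "family_of x = F" using family_eq F by blast
    then have "x \<notin> T" using x by (simp add: T_def)
    note h = high[OF x(1,2) not_T[OF x(1) this], folded F0']
    show "ater G' e \<in> F0" using h by blast
    fix m' assume "m' \<in> F0 \<inter> M"
    then show "full_gap_above G Q m' (ater G' e)" using h by blast
  next
    fix F m e assume F: "F \<in> families G Q" and m: "m \<in> F \<inter> M" and nm: "F = F0 \<or> \<not> at_point m (mF F)"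
      and e: "e \<in> EE" "at_point (aini G' e) m"
    obtain x where x: "x \<in> X" "e = \<eta> x" "at_point x m" using at_eta[OF e] m by blast
    have "x \<in> F" using at_mem[OF F _ x(3)] m X_Q[OF x(1)] by blast
    then have cx: "family_of x = F" using family_eq F by blast
    have "family_of (\<sigma> (grev G (\<eta> x))) = F"
    proof (cases "F = F0")
      case True
      then have "x \<notin> T" using cx by (simp add: T_def)
      then show ?thesis using not_T x(1) F0' True by simp
    next
      case False
      then have "\<not> at_point x (mF F)" using nm at_point_trans[OF at_point_sym[OF x(3)]] by blast
      then have "x \<in> T" using False cx x(1) by (simp add: T_def)
      then show ?thesis using sT t[OF x(1)] False cx by simp
    qed
    note h = high[OF x(1,2) HOL.refl, unfolded this]
    show "ater G' e \<in> F" using h by blast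
    fix m' assume "m' \<in> F \<inter> M"
    then show "full_gap_above G Q m' (ater G' e)" using h by blast
  next
    fix e p assume e: "floating_edge G' Q e" and p: "p \<in> {aini G' e, ater G' e}"
    have eE: "e \<in> EE" "I e \<notin> M" "I (grev G e) \<notin> M" using e by (auto simp: floating_edge_def M' R)
    obtain n where n: "n \<in> EE" "n \<notin> \<eta> ` X" "grev G n \<notin> \<eta> ` X" "p = I n"
    proof -
      have "e \<notin> \<eta> ` X" "grev G e \<notin> \<eta> ` X" using eE I_M rv_simps(1) by blast+
      moreover have "p = I e \<or> p = I (grev G e)" using p eE(1) R by auto
      ultimately show ?thesis using that[of e] that[of "grev G e"] eE(1) by auto
    qed
    have "n \<notin> grev G ` \<eta> ` T" using n(3) T1(1) S'(1) by auto
    then have "\<sigma> n = x0" using sn n by blast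
    note h = above[OF n(1,2), unfolded this, folded F0' n(4)]
    show "p \<in> F0" using h by blast
    fix m' assume "m' \<in> F0 \<inter> M"
    then show "full_gap_above G Q m' p" using h by blast
  qed
  then show ?thesis using G'(1) by blast
qed

end

theorem proposition5p14:
  fixes G :: "('v, 'e) gbs" and Q F0 :: "'v apoint set"
    and mF :: "'v apoint set \<Rightarrow> 'v apoint"
  assumes "gbs_graph G" and "totally_reduced G"
    and "one_qc_class G Q" and "supp_qc G Q \<noteq> {}"
    and "clean G Q" and "floating_pieces G Q" and "full_support_gaps G Q"
    and "F0 \<in> families G Q"
    and "\<forall>F\<in>families G Q - {F0}. mF F \<in> F \<inter> min_qc G Q"
  shows "\<exists>G'. move\<^sup>*\<^sup>* G G' \<and> normal_form G' Q F0 mF"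
proof -
  interpret clean_gbs G Q
    using assms(1,3-7) by unfold_locales
  show ?thesis using assms(8,9) by (rule reaches_normal_form)
qed

end
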